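(* Let $1<p<\infty$, $p\neq 2$, let $\Omega\subset\mathbb{R}^2$ be a domain and let $u=(u^1,u^2)\in C^2(\Omega,\mathbb{R}^2)$ be a $p$-harmonic map. Let $f$ and $g$ be the complex gradients of $u^1$ and $u^2$. Let $C>0$ be a constant, let $B=B(z_0,R)$ be a ball in $\Omega$, and let $c\in\mathbb{R}$ be such that $\{u^1=c\}\cap B\neq\emptyset$. Suppose that one of the following holds: (1) the Euclidean norms of the Hessians $\|H(u^1)\|$, $\|H(u^2)\|$ are in $L^2(B)$ and $|f|>C$ in $B$; or (2) $f_z,g_z\in L^2(B)$ and $|f|>C$ in $B$; or (3) $f$ and $g$ are quasiregular in $B$ and $|f|>C$ in $B$; or (4) $f$ and $g$ are quasiregular in $B$ and $|f(z)|>C|z-z_0|^{\alpha}$ in $B$ with $\alpha<1$. Then $k_{u^1}\in L^1(B)$. Moreover, suppose in addition that the singular set of $u^1$ consists of isolated critical points only and that there are no such points in $\{u^1=c\}\cap B$. Then the length $L$ of the level curve $\{z\in B: u^1(z)=c\}$ satisfies $$L\le \int_{\Omega\cap B}|k_{u^1}|+2\pi R.$$ The same results hold for $u^2$, i.e. with $u^1$ replaced by $u^2$ in the level curve, in the curvature function and in the condition on critical points, and with the lower bounds on $|f|$ in (1)–(4) replaced by the same lower bounds on $|g|$.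
   Context: For $1<p<\infty$, a map $u=(u^1,u^2):\Omega\subset\mathbb{R}^2\to\mathbb{R}^2$ is $p$-harmonic if it is a (weak) solution of the system $\operatorname{div}(|Du|^{p-2}\nabla u^1)=0$, $\operatorname{div}(|Du|^{p-2}\nabla u^2)=0$ in $\Omega$, where $|Du|^2=|\nabla u^1|^2+|\nabla u^2|^2$. The complex gradients are $f=\tfrac12(u^1_x-iu^1_y)$ and $g=\tfrac12(u^2_x-iu^2_y)$; $f_z=\tfrac12(f_x-if_y)$ and $f_{\bar z}=\tfrac12(f_x+if_y)$ denote the Wirtinger derivatives. A map $F$ is quasiregular in a planar domain if there is a constant $k$ such that $\dfrac{|F_{\bar z}|}{|F_z|}\le k<1$ a.e. in that domain. At points where $\nabla v\ne0$, the curvature function of the level curves of a $C^2$ function $v$ is $$k_v=-\frac{v_y^2v_{xx}-2v_xv_yv_{xy}+v_x^2v_{yy}}{|\nabla v|^3}=-\operatorname{div}\left(\frac{\nabla v}{|\nabla v|}\right).$$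
   Formalization: Under (3) or (4), the claim that the curvature is in L^1(B) is made only when the closed ball lies in Ω, since it fails for balls touching the boundary of Ω; (1), (2) and the length bound need only B ⊂ Ω. *)

theory Defs
  imports "HOL-Analysis.Analysis"
begin

text \<open>The plane is the type \<^typ>\<open>complex\<close> (with \<open>z = x + iy\<close>); maps into the plane take
  values in \<^typ>\<open>real^2\<close>, so that the components of \<open>u\<close> are \<open>\<lambda>z. u z $ 1\<close> and \<open>\<lambda>z. u z $ 2\<close>.\<close>

definition dx :: "(complex \<Rightarrow> 'a::real_normed_vector) \<Rightarrow> complex \<Rightarrow> 'a" where
  "dx v z = frechet_derivative v (at z) 1"

definition dy :: "(complex \<Rightarrow> 'a::real_normed_vector) \<Rightarrow> complex \<Rightarrow> 'a" where
  "dy v z = frechet_derivative v (at z) \<i>"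

text \<open>Intended for open \<open>S\<close>, where this is the usual class \<open>C^k\<close>.\<close>

primrec Ck_on :: "nat \<Rightarrow> complex set \<Rightarrow> (complex \<Rightarrow> 'a::real_normed_vector) \<Rightarrow> bool" where
  "Ck_on 0 S v \<longleftrightarrow> continuous_on S v"
| "Ck_on (Suc k) S v \<longleftrightarrow>
     (\<forall>z\<in>S. v differentiable (at z)) \<and> Ck_on k S (dx v) \<and> Ck_on k S (dy v)"

definition grad :: "(complex \<Rightarrow> real) \<Rightarrow> complex \<Rightarrow> real^2" where
  "grad v z = vector [dx v z, dy v z]"

text \<open>The norm of \<^typ>\<open>real^2^2\<close> is the Euclidean (Frobenius) norm of matrices.\<close>

definition hessian :: "(complex \<Rightarrow> real) \<Rightarrow> complex \<Rightarrow> real^2^2" where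
  "hessian v z = vector [vector [dx (dx v) z, dy (dx v) z],
                         vector [dx (dy v) z, dy (dy v) z]]"

definition cgrad :: "(complex \<Rightarrow> real) \<Rightarrow> complex \<Rightarrow> complex" where
  "cgrad v z = (of_real (dx v z) - \<i> * of_real (dy v z)) / 2"

definition wirt_z :: "(complex \<Rightarrow> complex) \<Rightarrow> complex \<Rightarrow> complex" where
  "wirt_z F z = (dx F z - \<i> * dy F z) / 2"

definition wirt_zbar :: "(complex \<Rightarrow> complex) \<Rightarrow> complex \<Rightarrow> complex" where
  "wirt_zbar F z = (dx F z + \<i> * dy F z) / 2"

definition norm_Du :: "(complex \<Rightarrow> real^2) \<Rightarrow> complex \<Rightarrow> real" where
  "norm_Du u z = sqrt ((norm (grad (\<lambda>w. u w $ 1) z))\<^sup>2 + (norm (grad (\<lambda>w. u w $ 2) z))\<^sup>2)"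

definition test_function :: "complex set \<Rightarrow> (complex \<Rightarrow> real) \<Rightarrow> bool" where
  "test_function \<Omega> \<phi> \<longleftrightarrow> (\<forall>k. Ck_on k UNIV \<phi>) \<and>
     (\<exists>K. compact K \<and> K \<subseteq> \<Omega> \<and> (\<forall>z. z \<notin> K \<longrightarrow> \<phi> z = 0))"

text \<open>The weak form of the system, written with classical derivatives; it is meant for maps of
  class \<open>C^1\<close>, whose weak and classical derivatives agree. Where \<open>Du = 0\<close> the field
  \<open>|Du|^(p-2) \<nabla>u\<^sup>i\<close> is \<open>0\<close>, also for \<open>p < 2\<close>, because \<open>0 powr a = 0\<close>.\<close>

definition p_harmonic_map :: "real \<Rightarrow> complex set \<Rightarrow> (complex \<Rightarrow> real^2) \<Rightarrow> bool" where
  "p_harmonic_map p \<Omega> u \<longleftrightarrow>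
     (\<forall>j \<phi>. test_function \<Omega> \<phi> \<longrightarrow>
        (LINT z:\<Omega>|lebesgue.
           norm_Du u z powr (p - 2) * (grad (\<lambda>w. u w $ j) z \<bullet> grad \<phi> z)) = 0)"

text \<open>The bound on the ratio is cleared of denominators: dividing would give the value \<open>0\<close> to
  \<open>|F_zbar| / |F_z|\<close> wherever \<open>F_z = 0\<close>, whatever \<open>F_zbar\<close> is.\<close>

definition quasiregular_on :: "complex set \<Rightarrow> (complex \<Rightarrow> complex) \<Rightarrow> bool" where
  "quasiregular_on S F \<longleftrightarrow>
     (\<exists>k. 0 \<le> k \<and> k < 1 \<and>
        (AE z in lebesgue. z \<in> S \<longrightarrow> norm (wirt_zbar F z) \<le> k * norm (wirt_z F z)))"

definition L2_on :: "complex set \<Rightarrow> (complex \<Rightarrow> 'a::real_normed_vector) \<Rightarrow> bool" where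
  "L2_on S F \<longleftrightarrow> set_borel_measurable lebesgue S F \<and>
     set_integrable lebesgue S (\<lambda>z. (norm (F z))\<^sup>2)"

text \<open>Meaningful where \<open>\<nabla>v \<noteq> 0\<close>; elsewhere the value is \<open>0\<close>.\<close>

definition level_curvature :: "(complex \<Rightarrow> real) \<Rightarrow> complex \<Rightarrow> real" where
  "level_curvature v z =
     - (((dy v z)\<^sup>2 * dx (dx v) z - 2 * dx v z * dy v z * dy (dx v) z + (dx v z)\<^sup>2 * dy (dy v) z)
        / (norm (grad v z)) ^ 3)"

text \<open>One-dimensional Hausdorff measure, which on regular curves is the length. Boundedness of
  the covering sets is required separately because \<^const>\<open>diameter\<close> is unspecified on unbounded
  sets.\<close>

definition hausdorff1 :: "'a::metric_space set \<Rightarrow> ennreal" where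
  "hausdorff1 A =
     (SUP \<delta>\<in>{0<..}.
        INF U\<in>{U :: nat \<Rightarrow> 'a set. A \<subseteq> (\<Union>n. U n) \<and> (\<forall>n. bounded (U n) \<and> diameter (U n) \<le> \<delta>)}.
          (\<Sum>n. ennreal (diameter (U n))))"

end

theory Submission
  imports Defs
begin

text \<open>
  Let \<open>v\<close> be the component in question and \<open>N = \<nabla>v / |\<nabla>v|\<close>, so that the curvature of the level
  curves is \<open>k = - div N\<close>. Each of the four hypotheses makes \<open>\<nabla>v\<close> nonzero on the punctured ball
  \<open>B - {z\<^sub>0}\<close>; under the last one \<open>z\<^sub>0\<close> itself may be critical.

  Integrability. Pointwise \<open>|k| \<le> 2 h / |\<nabla>v|\<close> if \<open>h\<close> bounds the entries of the Hessian
  (\<open>level_curvature_bound\<close>). Square integrable Hessians and a positive lower bound for the gradient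
  are therefore enough. If only \<open>f\<^sub>z\<close> and \<open>g\<^sub>z\<close> are known to be square integrable, then these encode the
  trace-free parts of the two Hessians, and the traces are recovered from the system: away from
  critical points the weak equation can be integrated by parts into a pointwise one, a linear system for
  the two Laplacians whose matrix is uniformly positive because \<open>p > 1\<close>
  (\<open>p_harmonic_map_nondivergence_form\<close>, \<open>laplacians_le_trace_free_parts\<close>). If the closed ball lies in the
  domain, then the Hessians are bounded on it, and \<open>|z - z\<^sub>0|\<^sup>-\<^sup>\<alpha>\<close> with \<open>\<alpha> < 1\<close> is integrable in the plane.

  Length. The heuristic is Green's formula: integrating \<open>div N = - k\<close> over \<open>{v > c} \<inter> B\<close> gives the
  length of \<open>{v = c}\<close> as the integral of \<open>k\<close> over this set plus the flux of \<open>N\<close> through an arc of the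
  circle, at most \<open>2\<pi>R\<close>. To avoid irregular domains, \<open>div N = - k\<close> is tested with \<open>\<psi>(v) \<phi>\<close>, where
  \<open>\<psi>\<close> is a \<open>C\<^sup>1\<close> step across a thin band \<open>|v - c| < \<epsilon>\<close> and \<open>\<phi>\<close> is a radial cutoff that vanishes near
  \<open>\<partial>B\<close> and near \<open>z\<^sub>0\<close>. This bounds the mass \<open>\<integral> \<psi>'(v) |\<nabla>v|\<close> of the band on compact subsets of the
  punctured ball by half of \<open>\<integral> |k| + 2\<pi>R\<close>, up to an arbitrarily small error, the half coming from the
  choice of a step from \<open>- 1/2\<close> to \<open>1/2\<close> (\<open>band_mass_le\<close>).

  Conversely, as \<open>\<epsilon> \<rightarrow> 0\<close> a small ball of radius \<open>r\<close> centered on the curve carries a mass of almost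
  \<open>2 r\<close> (\<open>band_mass_ge\<close>). So finitely many disjoint such balls have radii with \<open>\<Sum> 2 r\<close> at most about
  half of \<open>\<integral> |k| + 2\<pi>R\<close>. Roughly doubling the radii of a maximal disjoint family of balls of slowly
  varying radii gives a cover of the curve (\<open>level_set_cover\<close>), and the sum of its diameters, almost
  \<open>\<integral> |k| + 2\<pi>R\<close>, bounds the Hausdorff measure.
\<close>


section \<open>Calculus with the partial derivatives\<close>

lemma has_derivative_partials:
  fixes v :: "complex \<Rightarrow> 'a::real_normed_vector"
  assumes "v differentiable (at z)"
  shows "(v has_derivative (\<lambda>h. Re h *\<^sub>R dx v z + Im h *\<^sub>R dy v z)) (at z)"
proof -
  let ?D = "frechet_derivative v (at z)"
  have D: "(v has_derivative ?D) (at z)"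
    using assms frechet_derivative_works by blast
  then have lin: "linear ?D"
    by (rule has_derivative_linear)
  have "?D h = Re h *\<^sub>R dx v z + Im h *\<^sub>R dy v z" for h
  proof -
    have "h = Re h *\<^sub>R 1 + Im h *\<^sub>R \<i>"
      by (simp add: complex_eq_iff)
    then have "?D h = ?D (Re h *\<^sub>R 1 + Im h *\<^sub>R \<i>)"
      by (rule arg_cong)
    also have "\<dots> = Re h *\<^sub>R dx v z + Im h *\<^sub>R dy v z"
      by (simp only: linear_add[OF lin] linear_scale[OF lin] dx_def dy_def)
    finally show ?thesis .
  qed
  then have "?D = (\<lambda>h. Re h *\<^sub>R dx v z + Im h *\<^sub>R dy v z)"
    by (rule ext)
  with D show ?thesis by simp
qed

lemma partials_eqI:
  assumes "(v has_derivative D) (at z)"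
  shows "dx v z = D 1" "dy v z = D \<i>"
  using frechet_derivative_at[OF assms] by (simp_all add: dx_def dy_def)

lemma partials_cong:
  assumes "open S" "z \<in> S" "\<And>w. w \<in> S \<Longrightarrow> f w = g w"
  shows "dx f z = dx g z" "dy f z = dy g z"
proof -
  have *: "(f has_derivative D) (at z) = (g has_derivative D) (at z)" for D
  proof
    assume "(f has_derivative D) (at z)"
    then show "(g has_derivative D) (at z)"
      by (rule has_derivative_transform_within_open[OF _ assms]) auto
  next
    assume "(g has_derivative D) (at z)"
    then show "(f has_derivative D) (at z)"
      by (rule has_derivative_transform_within_open[OF _ assms(1,2)]) (simp add: assms(3))
  qed
  show "dx f z = dx g z" "dy f z = dy g z"
    unfolding dx_def dy_def frechet_derivative_def * by simp_all
qed

lemma differentiable_cong_open: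
  assumes "open S" "z \<in> S" "\<And>w. w \<in> S \<Longrightarrow> f w = g w" "f differentiable (at z)"
  shows "g differentiable (at z)"
  using assms has_derivative_transform_within_open unfolding differentiable_def by metis

lemma Ck_on_cong:
  assumes "open S" "\<And>w. w \<in> S \<Longrightarrow> f w = g w"
  shows "Ck_on k S f \<Longrightarrow> Ck_on k S g"
  using assms
proof (induction k arbitrary: f g)
  case 0
  then show ?case by (simp cong: continuous_on_cong)
next
  case (Suc k)
  have d: "dx f z = dx g z" "dy f z = dy g z" "g differentiable (at z)" if "z \<in> S" for z
    using partials_cong[OF Suc.prems(2) that Suc.prems(3)] 
      differentiable_cong_open[OF Suc.prems(2) that Suc.prems(3)] Suc.prems(1) that by auto
  show ?case
    using Suc.prems(1) Suc.IH[of "dx f" "dx g"] Suc.IH[of "dy f" "dy g"] d Suc.prems(2) by simp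
qed

lemma Ck_on_subset: "Ck_on k S f \<Longrightarrow> T \<subseteq> S \<Longrightarrow> Ck_on k T f"
  by (induction k arbitrary: f) (auto intro: continuous_on_subset)

lemma Ck_on_imp_continuous_on: "Ck_on k S f \<Longrightarrow> continuous_on S f"
  by (cases k)
    (auto simp: continuous_on_eq_continuous_within intro!: differentiable_imp_continuous_within
      intro: differentiable_at_withinI)

lemma Ck_on_SucD: "Ck_on (Suc k) S f \<Longrightarrow> Ck_on k S f"
proof (induction k arbitrary: f)
  case 0
  then show ?case using Ck_on_imp_continuous_on[of "Suc 0"] by (simp del: Ck_on.simps(2))
next
  case (Suc k)
  have "Ck_on k S (dx f)" "Ck_on k S (dy f)"
    using Suc.prems by (auto intro!: Suc.IH)
  then show ?case
    using Suc.prems by simp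
qed

lemma partials_mult:
  fixes f g :: "complex \<Rightarrow> real"
  assumes "f differentiable (at z)" "g differentiable (at z)"
  shows "dx (\<lambda>z. f z * g z) z = dx f z * g z + f z * dx g z"
    "dy (\<lambda>z. f z * g z) z = dy f z * g z + f z * dy g z"
  using partials_eqI[OF has_derivative_mult[OF has_derivative_partials[OF assms(1)] 
        has_derivative_partials[OF assms(2)]]] by simp_all

lemma partials_add:
  assumes "f differentiable (at z)" "g differentiable (at z)"
  shows "dx (\<lambda>z. f z + g z) z = dx f z + dx g z"
    "dy (\<lambda>z. f z + g z) z = dy f z + dy g z"
  using partials_eqI[OF has_derivative_add[OF has_derivative_partials[OF assms(1)] 
        has_derivative_partials[OF assms(2)]]] by simp_all

lemma partials_linear:
  assumes "bounded_linear L" "f differentiable (at z)"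
  shows "dx (\<lambda>z. L (f z)) z = L (dx f z)" "dy (\<lambda>z. L (f z)) z = L (dy f z)"
  using partials_eqI[OF bounded_linear.has_derivative[OF assms(1) has_derivative_partials[OF assms(2)]]] 
  by simp_all

lemma has_derivative_real_compose:
  fixes f :: "complex \<Rightarrow> real"
  assumes "(H has_real_derivative d) (at (f z))" "f differentiable (at z)"
  shows "((\<lambda>z. H (f z)) has_derivative (\<lambda>h. Re h *\<^sub>R (d * dx f z) + Im h *\<^sub>R (d * dy f z))) (at z)"
proof -
  have "(H has_derivative (*) d) (at (f z))"
    using assms(1) by (simp add: has_field_derivative_def)
  from has_derivative_compose[OF has_derivative_partials[OF assms(2)] this]
  show ?thesis by (simp add: algebra_simps)
qed

lemma partials_real_compose:
  fixes f :: "complex \<Rightarrow> real"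
  assumes "(H has_real_derivative d) (at (f z))" "f differentiable (at z)"
  shows "dx (\<lambda>z. H (f z)) z = d * dx f z" "dy (\<lambda>z. H (f z)) z = d * dy f z"
  using partials_eqI[OF has_derivative_real_compose[of H d f z, OF assms]] by simp_all

lemma partials_const: "dx (\<lambda>z. a) z = 0" "dy (\<lambda>z. a) z = 0"
  using partials_eqI[OF has_derivative_const[of a "at z"]] by simp_all

lemma Ck_on_const: "Ck_on k S (\<lambda>z. a)"
proof (induction k arbitrary: a)
  case 0
  then show ?case by simp
next
  case (Suc k)
  have "dx (\<lambda>z::complex. a) = (\<lambda>z. 0)" "dy (\<lambda>z::complex. a) = (\<lambda>z. 0)"
    by (simp_all add: fun_eq_iff partials_const)
  then show ?case using Suc by simp
qed

lemma Ck_on_add: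
  assumes "open S"
  shows "Ck_on k S f \<Longrightarrow> Ck_on k S g \<Longrightarrow> Ck_on k S (\<lambda>z. f z + g z)"
proof (induction k arbitrary: f g)
  case 0
  then show ?case by (simp add: continuous_on_add)
next
  case (Suc k)
  have "Ck_on k S (\<lambda>z. dx f z + dx g z)" "Ck_on k S (\<lambda>z. dy f z + dy g z)"
    using Suc by simp_all
  then have "Ck_on k S (dx (\<lambda>z. f z + g z))" "Ck_on k S (dy (\<lambda>z. f z + g z))"
    using Suc.prems by (auto intro: Ck_on_cong[OF assms, rotated] simp: partials_add)
  then show ?case using Suc.prems by (auto simp: differentiable_add)
qed

lemma Ck_on_mult:
  fixes f g :: "complex \<Rightarrow> real"
  assumes "open S"
  shows "Ck_on k S f \<Longrightarrow> Ck_on k S g \<Longrightarrow> Ck_on k S (\<lambda>z. f z * g z)"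
proof (induction k arbitrary: f g)
  case 0
  then show ?case by (simp add: continuous_on_mult)
next
  case (Suc k)
  note fg = Suc.prems[THEN Ck_on_SucD]
  have "Ck_on k S (\<lambda>z. dx f z * g z + f z * dx g z)" "Ck_on k S (\<lambda>z. dy f z * g z + f z * dy g z)"
    using Suc fg by (auto intro!: Ck_on_add assms)
  then have "Ck_on k S (dx (\<lambda>z. f z * g z))" "Ck_on k S (dy (\<lambda>z. f z * g z))"
    using Suc.prems by (auto intro: Ck_on_cong[OF assms, rotated] simp: partials_mult)
  then show ?case using Suc.prems by (auto simp: differentiable_mult)
qed

lemma Ck_on_linear:
  assumes "open S" "bounded_linear L"
  shows "Ck_on k S f \<Longrightarrow> Ck_on k S (\<lambda>z. L (f z))"
proof (induction k arbitrary: f)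
  case 0
  then show ?case using assms by (simp add: linear_continuous_on_compose bounded_linear.continuous_on)
next
  case (Suc k)
  have "Ck_on k S (\<lambda>z. L (dx f z))" "Ck_on k S (\<lambda>z. L (dy f z))"
    using Suc by simp_all
  then have "Ck_on k S (dx (\<lambda>z. L (f z)))" "Ck_on k S (dy (\<lambda>z. L (f z)))"
    using Suc.prems by (auto intro: Ck_on_cong[OF assms(1), rotated] simp: partials_linear[OF assms(2)])
  moreover have "(\<lambda>z. L (f z)) differentiable (at z)" if "z \<in> S" for z
    using has_derivative_partials[of f z] Suc.prems that bounded_linear.has_derivative[OF assms(2)]
    by (auto simp: differentiable_def)
  ultimately show ?case by simp
qed

lemma Ck_on_real_compose:
  fixes f :: "complex \<Rightarrow> real" and H :: "real \<Rightarrow> real"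
  assumes "open S" "Ck_on (Suc 0) S f"
    and H: "\<And>z. z \<in> S \<Longrightarrow> (H has_real_derivative H' (f z)) (at (f z))"
    and cont: "continuous_on S (\<lambda>z. H' (f z))"
  shows "Ck_on (Suc 0) S (\<lambda>z. H (f z))"
proof -
  have "continuous_on S (\<lambda>z. H' (f z) * dx f z)" "continuous_on S (\<lambda>z. H' (f z) * dy f z)"
    using assms by (auto intro!: continuous_on_mult)
  then have "continuous_on S (dx (\<lambda>z. H (f z)))" "continuous_on S (dy (\<lambda>z. H (f z)))"
    using assms(2) by (auto simp: partials_real_compose[OF H] cong: continuous_on_cong)
  moreover have "(\<lambda>z. H (f z)) differentiable (at z)" if "z \<in> S" for z
    using has_derivative_real_compose[of H _ f z, OF H[OF that]] assms(2) that by (auto simp: differentiable_def)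
  ultimately show ?thesis by simp
qed

lemma DERIV_along_line:
  fixes v :: "complex \<Rightarrow> real"
  assumes "v differentiable (at (a + of_real t * e))"
  shows "((\<lambda>t. v (a + of_real t * e)) has_real_derivative
     (Re e * dx v (a + of_real t * e) + Im e * dy v (a + of_real t * e))) (at t)"
proof -
  have "((\<lambda>t. a + of_real t * e) has_derivative (\<lambda>h. of_real h * e)) (at t)"
    by (auto intro!: derivative_eq_intros)
  from has_derivative_compose[OF this has_derivative_partials[OF assms]]
  show ?thesis
    by (rule has_derivative_imp_has_field_derivative) (simp add: algebra_simps)
qed

text \<open>Schwarz's theorem: both mixed derivatives are limits of the second difference over small
  squares, which two applications of the mean value theorem evaluate in either order.\<close>

lemma second_difference_mean_value:
  fixes v :: "complex \<Rightarrow> real"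
  assumes diff: "\<And>z. z \<in> S \<Longrightarrow> v differentiable (at z)"
    and diff': "\<And>z. z \<in> S \<Longrightarrow> w differentiable (at z)"
    and w: "\<And>z. z \<in> S \<Longrightarrow> w z = Re e * dx v z + Im e * dy v z"
    and S: "ball a (3 * s) \<subseteq> S" and s: "s > 0" and e: "norm e = 1" "norm e' = 1"
  shows "\<exists>\<xi>\<in>ball a (3 * s). 
    v (a + of_real s * e + of_real s * e') - v (a + of_real s * e) - v (a + of_real s * e') + v a
     = s\<^sup>2 * (Re e' * dx w \<xi> + Im e' * dy w \<xi>)"
proof -
  have in_ball: "a + of_real x * e + of_real y * e' \<in> ball a (3 * s)" 
    if "0 \<le> x" "x \<le> s" "0 \<le> y" "y \<le> s" for x y
  proof -
    have "norm (of_real x * e + of_real y * e') \<le> x + y"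
      using that e norm_triangle_ineq[of "of_real x * e" "of_real y * e'"] by (simp add: norm_mult)
    also have "\<dots> < 3 * s" using that s by simp
    finally have "norm (- (of_real x * e + of_real y * e')) < 3 * s" by (simp only: norm_minus_cancel)
    then show ?thesis by (simp add: dist_norm add.assoc)
  qed
  define g where "g x = v ((a + of_real s * e') + of_real x * e) - v (a + of_real x * e)" for x
  have "(g has_real_derivative 
     w (a + of_real x * e + of_real s * e') - w (a + of_real x * e)) (at x)" if "0 \<le> x" "x \<le> s" for x
  proof -
    have 1: "a + of_real x * e + of_real s * e' \<in> S" "a + of_real x * e \<in> S"
      using in_ball[of x s] in_ball[of x 0] that s S by auto
    show ?thesis unfolding g_def w[OF 1(1)] w[OF 1(2)]
      using 1 DERIV_along_line[of v "a + of_real s * e'" x e] DERIV_along_line[of v "a" x e]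
      by (auto intro!: DERIV_diff simp: diff add.commute add.left_commute)
  qed
  then obtain x where x: "0 < x" "x < s" 
    "g s - g 0 = s * (w (a + of_real x * e + of_real s * e') - w (a + of_real x * e))"
    using MVT2[of 0 s g "\<lambda>x. w (a + of_real x * e + of_real s * e') - w (a + of_real x * e)"] s 
    by auto
  have "((\<lambda>y. w (a + of_real x * e + of_real y * e')) has_real_derivative 
     (Re e' * dx w (a + of_real x * e + of_real y * e') + Im e' * dy w (a + of_real x * e + of_real y * e'))) 
       (at y)" if "0 \<le> y" "y \<le> s" for y
    using in_ball[of x y] that x S by (intro DERIV_along_line diff') auto
  then obtain y where y: "0 < y" "y < s" 
    "w (a + of_real x * e + of_real s * e') - w (a + of_real x * e) = 
      s * (Re e' * dx w (a + of_real x * e + of_real y * e') + Im e' * dy w (a + of_real x * e + of_real y * e'))"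
    using MVT2[of 0 s "\<lambda>y. w (a + of_real x * e + of_real y * e')" 
      "\<lambda>y. Re e' * dx w (a + of_real x * e + of_real y * e') + Im e' * dy w (a + of_real x * e + of_real y * e')"] s 
    by auto
  show ?thesis
  proof (rule bexI)
    show "a + of_real x * e + of_real y * e' \<in> ball a (3 * s)"
      using in_ball x y by simp
    show "v (a + of_real s * e + of_real s * e') - v (a + of_real s * e) - v (a + of_real s * e') + v a
     = s\<^sup>2 * (Re e' * dx w (a + of_real x * e + of_real y * e') + Im e' * dy w (a + of_real x * e + of_real y * e'))"
      using x(3) y(3) by (simp add: g_def power2_eq_square add.commute add.left_commute)
  qed
qed

lemma mixed_partials_eq:
  fixes v :: "complex \<Rightarrow> real"
  assumes "open S" "Ck_on 2 S v" "a \<in> S"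
  shows "dy (dx v) a = dx (dy v) a"
proof (rule ccontr)
  let ?P = "dy (dx v)" and ?Q = "dx (dy v)"
  assume ne: "?P a \<noteq> ?Q a"
  define d where "d = \<bar>?P a - ?Q a\<bar> / 2"
  have d: "d > 0" using ne by (simp add: d_def)
  have *: "\<And>z. z \<in> S \<Longrightarrow> v differentiable (at z)" 
    "\<And>z. z \<in> S \<Longrightarrow> dx v differentiable (at z)" "\<And>z. z \<in> S \<Longrightarrow> dy v differentiable (at z)"
    "continuous_on S ?P" "continuous_on S ?Q"
    using assms(2) by (auto simp: numeral_2_eq_2)
  have "isCont ?P a" "isCont ?Q a"
    using * assms by (auto simp: continuous_on_eq_continuous_at)
  then obtain r1 r2 where r: "r1 > 0" "\<And>z. dist z a < r1 \<Longrightarrow> \<bar>?P z - ?P a\<bar> < d"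
    "r2 > 0" "\<And>z. dist z a < r2 \<Longrightarrow> \<bar>?Q z - ?Q a\<bar> < d"
    unfolding continuous_at_eps_delta using d by (metis dist_real_def)
  obtain r3 where r3: "r3 > 0" "ball a r3 \<subseteq> S"
    using assms openE by blast
  define s where "s = min r1 (min r2 r3) / 3"
  have s: "s > 0" "ball a (3 * s) \<subseteq> S" "3 * s \<le> r1" "3 * s \<le> r2"
    using r r3 by (auto simp: s_def)
  obtain \<xi> where \<xi>: "\<xi> \<in> ball a (3 * s)" 
    "v (a + of_real s * 1 + of_real s * \<i>) - v (a + of_real s * 1) - v (a + of_real s * \<i>) + v a = s\<^sup>2 * ?P \<xi>"
    using second_difference_mean_value[of S v "dx v" 1 a s \<i>] * s by auto
  obtain \<eta> where \<eta>: "\<eta> \<in> ball a (3 * s)" 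
    "v (a + of_real s * \<i> + of_real s * 1) - v (a + of_real s * \<i>) - v (a + of_real s * 1) + v a = s\<^sup>2 * ?Q \<eta>"
    using second_difference_mean_value[of S v "dy v" \<i> a s 1] * s by auto
  have "s\<^sup>2 * ?P \<xi> = s\<^sup>2 * ?Q \<eta>"
    using \<xi>(2) \<eta>(2) by (simp add: algebra_simps)
  then have "?P \<xi> = ?Q \<eta>" using s by simp
  moreover have "\<bar>?P \<xi> - ?P a\<bar> < d" "\<bar>?Q \<eta> - ?Q a\<bar> < d"
    using r(2)[of \<xi>] r(4)[of \<eta>] \<xi> \<eta> s by (auto simp: dist_commute)
  ultimately show False by (simp add: d_def abs_if field_simps split: if_splits)
qed


section \<open>Integration by parts for compactly supported functions\<close>

lemma partials_eq_0_outside_support: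
  fixes F :: "complex \<Rightarrow> real"
  assumes "compact K" "\<And>z. z \<notin> K \<Longrightarrow> F z = 0" "z \<notin> K"
  shows "dx F z = 0" "dy F z = 0"
proof -
  have "open (- K)" using assms(1) by (simp add: compact_imp_closed open_Compl)
  from partials_cong[OF this, of z F "\<lambda>_. 0"] show "dx F z = 0" "dy F z = 0"
    using assms by (simp_all add: partials_const)
qed

lemma integrable_continuous_compact_support:
  fixes F :: "complex \<Rightarrow> real"
  assumes "continuous_on K F" "compact K" "\<And>z. z \<notin> K \<Longrightarrow> F z = 0"
  shows "integrable lborel F"
proof -
  have "integrable lborel (\<lambda>z. indicator K z *\<^sub>R F z)"
    using borel_integrable_compact assms by blast
  also have "(\<lambda>z. indicator K z *\<^sub>R F z) = F"
    using assms(3) by (auto simp: fun_eq_iff indicator_def)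
  finally show ?thesis .
qed

text \<open>The difference quotients have vanishing integrals because Lebesgue measure is translation
  invariant, and they converge dominatedly to the derivative. In this form the divergence theorem
  needs no iterated integrals.\<close>

lemma integral_directional_derivative_eq_0:
  fixes F :: "complex \<Rightarrow> real"
  assumes F: "Ck_on (Suc 0) UNIV F" and K: "compact K" "\<And>z. z \<notin> K \<Longrightarrow> F z = 0"
  shows "(LINT z|lborel. Re e * dx F z + Im e * dy F z) = 0"
proof -
  define D where "D z = Re e * dx F z + Im e * dy F z" for z
  have contD: "continuous_on UNIV D"
    using F unfolding D_def by (auto intro!: continuous_intros)
  have D0: "D z = 0" if "z \<notin> K" for z
    using partials_eq_0_outside_support[OF K that] by (simp add: D_def)
  have "bounded (D ` K)"
    using K contD by (meson compact_continuous_image compact_imp_bounded continuous_on_subset top_greatest)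
  then obtain M where M: "M > 0" "\<And>z. z \<in> K \<Longrightarrow> \<bar>D z\<bar> \<le> M"
    by (auto simp: bounded_pos)
  have M': "\<bar>D z\<bar> \<le> M" for z
    using M D0 by (cases "z \<in> K") auto
  obtain r where "\<forall>x\<in>K. norm x \<le> r"
    using compact_imp_bounded[OF K(1)] by (auto simp: bounded_iff)
  then have r: "K \<subseteq> cball 0 r" by auto
  have lip: "\<bar>F (z + of_real t * e) - F z\<bar> \<le> M * t" if "t > 0" for z t
  proof -
    have "((\<lambda>t. F (z + of_real t * e)) has_real_derivative D (z + of_real t * e)) (at t)" for t
      unfolding D_def using F by (intro DERIV_along_line) auto
    then obtain s where "F (z + of_real t * e) - F (z + of_real 0 * e) = (t - 0) * D (z + of_real s * e)"
      using MVT2[OF \<open>t > 0\<close>, of "\<lambda>t. F (z + of_real t * e)" "\<lambda>t. D (z + of_real t * e)"] by blast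
    then show ?thesis
      using M'[of "z + of_real s * e"] that by (simp add: abs_mult mult.commute mult_left_mono)
  qed
  have contF: "continuous_on UNIV F" using Ck_on_imp_continuous_on F by blast
  have intF: "integrable lborel F"
    by (rule integrable_continuous_compact_support[OF continuous_on_subset[OF contF subset_UNIV] K])
  have shift: "integrable lborel (\<lambda>z. F (z + h))" "(LINT z|lborel. F (z + h)) = (LINT z|lborel. F z)" for h
  proof -
    have F': "F \<in> borel_measurable borel" using contF by (rule borel_measurable_continuous_onI)
    have "integrable (distr lborel borel ((+) h)) F"
      using intF by (subst lborel_distr_plus)
    then show "integrable lborel (\<lambda>z. F (z + h))"
      using F' by (subst (asm) integrable_distr_eq) (auto simp: add.commute)
    have "(LINT z|lborel. F z) = (LINT z|distr lborel borel ((+) h). F z)"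
      by (subst lborel_distr_plus) simp
    also have "\<dots> = (LINT z|lborel. F (z + h))"
      using F' by (subst integral_distr) (auto simp: add.commute)
    finally show "(LINT z|lborel. F (z + h)) = (LINT z|lborel. F z)" by simp
  qed
  define G where "G n z = (F (z + of_real (inverse (real (Suc n))) * e) - F z) / inverse (real (Suc n))" for n z
  have "(\<lambda>n. LINT z|lborel. G n z) \<longlonglongrightarrow> (LINT z|lborel. D z)"
  proof (rule integral_dominated_convergence)
    show "D \<in> borel_measurable lborel" using borel_measurable_continuous_onI[OF contD] by simp
    show "G n \<in> borel_measurable lborel" for n
      unfolding G_def using shift intF by (intro borel_measurable_divide borel_measurable_diff) auto
    show "integrable lborel (\<lambda>z. indicator (cball 0 (r + norm e)) z *\<^sub>R M :: real)"
      by (intro borel_integrable_compact) auto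
    show "AE z in lborel. (\<lambda>n. G n z) \<longlonglongrightarrow> D z"
    proof (rule AE_I2)
      fix z
      have "((\<lambda>t. F (z + of_real t * e)) has_real_derivative D (z + of_real 0 * e)) (at 0)"
        unfolding D_def using F by (intro DERIV_along_line) auto
      then have "((\<lambda>h. (F (z + of_real h * e) - F z) / h) \<longlongrightarrow> D z) (at 0)"
        by (simp add: DERIV_def)
      moreover have "filterlim (\<lambda>n. inverse (real (Suc n))) (at 0) sequentially"
        using LIMSEQ_inverse_real_of_nat by (intro filterlim_atI) auto
      ultimately show "(\<lambda>n. G n z) \<longlonglongrightarrow> D z"
        unfolding G_def by (rule filterlim_compose)
    qed
    show "AE z in lborel. norm (G n z) \<le> indicator (cball 0 (r + norm e)) z *\<^sub>R M" for n
    proof (rule AE_I2)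
      fix z
      show "norm (G n z) \<le> indicator (cball 0 (r + norm e)) z *\<^sub>R M"
      proof (cases "z \<in> cball 0 (r + norm e)")
        case True
        have "\<bar>G n z\<bar> \<le> (M * inverse (real (Suc n))) / inverse (real (Suc n))"
          unfolding G_def abs_divide using lip[of "inverse (real (Suc n))" z] 
          by (intro frac_le) auto
        with True show ?thesis by simp
      next
        case False
        let ?w = "z + of_real (inverse (real (Suc n))) * e"
        have "norm (of_real (inverse (real (Suc n))) * e) \<le> 1 * norm e"
          unfolding norm_mult norm_of_real by (intro mult_right_mono) (auto simp: divide_simps)
        then have "?w \<notin> cball 0 r"
          using False norm_triangle_ineq4[of ?w "of_real (inverse (real (Suc n))) * e"] by auto
        moreover have "z \<notin> cball 0 r" using False norm_ge_zero[of e] by (auto simp del: norm_ge_zero)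
        ultimately have "F ?w = 0" "F z = 0" using r K(2) by blast+
        with False show ?thesis by (simp only: G_def) simp
      qed
    qed
  qed
  moreover have "(LINT z|lborel. G n z) = 0" for n
    unfolding G_def using shift intF by simp
  ultimately show ?thesis 
    unfolding D_def using LIMSEQ_unique[OF _ tendsto_const] by fastforce
qed

lemma Ck_on_extend_by_zero:
  fixes G \<phi> :: "complex \<Rightarrow> real"
  assumes "open S" "Ck_on k S G" "Ck_on k UNIV \<phi>" "compact K" "K \<subseteq> S" "\<And>z. z \<notin> K \<Longrightarrow> \<phi> z = 0"
  shows "Ck_on k UNIV (\<lambda>z. if z \<in> S then G z * \<phi> z else 0)"
proof -
  let ?F = "\<lambda>z. if z \<in> S then G z * \<phi> z else 0"
  have glue: "Ck_on k UNIV f" if "open A" "open B" "A \<union> B = UNIV" "Ck_on k A f" "Ck_on k B f"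
    for f :: "complex \<Rightarrow> real" and A B
    using that
  proof (induction k arbitrary: f)
    case 0
    then show ?case using continuous_on_open_Un[of A B f] by simp
  next
    case (Suc k)
    then show ?case by (simp) blast
  qed
  have "Ck_on k S (\<lambda>z. G z * \<phi> z)"
    using assms by (intro Ck_on_mult) (auto intro: Ck_on_subset)
  then have "Ck_on k S ?F"
    by (rule Ck_on_cong[OF assms(1), rotated]) auto
  moreover have "open (- K)" using assms by (simp add: compact_imp_closed open_Compl)
  then have "Ck_on k (- K) ?F"
    by (rule Ck_on_cong[OF _ _ Ck_on_const[of _ _ 0]]) (use assms in auto)
  ultimately show ?thesis
    using assms \<open>open (- K)\<close> by (intro glue[of S "- K"]) auto
qed

lemma integration_by_parts:
  fixes G\<^sub>1 G\<^sub>2 \<phi> :: "complex \<Rightarrow> real"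
  assumes S: "open S" and G: "Ck_on (Suc 0) S G\<^sub>1" "Ck_on (Suc 0) S G\<^sub>2" 
    and \<phi>: "Ck_on (Suc 0) UNIV \<phi>" and K: "compact K" "K \<subseteq> S" "\<And>z. z \<notin> K \<Longrightarrow> \<phi> z = 0"
  shows "integrable lborel (\<lambda>z. indicator S z * ((dx G\<^sub>1 z + dy G\<^sub>2 z) * \<phi> z))" (is ?A)
    "integrable lborel (\<lambda>z. indicator S z * (G\<^sub>1 z * dx \<phi> z + G\<^sub>2 z * dy \<phi> z))" (is ?B)
    "(LINT z|lborel. indicator S z * (G\<^sub>1 z * dx \<phi> z + G\<^sub>2 z * dy \<phi> z))
      = - (LINT z|lborel. indicator S z * ((dx G\<^sub>1 z + dy G\<^sub>2 z) * \<phi> z))" (is ?C)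
proof -
  note \<phi>0 = partials_eq_0_outside_support[OF K(1,3)]
  have cont: "continuous_on K \<phi>" "continuous_on K (dx \<phi>)" "continuous_on K (dy \<phi>)"
    "continuous_on K G\<^sub>1" "continuous_on K G\<^sub>2" "continuous_on K (dx G\<^sub>1)" "continuous_on K (dy G\<^sub>2)"
    using Ck_on_imp_continuous_on[OF \<phi>] Ck_on_imp_continuous_on[OF G(1)] 
      Ck_on_imp_continuous_on[OF G(2)] \<phi> G K(2) 
    by (auto intro: continuous_on_subset)
  show A: ?A
  proof (rule integrable_continuous_compact_support[OF _ K(1)])
    have "continuous_on K (\<lambda>z. (dx G\<^sub>1 z + dy G\<^sub>2 z) * \<phi> z)"
      by (intro continuous_intros cont)
    then show "continuous_on K (\<lambda>z. indicator S z * ((dx G\<^sub>1 z + dy G\<^sub>2 z) * \<phi> z))"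
      by (rule continuous_on_eq) (use K in \<open>auto simp: indicator_def\<close>)
  qed (auto simp: K)
  show B: ?B
  proof (rule integrable_continuous_compact_support[OF _ K(1)])
    have "continuous_on K (\<lambda>z. G\<^sub>1 z * dx \<phi> z + G\<^sub>2 z * dy \<phi> z)"
      by (intro continuous_intros cont)
    then show "continuous_on K (\<lambda>z. indicator S z * (G\<^sub>1 z * dx \<phi> z + G\<^sub>2 z * dy \<phi> z))"
      by (rule continuous_on_eq) (use K in \<open>auto simp: indicator_def\<close>)
  qed (auto simp: \<phi>0)
  define F where "F G z = (if z \<in> S then G z * \<phi> z else 0)" for G z
  have F: "Ck_on (Suc 0) UNIV (F G)" if "Ck_on (Suc 0) S G" for G
    unfolding F_def using Ck_on_extend_by_zero[OF S that \<phi> K] .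
  have F0: "F G z = 0" if "z \<notin> K" for G z
    using K(3)[OF that] by (simp add: F_def)
  have dF: "dx (F G) z = indicator S z * (dx G z * \<phi> z + G z * dx \<phi> z)"
    "dy (F G) z = indicator S z * (dy G z * \<phi> z + G z * dy \<phi> z)" if "Ck_on (Suc 0) S G" for G z
  proof (atomize (full), cases "z \<in> S")
    case True
    then show "dx (F G) z = indicator S z * (dx G z * \<phi> z + G z * dx \<phi> z) \<and>
       dy (F G) z = indicator S z * (dy G z * \<phi> z + G z * dy \<phi> z)"
      using partials_cong[OF S True, of "F G" "\<lambda>z. G z * \<phi> z"] partials_mult[of G z \<phi>] that \<phi> 
      by (simp add: F_def)
  next
    case False
    then have "z \<notin> K" using K by auto
    then show "dx (F G) z = indicator S z * (dx G z * \<phi> z + G z * dx \<phi> z) \<and>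
       dy (F G) z = indicator S z * (dy G z * \<phi> z + G z * dy \<phi> z)"
      using partials_eq_0_outside_support[OF K(1) F0 \<open>z \<notin> K\<close>] False by simp
  qed
  have int: "integrable lborel (dx (F G))" "integrable lborel (dy (F G))" if "Ck_on (Suc 0) S G" for G
    using F[OF that] 
    by (auto intro!: integrable_continuous_compact_support[OF _ K(1)] partials_eq_0_outside_support[OF K(1) F0]
      intro: continuous_on_subset)
  have "(LINT z|lborel. dx (F G\<^sub>1) z) = 0"
    using integral_directional_derivative_eq_0[OF F[OF G(1)] K(1) F0, of 1] by simp
  moreover have "(LINT z|lborel. dy (F G\<^sub>2) z) = 0"
    using integral_directional_derivative_eq_0[OF F[OF G(2)] K(1) F0, of \<i>] by simp
  ultimately have "0 = (LINT z|lborel. dx (F G\<^sub>1) z + dy (F G\<^sub>2) z)"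
    using int(1)[OF G(1)] int(2)[OF G(2)] by simp
  also have "\<dots> = (LINT z|lborel. indicator S z * (G\<^sub>1 z * dx \<phi> z + G\<^sub>2 z * dy \<phi> z) 
      + indicator S z * ((dx G\<^sub>1 z + dy G\<^sub>2 z) * \<phi> z))"
    by (intro Bochner_Integration.integral_cong) (auto simp: dF[OF G(1)] dF[OF G(2)] algebra_simps)
  also have "\<dots> = (LINT z|lborel. indicator S z * (G\<^sub>1 z * dx \<phi> z + G\<^sub>2 z * dy \<phi> z)) 
      + (LINT z|lborel. indicator S z * ((dx G\<^sub>1 z + dy G\<^sub>2 z) * \<phi> z))"
    using A B by (intro Bochner_Integration.integral_add)
  finally show ?C by simp
qed

section \<open>The Euler-Lagrange system holds pointwise\<close>

text \<open>The derivatives of \<open>exp (-1/t)\<close>, extended by \<open>0\<close> to \<open>t \<le> 0\<close>, are combinations of the functions below, which are closed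
  under differentiation; this makes smoothness of the bump functions a plain induction.\<close>

definition flat :: "nat \<Rightarrow> real \<Rightarrow> real" where
  "flat n t = (if t \<le> 0 then 0 else exp (- 1 / t) / t ^ n)"

lemma tendsto_flat_0: "(flat n \<longlongrightarrow> 0) (at 0)"
proof (rule filterlim_split_at_real)
  show "(flat n \<longlongrightarrow> 0) (at_left 0)"
    by (rule tendsto_eventually) (auto simp: flat_def eventually_at_left_field intro: exI[of _ "- 1"])
  have "((\<lambda>t. (inverse t) ^ n / exp (inverse t)) \<longlongrightarrow> (0::real)) (at_right 0)"
    by (rule filterlim_compose[OF tendsto_power_div_exp_0 filterlim_inverse_at_top_right])
  moreover have "eventually (\<lambda>t. (inverse t) ^ n / exp (inverse t) = flat n t) (at_right 0)"
    unfolding eventually_at_right_field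
    by (auto simp: flat_def field_simps exp_minus intro!: exI[of _ 1])
  ultimately show "(flat n \<longlongrightarrow> 0) (at_right 0)"
    using tendsto_cong by fast
qed

lemma DERIV_flat: "(flat n has_real_derivative (flat (n + 2) t - n * flat (n + 1) t)) (at t)"
proof -
  consider "t > 0" | "t < 0" | "t = 0" by linarith
  then show ?thesis
  proof cases
    case 1
    have "((\<lambda>t. exp (- 1 / t) / t ^ n) has_real_derivative (flat (n + 2) t - n * flat (n + 1) t)) (at t)"
    proof -
      have "n - Suc 0 = 0 \<or> t * t ^ (n - Suc 0 - Suc 0) = t ^ (n - Suc 0)"
        by (cases "n - Suc 0") auto
      then show ?thesis
        using 1 by (cases n) (auto intro!: derivative_eq_intros simp: flat_def divide_simps algebra_simps)
    qed
    then show ?thesis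
      by (rule has_field_derivative_transform_within_open[of _ _ _ "{0<..}"]) (use 1 in \<open>auto simp: flat_def\<close>)
  next
    case 2
    have "((\<lambda>t. 0) has_real_derivative (flat (n + 2) t - n * flat (n + 1) t)) (at t)"
      using 2 by (auto simp: flat_def)
    then show ?thesis
      by (rule has_field_derivative_transform_within_open[of _ _ _ "{..<0}"]) (use 2 in \<open>auto simp: flat_def\<close>)
  next
    case 3
    have "(\<lambda>h. (flat n (0 + h) - flat n 0) / h) = flat (n + 1)"
      by (auto simp: flat_def fun_eq_iff)
    then show ?thesis
      using tendsto_flat_0[of "n + 1"] 3 by (simp add: DERIV_def flat_def[of _ 0])
  qed
qed

lemma Ck_on_flat_compose:
  assumes q: "\<And>k. Ck_on k UNIV q"
  shows "Ck_on k UNIV (\<lambda>z. flat n (q z))"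
proof (induction k arbitrary: n)
  case 0
  have "continuous_on UNIV (flat n)"
    using DERIV_isCont[OF DERIV_flat] by (simp add: continuous_on_eq_continuous_at)
  then show ?case
    using Ck_on_imp_continuous_on[OF q] continuous_on_compose2 by fastforce
next
  case (Suc k)
  have qd: "q differentiable (at z)" for z using q[of "Suc 0"] by simp
  have "Ck_on k UNIV (\<lambda>z. (flat (n + 2) (q z) + - real n * flat (n + 1) (q z)) * dx q z)"
    "Ck_on k UNIV (\<lambda>z. (flat (n + 2) (q z) + - real n * flat (n + 1) (q z)) * dy q z)"
    using q[of "Suc k"] by (intro Ck_on_mult Ck_on_add Ck_on_const Suc.IH open_UNIV; simp)+
  moreover have "dx (\<lambda>z. flat n (q z)) = (\<lambda>z. (flat (n + 2) (q z) + - real n * flat (n + 1) (q z)) * dx q z)"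
    "dy (\<lambda>z. flat n (q z)) = (\<lambda>z. (flat (n + 2) (q z) + - real n * flat (n + 1) (q z)) * dy q z)"
    by (simp_all add: fun_eq_iff partials_real_compose[OF DERIV_flat qd])
  moreover have "(\<lambda>z. flat n (q z)) differentiable (at z)" for z
    using has_derivative_real_compose[of "flat n" _ q z, OF DERIV_flat qd] by (auto simp: differentiable_def)
  ultimately show ?case by simp
qed

lemma Ck_on_ident: "Ck_on k UNIV (\<lambda>z. z)"
proof (cases k)
  case (Suc m)
  have "dx (\<lambda>z. z) = (\<lambda>z. 1)" "dy (\<lambda>z. z) = (\<lambda>z. \<i>)"
    using partials_eqI[OF has_derivative_ident] by (simp_all add: fun_eq_iff)
  then show ?thesis using Suc by (simp add: Ck_on_const)
qed simp

lemma Ck_on_dist_squared: "Ck_on k UNIV (\<lambda>z. (norm (z - a))\<^sup>2)"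
proof -
  have R: "Ck_on k UNIV (\<lambda>z. Re z + - Re a)" "Ck_on k UNIV (\<lambda>z. Im z + - Im a)"
    by (rule Ck_on_add[OF open_UNIV _ Ck_on_const], rule Ck_on_linear[OF open_UNIV _ Ck_on_ident],
      rule bounded_linear_Re bounded_linear_Im)+
  have "Ck_on k UNIV (\<lambda>z. (Re z + - Re a) * (Re z + - Re a) + (Im z + - Im a) * (Im z + - Im a))"
    by (intro Ck_on_add Ck_on_mult open_UNIV R)
  also have "(\<lambda>z. (Re z + - Re a) * (Re z + - Re a) + (Im z + - Im a) * (Im z + - Im a)) = 
    (\<lambda>z. (norm (z - a))\<^sup>2)"
    by (simp only: fun_eq_iff cmod_power2) (simp add: power2_eq_square)
  finally show ?thesis .
qed

lemma bump_function_exists: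
  assumes "r > 0"
  obtains \<phi> :: "complex \<Rightarrow> real" where "\<And>k. Ck_on k UNIV \<phi>" "\<And>z. z \<in> ball a r \<Longrightarrow> \<phi> z > 0" 
    "\<And>z. z \<notin> ball a r \<Longrightarrow> \<phi> z = 0"
proof
  let ?q = "\<lambda>z. r\<^sup>2 + - 1 * (norm (z - a))\<^sup>2"
  show "Ck_on k UNIV (\<lambda>z. flat 0 (?q z))" for k
    by (intro Ck_on_flat_compose Ck_on_add Ck_on_const Ck_on_mult Ck_on_dist_squared open_UNIV)
  have "?q z > 0 \<longleftrightarrow> norm (z - a) < r" for z
    using assms power_mono_iff[of r "norm (z - a)" 2] by (auto simp: not_le[symmetric])
  then have *: "?q z > 0 \<longleftrightarrow> z \<in> ball a r" for z by (simp only: mem_ball dist_norm norm_minus_commute[of a z])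
  show "flat 0 (?q z) > 0" if "z \<in> ball a r" for z
    using *[of z] that by (simp add: flat_def)
  show "flat 0 (?q z) = 0" if "z \<notin> ball a r" for z
    using *[of z] that by (simp add: flat_def)
qed

lemma fundamental_lemma_of_variations:
  fixes q :: "complex \<Rightarrow> real"
  assumes S: "open S" and q: "continuous_on S q"
    and int: "\<And>\<phi>. test_function S \<phi> \<Longrightarrow> (LINT z|lborel. indicator S z * (q z * \<phi> z)) = 0"
    and a: "a \<in> S"
  shows "q a = 0"
proof (rule ccontr)
  assume ne: "q a \<noteq> 0"
  have "isCont (\<lambda>z. q z * q a) a"
    using S q a by (auto simp: continuous_on_eq_continuous_at)
  moreover have "q a * q a > 0" using ne by (metis not_real_square_gt_zero)
  ultimately obtain r1 where r1: "r1 > 0" "\<And>z. dist a z < r1 \<Longrightarrow> q z * q a > 0"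
  proof -
    have "((\<lambda>z. q z * q a) \<longlongrightarrow> q a * q a) (at a)"
      using \<open>isCont (\<lambda>z. q z * q a) a\<close> by (simp add: isCont_def)
    then have "eventually (\<lambda>z. 0 < q z * q a) (at a)"
      using \<open>q a * q a > 0\<close> by (rule order_tendstoD(1))
    then obtain d where "d > 0" "\<And>z. z \<noteq> a \<Longrightarrow> dist z a < d \<Longrightarrow> 0 < q z * q a"
      unfolding eventually_at by auto
    with \<open>q a * q a > 0\<close> show ?thesis
      by (intro that[of d]) (metis dist_commute)+
  qed
  obtain r2 where r2: "r2 > 0" "cball a r2 \<subseteq> S"
    using S a open_contains_cball by blast
  define r where "r = min r1 r2"
  have r: "r > 0" "cball a r \<subseteq> S" "\<And>z. z \<in> ball a r \<Longrightarrow> q z * q a > 0"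
    using r1 r2 by (auto simp: r_def)
  obtain \<phi> :: "complex \<Rightarrow> real" where \<phi>: "\<And>k. Ck_on k UNIV \<phi>" "\<And>z. z \<in> ball a r \<Longrightarrow> \<phi> z > 0" 
    "\<And>z. z \<notin> ball a r \<Longrightarrow> \<phi> z = 0"
    using bump_function_exists[OF r(1)] by blast
  have "test_function S \<phi>"
    unfolding test_function_def using \<phi> r(2) ball_subset_cball by (intro conjI exI[of _ "cball a r"]) auto
  then have 0: "(LINT z|lborel. indicator S z * (q z * \<phi> z)) = 0" by (rule int)
  let ?f = "\<lambda>z. indicator S z * (q z * \<phi> z) * q a"
  have "continuous_on (cball a r) (\<lambda>z. q z * \<phi> z * q a)"
    using q r(2) Ck_on_imp_continuous_on[OF \<phi>(1)] by (auto intro!: continuous_intros intro: continuous_on_subset)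
  then have "continuous_on (cball a r) ?f"
    by (rule continuous_on_eq) (use r in \<open>auto simp: indicator_def\<close>)
  then have int_f: "integrable lborel ?f"
    by (rule integrable_continuous_compact_support[of "cball a r"]) (auto simp: \<phi>)
  have pos: "?f z > 0" if "z \<in> ball a r" for z
  proof -
    have "z \<in> S" using that r(2) by auto
    moreover have "q z * q a * \<phi> z > 0" using \<phi>(2)[OF that] r(3)[OF that] by simp
    ultimately show ?thesis by (simp add: mult.assoc mult.commute mult.left_commute)
  qed
  then have "?f z \<ge> 0" for z using \<phi>(3)[of z] by (cases "z \<in> ball a r") (auto simp: less_imp_le)
  moreover have "(LINT z|lborel. ?f z) = 0" using 0 by simp
  ultimately have "AE z in lborel. ?f z = 0"
    using integral_nonneg_eq_0_iff_AE[OF int_f] by simp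
  then have "AE z in lborel. z \<notin> ball a r"
    by (rule AE_mp) (use pos in \<open>fastforce intro!: AE_I2\<close>)
  then have "ball a r \<in> null_sets lborel"
    by (subst (asm) AE_iff_null) (auto simp: ball_def)
  then have "negligible (ball a r)"
    using negligible_iff_null_sets null_sets_completionI by blast
  then show False using open_not_negligible[of "ball a r"] r(1) by simp
qed


lemma norm_grad_squared: "(norm (grad v z))\<^sup>2 = (dx v z)\<^sup>2 + (dy v z)\<^sup>2"
  unfolding power2_norm_eq_inner by (simp add: inner_vec_def sum_2 grad_def power2_eq_square)

lemma inner_grad: "grad v z \<bullet> grad w z = dx v z * dx w z + dy v z * dy w z"
  by (simp add: inner_vec_def sum_2 grad_def)

lemma norm_cgrad: "norm (grad v z) = 2 * norm (cgrad v z)"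
proof -
  have "cgrad v z = Complex (dx v z / 2) (- dy v z / 2)"
    by (simp add: cgrad_def complex_eq_iff)
  then have "(2 * norm (cgrad v z))\<^sup>2 = (norm (grad v z))\<^sup>2"
    by (simp add: norm_grad_squared power_mult_distrib cmod_power2 field_simps)
  then show ?thesis
    by (metis norm_ge_zero mult_nonneg_nonneg power2_eq_iff_nonneg zero_le_numeral)
qed

lemma norm_wirt_z_cgrad:
  assumes "open S" "Ck_on 2 S v" "z \<in> S"
  shows "(norm (wirt_z (cgrad v) z))\<^sup>2 = ((dx (dx v) z - dy (dy v) z)\<^sup>2 + 4 * (dy (dx v) z)\<^sup>2) / 16"
proof -
  have d: "dx v differentiable (at z)" "dy v differentiable (at z)"
    using assms by (auto simp: numeral_2_eq_2)
  define D where "D h = (of_real (Re h *\<^sub>R dx (dx v) z + Im h *\<^sub>R dy (dx v) z) 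
     - \<i> * of_real (Re h *\<^sub>R dx (dy v) z + Im h *\<^sub>R dy (dy v) z)) / 2" for h
  have "(cgrad v has_derivative D) (at z)"
    unfolding cgrad_def[abs_def] D_def
    by (rule derivative_eq_intros has_derivative_partials[OF d(1)] has_derivative_partials[OF d(2)] refl)+
      (simp_all add: fun_eq_iff)
  note this[THEN partials_eqI(1)] this[THEN partials_eqI(2)]
  then have "wirt_z (cgrad v) z = Complex ((dx (dx v) z - dy (dy v) z) / 4) (- dy (dx v) z / 2)"
    by (simp add: wirt_z_def D_def complex_eq_iff mixed_partials_eq[OF assms])
  then show ?thesis
    by (simp add: cmod_power2 power_divide)
qed

text \<open>With \<open>T = |Du|\<^sup>2\<close>, differentiating the product \<open>T\<^sup>(\<^sup>p\<^sup>-\<^sup>2\<^sup>)\<^sup>/\<^sup>2 \<nabla>u\<^sup>j\<close> and dividing by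
  \<open>T\<^sup>(\<^sup>p\<^sup>-\<^sup>4\<^sup>)\<^sup>/\<^sup>2\<close> gives the nondivergence form of the system.\<close>

lemma p_harmonic_map_nondivergence_form:
  fixes u :: "complex \<Rightarrow> real^2" and j :: 2
  assumes \<Omega>: "open \<Omega>" and u: "Ck_on 2 \<Omega> u" and ph: "p_harmonic_map p \<Omega> u"
    and S: "open S" "S \<subseteq> \<Omega>" and nz: "\<And>z. z \<in> S \<Longrightarrow> norm_Du u z \<noteq> 0" and z: "z \<in> S"
  defines "a \<equiv> \<lambda>z. u z $ 1" and "b \<equiv> \<lambda>z. u z $ 2" and "w \<equiv> \<lambda>z. u z $ j"
  shows "((dx a z)\<^sup>2 + (dy a z)\<^sup>2 + (dx b z)\<^sup>2 + (dy b z)\<^sup>2) * (dx (dx w) z + dy (dy w) z)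
    + (p - 2) * (dx w z * (dx a z * dx (dx a) z + dy a z * dy (dx a) z + dx b z * dx (dx b) z + dy b z * dy (dx b) z)
               + dy w z * (dx a z * dy (dx a) z + dy a z * dy (dy a) z + dx b z * dy (dx b) z + dy b z * dy (dy b) z)) = 0"
proof -
  have C2: "Ck_on 2 S (\<lambda>z. u z $ k)" for k
    by (rule Ck_on_linear[OF S(1) bounded_linear_vec_nth Ck_on_subset[OF u S(2)]])
  then have C1: "Ck_on (Suc 0) S (dx (\<lambda>z. u z $ k))" "Ck_on (Suc 0) S (dy (\<lambda>z. u z $ k))" for k
    by (simp_all add: numeral_2_eq_2)
  define T where "T z = dx a z * dx a z + dy a z * dy a z + (dx b z * dx b z + dy b z * dy b z)" for z
  define q where "q = (p - 2) / 2"
  define W where "W z = T z powr q" for z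
  have normDu: "norm_Du u z = sqrt (T z)" for z
    unfolding norm_Du_def norm_grad_squared T_def a_def b_def by (simp add: power2_eq_square)
  have T0: "T z \<ge> 0" for z by (simp add: T_def)
  have Tpos: "T z > 0" if "z \<in> S" for z
    using nz[OF that] T0[of z] by (simp add: normDu)
  have W_eq: "norm_Du u z powr (p - 2) = W z" for z
    unfolding normDu W_def q_def powr_half_sqrt[OF T0, symmetric] by (simp add: powr_powr)
  have CT: "Ck_on (Suc 0) S T"
    unfolding T_def a_def b_def by (intro Ck_on_add Ck_on_mult C1 S)
  have HW: "((\<lambda>t. t powr q) has_real_derivative q * T z powr (q - 1)) (at (T z))" if "z \<in> S" for z
    using has_real_derivative_powr[OF Tpos[OF that]] .
  have CW: "Ck_on (Suc 0) S W"
    unfolding W_def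
  proof (rule Ck_on_real_compose[OF S(1) CT HW])
    have "\<forall>z\<in>S. T z \<noteq> 0" using Tpos by force
    then show "continuous_on S (\<lambda>z. q * T z powr (q - 1))"
      by (intro continuous_intros Ck_on_imp_continuous_on[OF CT]) auto
  qed
  have Cw: "Ck_on (Suc 0) S (dx w)" "Ck_on (Suc 0) S (dy w)"
    unfolding w_def by (rule C1)+
  have CG: "Ck_on (Suc 0) S (\<lambda>z. W z * dx w z)" "Ck_on (Suc 0) S (\<lambda>z. W z * dy w z)"
    by (intro Ck_on_mult S CW Cw)+
  define divG where "divG z = dx (\<lambda>z. W z * dx w z) z + dy (\<lambda>z. W z * dy w z) z" for z
  have "(LINT z|lborel. indicator S z * (divG z * \<phi> z)) = 0" if \<phi>: "test_function S \<phi>" for \<phi>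
  proof -
    from \<phi> obtain K where K: "compact K" "K \<subseteq> S" "\<And>z. z \<notin> K \<Longrightarrow> \<phi> z = 0" 
      and C: "Ck_on (Suc 0) UNIV \<phi>"
      unfolding test_function_def by metis
    have "test_function \<Omega> \<phi>"
      using \<phi> S(2) unfolding test_function_def by blast
    with ph have "(LINT z:\<Omega>|lebesgue. norm_Du u z powr (p - 2) * (grad w z \<bullet> grad \<phi> z)) = 0"
      unfolding p_harmonic_map_def w_def by blast
    also have "(LINT z:\<Omega>|lebesgue. norm_Du u z powr (p - 2) * (grad w z \<bullet> grad \<phi> z))
      = (LINT z|lebesgue. indicator S z * (W z * dx w z * dx \<phi> z + W z * dy w z * dy \<phi> z))"
      unfolding set_lebesgue_integral_def
    proof (rule Bochner_Integration.integral_cong[OF refl])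
      fix z
      show "indicat_real \<Omega> z *\<^sub>R (norm_Du u z powr (p - 2) * (grad w z \<bullet> grad \<phi> z)) =
         indicator S z * (W z * dx w z * dx \<phi> z + W z * dy w z * dy \<phi> z)"
        using partials_eq_0_outside_support[OF K(1,3)] S(2) K(2)
        by (cases "z \<in> K") (auto simp: W_eq inner_grad algebra_simps indicator_def)
    qed
    also have "\<dots> = (LINT z|lborel. indicator S z * (W z * dx w z * dx \<phi> z + W z * dy w z * dy \<phi> z))"
      by (rule integral_completion)
        (use integration_by_parts(2)[OF S(1) CG C K] in auto)
    finally show ?thesis
      using integration_by_parts(3)[OF S(1) CG C K] by (simp add: divG_def)
  qed
  moreover have "continuous_on S divG"
    using CG unfolding divG_def by (auto intro: continuous_intros)
  ultimately have "divG z = 0"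
    using fundamental_lemma_of_variations[OF S(1)] z by blast
  have da: "a differentiable (at z)" "dx a differentiable (at z)" "dy a differentiable (at z)" 
    and db: "b differentiable (at z)" "dx b differentiable (at z)" "dy b differentiable (at z)" 
    and dw: "dx w differentiable (at z)" "dy w differentiable (at z)" 
    using C2 z by (auto simp: a_def b_def w_def numeral_2_eq_2)
  have dT: "T differentiable (at z)" and dW: "W differentiable (at z)"
    using CT CW z by auto
  note mixed = mixed_partials_eq[OF S(1) C2[of 1] z, folded a_def] 
    mixed_partials_eq[OF S(1) C2[of 2] z, folded b_def]
  have Tx: "dx T z = 2 * (dx a z * dx (dx a) z + dy a z * dy (dx a) z + dx b z * dx (dx b) z + dy b z * dy (dx b) z)"
    "dy T z = 2 * (dx a z * dy (dx a) z + dy a z * dy (dy a) z + dx b z * dy (dx b) z + dy b z * dy (dy b) z)"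
    unfolding T_def[abs_def] using da db mixed
    by (simp_all add: partials_add partials_mult algebra_simps)
  have Wx: "dx W z = q * T z powr (q - 1) * dx T z" "dy W z = q * T z powr (q - 1) * dy T z"
    unfolding W_def[abs_def] using partials_real_compose[OF HW[OF z] dT] by simp_all
  have WT: "W z = T z powr (q - 1) * T z"
    using Tpos[OF z] by (simp add: W_def powr_diff)
  have "divG z = T z powr (q - 1) * (T z * (dx (dx w) z + dy (dy w) z) + q * (dx w z * dx T z + dy w z * dy T z))"
    unfolding divG_def partials_mult[OF dW dw(1)] partials_mult[OF dW dw(2)] Wx WT
    by (simp add: algebra_simps)
  with \<open>divG z = 0\<close> have "T z * (dx (dx w) z + dy (dy w) z) + q * (dx w z * dx T z + dy w z * dy T z) = 0"
    using Tpos[OF z] by simp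
  moreover have "q * (x * (2 * P) + y * (2 * Q)) = (p - 2) * (x * P + y * Q)" for x y P Q
    by (simp add: q_def field_simps)
  moreover have "T z = (dx a z)\<^sup>2 + (dy a z)\<^sup>2 + (dx b z)\<^sup>2 + (dy b z)\<^sup>2"
    by (simp add: T_def power2_eq_square)
  ultimately show ?thesis
    unfolding Tx by (simp only:)
qed

text \<open>Pair the two equations with the Laplacians \<open>La\<close>, \<open>Lb\<close>: as \<open>p > 1\<close>, the part of the Hessians
  that is a multiple of the identity contributes at least \<open>min 1 (p/2) T (La\<^sup>2 + Lb\<^sup>2)\<close>, and what
  remains involves only the trace-free parts, which \<open>f\<^sub>z\<close> and \<open>g\<^sub>z\<close> encode. The quadratic
  inequalities below are Cauchy-Schwarz, written with the remainder as a sum of squares.\<close>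

lemma laplacians_le_trace_free_parts:
  fixes p ax ay bx "by" a11 a12 a22 b11 b12 b22 :: real
  defines "T \<equiv> ax\<^sup>2 + ay\<^sup>2 + bx\<^sup>2 + by\<^sup>2"
    and "P \<equiv> ax * a11 + ay * a12 + bx * b11 + by * b12"
    and "Q \<equiv> ax * a12 + ay * a22 + bx * b12 + by * b22"
  assumes p: "p > 1" and T: "T > 0"
    and E: "T * (a11 + a22) + (p - 2) * (ax * P + ay * Q) = 0"
      "T * (b11 + b22) + (p - 2) * (bx * P + by * Q) = 0"
  shows "(a11 + a22)\<^sup>2 + (b11 + b22)\<^sup>2 
     \<le> ((p - 2) / min 1 (p / 2))\<^sup>2 * (((a11 - a22) / 2)\<^sup>2 + a12\<^sup>2 + ((b11 - b22) / 2)\<^sup>2 + b12\<^sup>2)"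
proof -
  define La Lb da db where defs: "La = a11 + a22" "Lb = b11 + b22" 
    "da = (a11 - a22) / 2" "db = (b11 - b22) / 2"
  define L where "L = La\<^sup>2 + Lb\<^sup>2"
  have L0: "L \<ge> 0" by (simp add: L_def)
  define M where "M = da\<^sup>2 + a12\<^sup>2 + db\<^sup>2 + b12\<^sup>2"
  define w1 w2 where w: "w1 = La * ax + Lb * bx" "w2 = La * ay + Lb * by"
  define r1 r2 where r: "r1 = ax * da + ay * a12 + bx * db + by * b12"
    "r2 = ax * a12 - ay * da + bx * b12 - by * db"
  define m where "m = min 1 (p / 2)"
  have m: "m > 0" "m \<le> 1" "m \<le> p / 2" using p by (auto simp: m_def)
  have PQ: "P = w1 / 2 + r1" "Q = w2 / 2 + r2"
    by (simp_all add: P_def Q_def w r defs field_simps)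
  have "T * L + (p - 2) * (w1 * P + w2 * Q) 
      = La * (T * La + (p - 2) * (ax * P + ay * Q)) + Lb * (T * Lb + (p - 2) * (bx * P + by * Q))"
    by (simp add: L_def w power2_eq_square algebra_simps)
  also have "\<dots> = 0" using E by (simp add: defs)
  finally have energy: "T * L + (p - 2) / 2 * (w1\<^sup>2 + w2\<^sup>2) = - ((p - 2) * (w1 * r1 + w2 * r2))"
    by (simp add: PQ power2_eq_square field_simps)
  have "T * L - (w1\<^sup>2 + w2\<^sup>2) = (La * bx - Lb * ax)\<^sup>2 + (La * by - Lb * ay)\<^sup>2"
    by (simp add: T_def L_def w power2_eq_square algebra_simps)
  then have s: "w1\<^sup>2 + w2\<^sup>2 \<le> T * L" by (smt (verit) zero_le_power2)
  have "T * M - (r1\<^sup>2 + r2\<^sup>2) = (ax * db - ay * b12 - bx * da + by * a12)\<^sup>2 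
      + (ax * b12 + ay * db - bx * a12 - by * da)\<^sup>2"
    by (simp add: T_def M_def r power2_eq_square algebra_simps)
  then have rM: "r1\<^sup>2 + r2\<^sup>2 \<le> T * M" by (smt (verit) zero_le_power2)
  have "(w1\<^sup>2 + w2\<^sup>2) * (r1\<^sup>2 + r2\<^sup>2) - (w1 * r1 + w2 * r2)\<^sup>2 = (w1 * r2 - w2 * r1)\<^sup>2"
    by (simp add: power2_eq_square algebra_simps)
  then have "(w1 * r1 + w2 * r2)\<^sup>2 \<le> (w1\<^sup>2 + w2\<^sup>2) * (r1\<^sup>2 + r2\<^sup>2)" by (smt (verit) zero_le_power2)
  also have "\<dots> \<le> (T * L) * (T * M)"
    using s rM T L0 by (intro mult_mono) auto
  finally have wr: "(w1 * r1 + w2 * r2)\<^sup>2 \<le> (T * L) * (T * M)" .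
  have lower: "m * (T * L) \<le> T * L + (p - 2) / 2 * (w1\<^sup>2 + w2\<^sup>2)"
  proof (cases "p \<ge> 2")
    case True
    have "m * (T * L) \<le> 1 * (T * L)" using m T L0 by (intro mult_right_mono) auto
    then show ?thesis using True by (simp add: add_increasing2)
  next
    case False
    have "(p - 2) / 2 * (T * L) \<le> (p - 2) / 2 * (w1\<^sup>2 + w2\<^sup>2)"
      using False s by (intro mult_left_mono_neg) auto
    moreover have "m * (T * L) \<le> p / 2 * (T * L)" using m T L0 by (intro mult_right_mono) auto
    ultimately show ?thesis by (simp add: field_simps)
  qed
  have "L \<le> ((p - 2) / m)\<^sup>2 * M"
  proof (cases "L = 0")
    case True
    then show ?thesis by (simp add: M_def)
  next
    case False
    then have L: "L > 0" using L0 by simp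
    have "(m * (T * L))\<^sup>2 \<le> (- ((p - 2) * (w1 * r1 + w2 * r2)))\<^sup>2"
      using lower energy m T L0 by (intro power_mono) auto
    also have "\<dots> = (p - 2)\<^sup>2 * (w1 * r1 + w2 * r2)\<^sup>2" by (simp add: power_mult_distrib)
    also have "\<dots> \<le> (p - 2)\<^sup>2 * ((T * L) * (T * M))" by (intro mult_left_mono wr) auto
    finally have "(T * T * L) * (m\<^sup>2 * L) \<le> (T * T * L) * ((p - 2)\<^sup>2 * M)"
      by (simp add: power2_eq_square algebra_simps)
    then have "m\<^sup>2 * L \<le> (p - 2)\<^sup>2 * M"
      using T L by (subst (asm) mult_le_cancel_left_pos) auto
    then show ?thesis using m by (simp add: power_divide field_simps)
  qed
  then show ?thesis by (simp add: L_def M_def m_def defs)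
qed

section \<open>Integrability of the curvature\<close>

lemma level_curvature_bound:
  assumes "\<bar>dx (dx v) z\<bar> \<le> h" "\<bar>dy (dx v) z\<bar> \<le> h" "\<bar>dy (dy v) z\<bar> \<le> h" and g: "grad v z \<noteq> 0"
  shows "\<bar>level_curvature v z\<bar> \<le> 2 * h / norm (grad v z)"
proof -
  let ?a = "dx v z" and ?b = "dy v z" and ?g = "norm (grad v z)"
  have g2: "?g\<^sup>2 = ?a\<^sup>2 + ?b\<^sup>2" by (rule norm_grad_squared)
  have h: "h \<ge> 0" using assms(1) by linarith
  have ab: "2 * \<bar>?a * ?b\<bar> \<le> ?a\<^sup>2 + ?b\<^sup>2"
    using sum_squares_bound[of ?a ?b] sum_squares_bound[of ?a "- ?b"] by (simp add: abs_if)
  have "\<bar>?b\<^sup>2 * dx (dx v) z - 2 * ?a * ?b * dy (dx v) z + ?a\<^sup>2 * dy (dy v) z\<bar>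
     \<le> \<bar>?b\<^sup>2 * dx (dx v) z\<bar> + \<bar>2 * ?a * ?b * dy (dx v) z\<bar> + \<bar>?a\<^sup>2 * dy (dy v) z\<bar>"
    by linarith
  also have "\<dots> = ?b\<^sup>2 * \<bar>dx (dx v) z\<bar> + 2 * \<bar>?a * ?b\<bar> * \<bar>dy (dx v) z\<bar> + ?a\<^sup>2 * \<bar>dy (dy v) z\<bar>"
    by (simp add: abs_mult)
  also have "\<dots> \<le> ?b\<^sup>2 * h + (?a\<^sup>2 + ?b\<^sup>2) * h + ?a\<^sup>2 * h"
    using assms ab by (intro add_mono mult_mono) auto
  also have "\<dots> = 2 * h * ?g\<^sup>2" by (simp add: g2 algebra_simps)
  finally have "\<bar>level_curvature v z\<bar> \<le> 2 * h * ?g\<^sup>2 / ?g ^ 3"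
    by (simp add: level_curvature_def abs_divide divide_right_mono)
  also have "\<dots> = 2 * h / ?g"
    using g by (simp add: power2_eq_square power3_eq_cube)
  finally show ?thesis .
qed

lemma continuous_on_level_curvature:
  assumes "Ck_on 2 S v" "\<And>z. z \<in> S \<Longrightarrow> grad v z \<noteq> 0"
  shows "continuous_on S (level_curvature v)"
proof -
  have C: "Ck_on (Suc 0) S (dx v)" "Ck_on (Suc 0) S (dy v)"
    using assms by (auto simp: numeral_2_eq_2)
  note c = Ck_on_imp_continuous_on[OF C(1)] Ck_on_imp_continuous_on[OF C(2)]
  have "norm (grad v z) = sqrt ((dx v z)\<^sup>2 + (dy v z)\<^sup>2)" for z
    by (metis norm_grad_squared norm_ge_zero real_sqrt_unique)
  then have "continuous_on S (\<lambda>z. norm (grad v z))"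
    using c by (simp add: continuous_intros)
  then show ?thesis
    unfolding level_curvature_def using C c assms(2) 
    by (auto intro!: continuous_intros)
qed

lemma set_integrable_level_curvature:
  assumes S: "open S" "Ck_on 2 S v" "\<And>z. z \<in> S \<Longrightarrow> grad v z \<noteq> 0"
    and W: "W absolutely_integrable_on S" "\<And>z. z \<in> S \<Longrightarrow> \<bar>level_curvature v z\<bar> \<le> W z"
  shows "level_curvature v absolutely_integrable_on S"
proof (rule set_integrable_bound[OF W(1)])
  have "set_borel_measurable borel S (level_curvature v)"
    unfolding set_borel_measurable_def
    using S by (intro borel_measurable_continuous_on_indicator continuous_on_level_curvature) auto
  then show "set_borel_measurable lebesgue S (level_curvature v)"
    unfolding set_borel_measurable_def by (simp add: measurable_completion)
  show "AE x in lebesgue. x \<in> S \<longrightarrow> norm (level_curvature v x) \<le> norm (W x)"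
    using W(2) by (intro AE_I2) (auto intro: order_trans abs_ge_self)
qed

text \<open>On the dyadic annulus of outer radius \<open>R / 2\<^sup>n\<close> the integrand is at most \<open>2\<^sup>n\<^sup>+\<^sup>1 / R\<close>, while
  the area is of order \<open>R\<^sup>2 / 4\<^sup>n\<close>: the contributions form a geometric series.\<close>

lemma nn_integral_inverse_dist_finite:
  fixes z0 :: complex
  assumes R: "R > 0"
  shows "(\<integral>\<^sup>+z. ennreal (indicator (ball z0 R) z / norm (z - z0)) \<partial>lborel) < \<infinity>"
proof -
  define c :: "nat \<Rightarrow> real" where "c n = 2 ^ Suc n / R" for n
  define b :: "nat \<Rightarrow> complex set" where "b n = ball z0 (R / 2 ^ n)" for n
  have [measurable]: "b n \<in> sets borel" for n by (simp add: b_def)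
  have c: "c n \<ge> 0" for n using R by (simp add: c_def)
  have "(\<integral>\<^sup>+z. ennreal (indicator (ball z0 R) z / norm (z - z0)) \<partial>lborel)
    \<le> (\<integral>\<^sup>+z. (\<Sum>n. ennreal (c n) * indicator (b n) z) \<partial>lborel)"
  proof (rule nn_integral_mono)
    fix z :: complex
    show "ennreal (indicator (ball z0 R) z / norm (z - z0)) \<le> (\<Sum>n. ennreal (c n) * indicator (b n) z)"
    proof (cases "z \<in> ball z0 R \<and> z \<noteq> z0")
      case False
      then show ?thesis by (auto simp: indicator_def)
    next
      case True
      then have d: "0 < dist z0 z" "dist z0 z < R" by auto
      obtain n0 where "(1 / 2) ^ n0 < dist z0 z / R"
        using d R real_arch_pow_inv[of "dist z0 z / R" "1 / 2"] by auto
      then have ex: "R / 2 ^ n0 \<le> dist z0 z"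
        using R by (simp add: field_simps power_one_over)
      define N where "N = (LEAST n. R / 2 ^ n \<le> dist z0 z)"
      have N: "R / 2 ^ N \<le> dist z0 z" unfolding N_def using ex by (rule LeastI)
      have "N \<noteq> 0" using N d by (intro notI) simp
      then obtain n where n: "N = Suc n" by (cases N) auto
      have "\<not> R / 2 ^ n \<le> dist z0 z"
        using not_less_Least[of n "\<lambda>n. R / 2 ^ n \<le> dist z0 z"] n N_def by auto
      then have zb: "z \<in> b n" by (simp add: b_def)
      have "1 / dist z0 z \<le> 1 / (R / 2 ^ N)" using N d R by (intro frac_le) auto
      then have le: "1 / norm (z - z0) \<le> c n"
        by (simp add: c_def n dist_norm norm_minus_commute)
      have "ennreal (indicator (ball z0 R) z / norm (z - z0)) \<le> ennreal (c n) * indicator (b n) z"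
        using le zb True by (simp add: ennreal_leI)
      also have "\<dots> = (\<Sum>k\<in>{n}. ennreal (c k) * indicator (b k) z)"
        by (subst sum.insert) (simp_all only: finite.emptyI empty_iff not_False_eq_True sum.empty add_0_right)
      also have "\<dots> \<le> (\<Sum>n. ennreal (c n) * indicator (b n) z)"
        by (intro sum_le_suminf) auto
      finally show ?thesis .
    qed
  qed
  also have "\<dots> = (\<Sum>n. \<integral>\<^sup>+z. ennreal (c n) * indicator (b n) z \<partial>lborel)"
    by (intro nn_integral_suminf) measurable
  also have "\<dots> = (\<Sum>n. ennreal (2 * pi * R * (1 / 2) ^ n))"
  proof (intro suminf_cong)
    fix n
    have "(\<integral>\<^sup>+z. ennreal (c n) * indicator (b n) z \<partial>lborel) = ennreal (c n) * emeasure lborel (b n)"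
      by (rule nn_integral_cmult_indicator) simp
    also have "emeasure lborel (b n) = ennreal (pi * (R / 2 ^ n)\<^sup>2)"
      unfolding b_def using R emeasure_ball[of "R / 2 ^ n" z0] by (simp add: unit_ball_vol_2)
    also have "ennreal (c n) * \<dots> = ennreal (c n * (pi * (R / 2 ^ n)\<^sup>2))"
      using c by (simp add: ennreal_mult)
    also have "c n * (pi * (R / 2 ^ n)\<^sup>2) = 2 * pi * R * (1 / 2) ^ n"
      using R by (simp add: c_def power2_eq_square field_simps power_one_over)
    finally show "(\<integral>\<^sup>+z. ennreal (c n) * indicator (b n) z \<partial>lborel) = ennreal (2 * pi * R * (1 / 2) ^ n)" .
  qed
  also have "\<dots> = ennreal (\<Sum>n. 2 * pi * R * (1 / 2) ^ n)"
    using R by (intro suminf_ennreal2 summable_mult summable_geometric) auto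
  also have "\<dots> < \<infinity>" by simp
  finally show ?thesis .
qed

lemma absolutely_integrable_inverse_dist:
  fixes z0 :: complex
  assumes "R > 0"
  shows "(\<lambda>z. 1 / norm (z - z0)) absolutely_integrable_on ball z0 R"
proof -
  have "integrable lborel (\<lambda>z. indicator (ball z0 R) z / norm (z - z0))"
    using nn_integral_inverse_dist_finite[OF assms, of z0] 
    by (intro integrableI_bounded borel_measurable_divide borel_measurable_indicator) auto
  then have "integrable lebesgue (\<lambda>z. indicator (ball z0 R) z / norm (z - z0))"
    by (subst integrable_completion) (auto intro!: borel_measurable_divide borel_measurable_indicator)
  then show ?thesis by (simp add: set_integrable_def)
qed


section \<open>The mass of thin bands around a level curve\<close>

definition normal_x :: "(complex \<Rightarrow> real) \<Rightarrow> complex \<Rightarrow> real" where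
  "normal_x v z = dx v z * inverse (norm (grad v z))"

definition normal_y :: "(complex \<Rightarrow> real) \<Rightarrow> complex \<Rightarrow> real" where
  "normal_y v z = dy v z * inverse (norm (grad v z))"

lemma normal_squared:
  assumes "grad v z \<noteq> 0"
  shows "(normal_x v z)\<^sup>2 + (normal_y v z)\<^sup>2 = 1"
    "normal_x v z * dx v z + normal_y v z * dy v z = norm (grad v z)"
proof -
  have g: "norm (grad v z) \<noteq> 0" using assms by simp
  have "(normal_x v z)\<^sup>2 + (normal_y v z)\<^sup>2 = ((dx v z)\<^sup>2 + (dy v z)\<^sup>2) / (norm (grad v z))\<^sup>2"
    by (simp add: normal_x_def normal_y_def power_mult_distrib field_simps add_divide_distrib)
  then show "(normal_x v z)\<^sup>2 + (normal_y v z)\<^sup>2 = 1"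
    using g by (simp add: norm_grad_squared[symmetric])
  have "normal_x v z * dx v z + normal_y v z * dy v z = ((dx v z)\<^sup>2 + (dy v z)\<^sup>2) / norm (grad v z)"
    by (simp add: normal_x_def normal_y_def power2_eq_square field_simps add_divide_distrib)
  then show "normal_x v z * dx v z + normal_y v z * dy v z = norm (grad v z)"
    unfolding norm_grad_squared[symmetric] using g by (simp add: power2_eq_square)
qed

lemma div_normal_eq_curvature:
  assumes S: "open S" and v: "Ck_on 2 S v" and reg: "\<And>z. z \<in> S \<Longrightarrow> grad v z \<noteq> 0"
  shows "Ck_on (Suc 0) S (normal_x v)" "Ck_on (Suc 0) S (normal_y v)"
    "z \<in> S \<Longrightarrow> dx (normal_x v) z + dy (normal_y v) z = - level_curvature v z"
proof -
  define G where "G z = dx v z * dx v z + dy v z * dy v z" for z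
  define \<rho> where "\<rho> z = inverse (sqrt (G z))" for z
  have C: "Ck_on (Suc 0) S (dx v)" "Ck_on (Suc 0) S (dy v)"
    using v by (auto simp: numeral_2_eq_2)
  have CG: "Ck_on (Suc 0) S G"
    unfolding G_def by (intro Ck_on_add Ck_on_mult C S)
  have norm_eq: "norm (grad v z) = sqrt (G z)" for z
    using norm_grad_squared[of v z] by (simp add: G_def power2_eq_square real_sqrt_unique)
  have G: "G z > 0" if "z \<in> S" for z
    using reg[OF that] norm_eq[of z] by (metis real_sqrt_gt_0_iff zero_less_norm_iff)
  have H: "((\<lambda>t. inverse (sqrt t)) has_real_derivative - (inverse (sqrt (G z)) ^ 3) / 2) (at (G z))" 
    if "z \<in> S" for z
    using G[OF that] by (auto intro!: derivative_eq_intros simp: field_simps power3_eq_cube)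
  have C\<rho>: "Ck_on (Suc 0) S \<rho>"
    unfolding \<rho>_def
  proof (rule Ck_on_real_compose[OF S CG H])
    have "\<forall>z\<in>S. sqrt (G z) \<noteq> 0" using G by force
    then show "continuous_on S (\<lambda>z. - (inverse (sqrt (G z)) ^ 3) / 2)"
      by (intro continuous_intros Ck_on_imp_continuous_on[OF CG]) auto
  qed
  have N: "normal_x v = (\<lambda>z. dx v z * \<rho> z)" "normal_y v = (\<lambda>z. dy v z * \<rho> z)"
    by (simp_all add: fun_eq_iff normal_x_def normal_y_def \<rho>_def norm_eq)
  show "Ck_on (Suc 0) S (normal_x v)" "Ck_on (Suc 0) S (normal_y v)"
    unfolding N by (intro Ck_on_mult C C\<rho> S)+
  assume z: "z \<in> S"
  have d: "dx v differentiable (at z)" "dy v differentiable (at z)" "G differentiable (at z)" "\<rho> differentiable (at z)"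
    using C CG C\<rho> z by auto
  have mixed: "dx (dy v) z = dy (dx v) z"
    using mixed_partials_eq[OF S v z] by simp
  have dG: "dx G z = 2 * (dx v z * dx (dx v) z + dy v z * dy (dx v) z)"
    "dy G z = 2 * (dx v z * dy (dx v) z + dy v z * dy (dy v) z)"
    unfolding G_def[abs_def] using d mixed by (simp_all add: partials_add partials_mult algebra_simps)
  have "dx \<rho> z = - (\<rho> z ^ 3) / 2 * dx G z" "dy \<rho> z = - (\<rho> z ^ 3) / 2 * dy G z"
    unfolding \<rho>_def[abs_def] using partials_real_compose[OF H[OF z] d(3)] by simp_all
  then have d\<rho>: "dx \<rho> z = - (\<rho> z ^ 3) * (dx v z * dx (dx v) z + dy v z * dy (dx v) z)"
    "dy \<rho> z = - (\<rho> z ^ 3) * (dx v z * dy (dx v) z + dy v z * dy (dy v) z)"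
    unfolding dG by simp_all
  have "\<rho> z * \<rho> z * G z = 1"
    using G[OF z] by (simp add: \<rho>_def mult.assoc[symmetric] real_sqrt_mult_self flip: inverse_mult_distrib)
  then have \<rho>G: "\<rho> z = \<rho> z ^ 3 * G z" by (simp add: power3_eq_cube mult.assoc)
  have "dx (normal_x v) z + dy (normal_y v) z 
      = \<rho> z * (dx (dx v) z + dy (dy v) z) + (dx v z * dx \<rho> z + dy v z * dy \<rho> z)"
    unfolding N partials_mult[OF d(1) d(4)] partials_mult[OF d(2) d(4)] by (simp add: algebra_simps)
  also have "\<dots> = (\<rho> z ^ 3 * G z) * (dx (dx v) z + dy (dy v) z) + (dx v z * dx \<rho> z + dy v z * dy \<rho> z)"
    using \<rho>G by simp
  also have "\<dots> = \<rho> z ^ 3 * ((dy v z)\<^sup>2 * dx (dx v) z - 2 * dx v z * dy v z * dy (dx v) z + (dx v z)\<^sup>2 * dy (dy v) z)"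
    unfolding d\<rho> by (simp add: G_def power2_eq_square algebra_simps)
  also have "\<dots> = - level_curvature v z"
    by (simp add: level_curvature_def norm_eq \<rho>_def divide_inverse power_inverse mult.commute)
  finally show "dx (normal_x v) z + dy (normal_y v) z = - level_curvature v z" .
qed

text \<open>A step from \<open>0\<close> to \<open>1\<close> of class \<open>C\<^sup>1\<close> whose slope \<open>step'\<close>, a trapezoid, is at most
  \<open>1 / (1 - \<beta>)\<close>: the sharp constant \<open>2\<pi>R\<close> requires slopes arbitrarily close to \<open>1\<close>.\<close>

definition step :: "real \<Rightarrow> real \<Rightarrow> real" where
  "step \<beta> t = ((max 0 t)\<^sup>2 - (max 0 (t - \<beta>))\<^sup>2 - (max 0 (t - (1 - \<beta>)))\<^sup>2 + (max 0 (t - 1))\<^sup>2) / (2 * \<beta> * (1 - \<beta>))"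

definition step' :: "real \<Rightarrow> real \<Rightarrow> real" where
  "step' \<beta> t = (max 0 t - max 0 (t - \<beta>) - max 0 (t - (1 - \<beta>)) + max 0 (t - 1)) / (\<beta> * (1 - \<beta>))"

lemma DERIV_positive_part_squared:
  fixes c t :: real
  shows "((\<lambda>t. (max 0 (t - c))\<^sup>2) has_real_derivative 2 * max 0 (t - c)) (at t)"
proof -
  consider "t > c" | "t < c" | "t = c" by linarith
  then show ?thesis
  proof cases
    case 1
    have "((\<lambda>t. (t - c)\<^sup>2) has_real_derivative 2 * max 0 (t - c)) (at t)"
      using 1 by (auto intro!: derivative_eq_intros)
    then show ?thesis
      by (rule has_field_derivative_transform_within_open[of _ _ _ "{c<..}"]) (use 1 in auto)
  next
    case 2
    have "((\<lambda>t. 0) has_real_derivative 2 * max 0 (t - c)) (at t)"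
      using 2 by auto
    then show ?thesis
      by (rule has_field_derivative_transform_within_open[of _ _ _ "{..<c}"]) (use 2 in auto)
  next
    case 3
    have "(\<lambda>h. ((max 0 (c + h - c))\<^sup>2 - (max 0 (c - c))\<^sup>2) / h) = max 0"
      by (auto simp: fun_eq_iff power2_eq_square max_def)
    moreover have "(max 0 \<longlongrightarrow> max 0 0) (at (0::real))"
      by (intro tendsto_max tendsto_const tendsto_ident_at)
    ultimately show ?thesis
      using 3 by (simp add: DERIV_def)
  qed
qed

lemma DERIV_step:
  assumes "0 < \<beta>" "\<beta> < 1"
  shows "(step \<beta> has_real_derivative step' \<beta> t) (at t)"
proof -
  have "((\<lambda>t. ((max 0 (t - 0))\<^sup>2 - (max 0 (t - \<beta>))\<^sup>2 - (max 0 (t - (1 - \<beta>)))\<^sup>2 + (max 0 (t - 1))\<^sup>2) / (2 * \<beta> * (1 - \<beta>)))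
    has_real_derivative 
     (2 * max 0 (t - 0) - 2 * max 0 (t - \<beta>) - 2 * max 0 (t - (1 - \<beta>)) + 2 * max 0 (t - 1)) / (2 * \<beta> * (1 - \<beta>))) (at t)"
    by (intro DERIV_cdivide DERIV_add DERIV_diff DERIV_positive_part_squared)
  moreover have "(2 * a - 2 * b - 2 * c + 2 * d) / (2 * \<beta> * (1 - \<beta>)) = (a - b - c + d) / (\<beta> * (1 - \<beta>))" 
    for a b c d :: real
    using mult_divide_mult_cancel_left[of 2 "a - b - c + d" "\<beta> * (1 - \<beta>)"] by (simp add: algebra_simps)
  ultimately show ?thesis
    by (simp add: step_def[abs_def] step'_def)
qed

lemma continuous_on_step': "continuous_on S (step' \<beta>)"
proof -
  have pos: "continuous_on S (\<lambda>t. max 0 (t - c))" for c :: real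
    by (intro continuous_on_max continuous_on_const continuous_on_diff continuous_on_id)
  have "continuous_on S (\<lambda>t. (max 0 (t - 0) - max 0 (t - \<beta>) - max 0 (t - (1 - \<beta>)) + max 0 (t - 1)) * (1 / (\<beta> * (1 - \<beta>))))"
    by (intro continuous_on_mult continuous_on_const continuous_on_add continuous_on_diff pos)
  then show ?thesis by (simp add: step'_def[abs_def])
qed

lemma step'_bounds:
  assumes \<beta>: "0 < \<beta>" "\<beta> < 1"
  shows "0 \<le> step' \<beta> t" "step' \<beta> t \<le> 1 / (1 - \<beta>)" "t \<le> 0 \<or> 1 \<le> t \<Longrightarrow> step' \<beta> t = 0"
proof -
  define q where "q s = max 0 s - max 0 (s - \<beta>)" for s
  have q_eq: "q s = min \<beta> (max 0 s)" for s using \<beta> by (simp add: q_def max_def min_def)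
  have mono: "q s \<le> q s'" if "s \<le> s'" for s s' 
    unfolding q_eq using that by (intro min.mono max.mono order_refl)
  have q: "0 \<le> q s" "q s \<le> \<beta>" for s using \<beta> by (auto simp: q_eq)
  have eq: "step' \<beta> t = (q t - q (t - (1 - \<beta>))) / (\<beta> * (1 - \<beta>))"
    by (simp add: step'_def q_def)
  show "0 \<le> step' \<beta> t"
    unfolding eq using mono[of "t - (1 - \<beta>)" t] \<beta> by simp
  have "q t - q (t - (1 - \<beta>)) \<le> \<beta>" using q(2)[of t] q(1)[of "t - (1 - \<beta>)"] by linarith
  then have "step' \<beta> t \<le> \<beta> / (\<beta> * (1 - \<beta>))"
    unfolding eq using \<beta> by (intro divide_right_mono) auto
  then show "step' \<beta> t \<le> 1 / (1 - \<beta>)" using \<beta> by simp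
  show "step' \<beta> t = 0" if "t \<le> 0 \<or> 1 \<le> t"
    using that \<beta> by (auto simp: step'_def max_def)
qed

lemma step_eq:
  assumes \<beta>: "0 < \<beta>" "\<beta> < 1"
  shows "t \<le> 0 \<Longrightarrow> step \<beta> t = 0" "1 \<le> t \<Longrightarrow> step \<beta> t = 1"
proof -
  show "step \<beta> t = 0" if "t \<le> 0"
    using that \<beta> by (simp add: step_def max_def)
  show "step \<beta> t = 1" if "1 \<le> t"
  proof -
    have "t\<^sup>2 - (t - \<beta>)\<^sup>2 - (t - (1 - \<beta>))\<^sup>2 + (t - 1)\<^sup>2 = 2 * \<beta> * (1 - \<beta>)"
      by (simp add: power2_eq_square algebra_simps)
    moreover have "max 0 t = t" "max 0 (t - \<beta>) = t - \<beta>" "max 0 (t - (1 - \<beta>)) = t - (1 - \<beta>)" "max 0 (t - 1) = t - 1"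
      using that \<beta> by auto
    ultimately show ?thesis unfolding step_def using \<beta> by simp
  qed
qed

lemma step_bounds:
  assumes \<beta>: "0 < \<beta>" "\<beta> < 1"
  shows "0 \<le> step \<beta> t" "step \<beta> t \<le> 1"
proof -
  have mono: "step \<beta> s \<le> step \<beta> s'" if "s \<le> s'" for s s'
    by (rule DERIV_nonneg_imp_nondecreasing[OF that])
      (rule exI conjI DERIV_step[OF \<beta>] step'_bounds(1)[OF \<beta>])+
  show "0 \<le> step \<beta> t" using mono[of "min t 0" t] step_eq(1)[OF \<beta>, of "min t 0"] by simp
  show "step \<beta> t \<le> 1" using mono[of t "max t 1"] step_eq(2)[OF \<beta>, of "max t 1"] by simp
qed

lemma Ck_on_step_compose:
  assumes "open S" "Ck_on (Suc 0) S f" "0 < \<beta>" "\<beta> < 1"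
  shows "Ck_on (Suc 0) S (\<lambda>z. step \<beta> (f z))"
proof (rule Ck_on_real_compose[OF assms(1,2)])
  show "(step \<beta> has_real_derivative step' \<beta> (f z)) (at (f z))" for z
    by (rule DERIV_step[OF assms(3,4)])
  show "continuous_on S (\<lambda>z. step' \<beta> (f z))"
    using continuous_on_compose2[OF continuous_on_step'[of UNIV \<beta>] Ck_on_imp_continuous_on[OF assms(2)]] by simp
qed

lemma partials_affine:
  fixes f :: "complex \<Rightarrow> real"
  assumes "f differentiable (at z)"
  shows "dx (\<lambda>z. k * f z + l) z = k * dx f z" "dy (\<lambda>z. k * f z + l) z = k * dy f z"
proof -
  have "((\<lambda>t. k * t + l) has_real_derivative k) (at (f z))"
    by (auto intro!: derivative_eq_intros)
  from partials_real_compose[OF this assms]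
  show "dx (\<lambda>z. k * f z + l) z = k * dx f z" "dy (\<lambda>z. k * f z + l) z = k * dy f z" by simp_all
qed

lemma partials_dist_squared:
  fixes z0 :: complex
  shows "dx (\<lambda>z. (norm (z - z0))\<^sup>2) z = 2 * Re (z - z0)" "dy (\<lambda>z. (norm (z - z0))\<^sup>2) z = 2 * Im (z - z0)"
proof -
  have "((\<lambda>z. (norm (z - z0))\<^sup>2) has_derivative (\<lambda>h. 2 * Re h * Re (z - z0) + 2 * Im h * Im (z - z0))) (at z)"
    unfolding cmod_power2 by (auto intro!: derivative_eq_intros simp: fun_eq_iff algebra_simps)
  from partials_eqI[OF this] show "dx (\<lambda>z. (norm (z - z0))\<^sup>2) z = 2 * Re (z - z0)" 
    "dy (\<lambda>z. (norm (z - z0))\<^sup>2) z = 2 * Im (z - z0)" by simp_all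
qed

lemma emeasure_annulus:
  fixes z0 :: complex
  assumes "0 \<le> s" "s \<le> t"
  shows "{z. s < (norm (z - z0))\<^sup>2 \<and> (norm (z - z0))\<^sup>2 < t} \<in> sets borel"
    "emeasure lborel {z. s < (norm (z - z0))\<^sup>2 \<and> (norm (z - z0))\<^sup>2 < t} \<le> ennreal (pi * (t - s))"
proof -
  let ?A = "{z. s < (norm (z - z0))\<^sup>2 \<and> (norm (z - z0))\<^sup>2 < t}"
  have eq: "?A = ball z0 (sqrt t) - cball z0 (sqrt s)"
  proof -
    have "s < (norm w)\<^sup>2 \<longleftrightarrow> sqrt s < norm w" "(norm w)\<^sup>2 < t \<longleftrightarrow> norm w < sqrt t" for w :: complex
      by (metis real_sqrt_less_iff real_sqrt_abs abs_norm_cancel)+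
    then show ?thesis by (auto simp: dist_norm norm_minus_commute[of z0])
  qed
  show "?A \<in> sets borel" unfolding eq by auto
  show "emeasure lborel ?A \<le> ennreal (pi * (t - s))"
  proof (cases "s = t")
    case True
    then have "?A = {}" by auto
    then show ?thesis by (simp only: emeasure_empty zero_le)
  next
    case False
    then have st: "sqrt s < sqrt t" using assms by simp
    have b: "emeasure lborel (ball z0 (sqrt t)) = ennreal (pi * t)"
      using assms emeasure_ball[of "sqrt t" z0] by (simp add: unit_ball_vol_2)
    have c: "emeasure lborel (cball z0 (sqrt s)) = ennreal (pi * s)"
      using assms emeasure_cball[of "sqrt s" z0] by (simp add: unit_ball_vol_2)
    have "emeasure lborel ?A = emeasure lborel (ball z0 (sqrt t)) - emeasure lborel (cball z0 (sqrt s))"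
    proof -
      have "cball z0 (sqrt s) \<subseteq> ball z0 (sqrt t)"
      proof
        fix x assume "x \<in> cball z0 (sqrt s)"
        then have "dist z0 x \<le> sqrt s" by (simp only: mem_cball)
        with st have "dist z0 x < sqrt t" by linarith
        then show "x \<in> ball z0 (sqrt t)" by (simp only: mem_ball)
      qed
      then show ?thesis unfolding eq by (intro emeasure_Diff) (auto simp: c)
    qed
    also have "\<dots> = ennreal (pi * (t - s))"
      unfolding b c using assms by (simp add: ennreal_minus algebra_simps)
    finally show ?thesis by simp
  qed
qed

text \<open>As a function of \<open>|z - z\<^sub>0|\<^sup>2\<close> the slope of a radial cutoff integrates to \<open>\<pi>\<close> over the plane,
  whatever the width of the annulus; the factor \<open>|\<nabla> |z - z\<^sub>0|\<^sup>2| = 2 |z - z\<^sub>0|\<close> then gives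
  the length of the outer circle, up to the factor \<open>1 / (1 - \<beta>)\<close>. The inner circle, which removes
  the possible critical point \<open>z\<^sub>0\<close>, contributes its own small length.\<close>

lemma annular_cutoff:
  fixes z0 :: complex
  assumes \<beta>: "0 < \<beta>" "\<beta> < 1" and s: "0 < s" "2 * s < a" "a < b"
  defines "\<tau> \<equiv> \<lambda>z. (norm (z - z0))\<^sup>2"
  obtains \<phi> where "Ck_on (Suc 0) UNIV \<phi>" "\<And>z. 0 \<le> \<phi> z" "\<And>z. \<phi> z \<le> 1"
    "\<And>z. 2 * s \<le> \<tau> z \<Longrightarrow> \<tau> z \<le> a \<Longrightarrow> \<phi> z = 1"
    "\<And>z. \<not> (s \<le> \<tau> z \<and> \<tau> z \<le> b) \<Longrightarrow> \<phi> z = 0"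
    "integrable lborel (\<lambda>z. norm (grad \<phi> z))"
    "(LINT z|lborel. norm (grad \<phi> z)) \<le> 2 * pi / (1 - \<beta>) * (sqrt (2 * s) + sqrt b)"
proof
  define f g where "f z = (1 / s) * \<tau> z + - 1" and "g z = (- 1 / (b - a)) * \<tau> z + b / (b - a)" for z
  define \<phi> where "\<phi> z = step \<beta> (f z) * step \<beta> (g z)" for z
  have f_eq: "f z = (\<tau> z - s) / s" and g_eq: "g z = (b - \<tau> z) / (b - a)" for z
    using s by (simp_all add: f_def g_def diff_divide_distrib)
  have C\<tau>: "Ck_on (Suc 0) UNIV \<tau>" unfolding \<tau>_def by (rule Ck_on_dist_squared)
  have Cf: "Ck_on (Suc 0) UNIV f" and Cg: "Ck_on (Suc 0) UNIV g"
    unfolding f_def g_def by (intro Ck_on_add Ck_on_mult Ck_on_const C\<tau> open_UNIV)+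
  have Csf: "Ck_on (Suc 0) UNIV (\<lambda>z. step \<beta> (f z))" and Csg: "Ck_on (Suc 0) UNIV (\<lambda>z. step \<beta> (g z))"
    using \<beta> by (intro Ck_on_step_compose Cf Cg open_UNIV; simp)+
  show C\<phi>: "Ck_on (Suc 0) UNIV \<phi>"
    unfolding \<phi>_def by (intro Ck_on_mult Csf Csg open_UNIV)
  note sb = step_bounds[OF \<beta>]
  show "0 \<le> \<phi> z" "\<phi> z \<le> 1" for z
    unfolding \<phi>_def using sb by (auto intro: mult_le_one)
  show "\<phi> z = 1" if "2 * s \<le> \<tau> z" "\<tau> z \<le> a" for z
    unfolding \<phi>_def f_eq g_eq using that s step_eq(2)[OF \<beta>] by (simp add: field_simps)
  show outside: "\<phi> z = 0" if "\<not> (s \<le> \<tau> z \<and> \<tau> z \<le> b)" for z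
    unfolding \<phi>_def f_eq g_eq using that s step_eq(1)[OF \<beta>] 
    by (auto simp: not_le divide_nonpos_pos)
  have \<tau>0: "\<tau> z \<ge> 0" for z by (simp add: \<tau>_def)
  define A1 A2 where "A1 = {z. s < \<tau> z \<and> \<tau> z < 2 * s}" and "A2 = {z. a < \<tau> z \<and> \<tau> z < b}"
  define c1 c2 where "c1 = 2 * sqrt (2 * s) / (s * (1 - \<beta>))" and "c2 = 2 * sqrt b / ((b - a) * (1 - \<beta>))"
  have c: "c1 \<ge> 0" "c2 \<ge> 0" using s \<beta> by (auto simp: c1_def c2_def)
  have bound: "norm (grad \<phi> z) \<le> c1 * indicator A1 z + c2 * indicator A2 z" for z
  proof -
    define d where "d = step' \<beta> (f z) / s * step \<beta> (g z) - step \<beta> (f z) * step' \<beta> (g z) / (b - a)"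
    have \<tau>d: "\<tau> differentiable (at z)" "f differentiable (at z)" "g differentiable (at z)"
      "(\<lambda>z. step \<beta> (f z)) differentiable (at z)" "(\<lambda>z. step \<beta> (g z)) differentiable (at z)"
      using C\<tau> Cf Cg Csf Csg by auto
    have df: "dx f z = 1 / s * dx \<tau> z" "dy f z = 1 / s * dy \<tau> z"
      "dx g z = (- 1 / (b - a)) * dx \<tau> z" "dy g z = (- 1 / (b - a)) * dy \<tau> z"
      unfolding f_def[abs_def] g_def[abs_def] by (rule partials_affine[OF \<tau>d(1)])+
    have "dx \<phi> z = d * dx \<tau> z" "dy \<phi> z = d * dy \<tau> z"
      unfolding \<phi>_def[abs_def] partials_mult[OF \<tau>d(4,5)] 
        partials_real_compose[OF DERIV_step[OF \<beta>] \<tau>d(2)] partials_real_compose[OF DERIV_step[OF \<beta>] \<tau>d(3)] df d_def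
      by (simp_all add: algebra_simps)
    then have "(norm (grad \<phi> z))\<^sup>2 = d\<^sup>2 * ((dx \<tau> z)\<^sup>2 + (dy \<tau> z)\<^sup>2)"
      unfolding norm_grad_squared by (simp add: power_mult_distrib algebra_simps)
    also have "(dx \<tau> z)\<^sup>2 + (dy \<tau> z)\<^sup>2 = 4 * \<tau> z"
    proof -
      have "dx \<tau> z = 2 * Re (z - z0)" "dy \<tau> z = 2 * Im (z - z0)"
        unfolding \<tau>_def by (rule partials_dist_squared)+
      moreover have "\<tau> z = (Re (z - z0))\<^sup>2 + (Im (z - z0))\<^sup>2"
        unfolding \<tau>_def by (rule cmod_power2)
      ultimately show ?thesis by (simp only: power_mult_distrib) simp
    qed
    also have "d\<^sup>2 * (4 * \<tau> z) = (\<bar>d\<bar> * (2 * sqrt (\<tau> z)))\<^sup>2"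
      using \<tau>0 by (simp add: power_mult_distrib)
    finally have norm_eq: "norm (grad \<phi> z) = \<bar>d\<bar> * (2 * sqrt (\<tau> z))"
      using \<tau>0 by (subst (asm) power2_eq_iff_nonneg) auto
    have "\<bar>d\<bar> \<le> step' \<beta> (f z) / s * step \<beta> (g z) + step \<beta> (f z) * step' \<beta> (g z) / (b - a)"
    proof -
      have "0 \<le> step' \<beta> (f z) / s * step \<beta> (g z)" "0 \<le> step \<beta> (f z) * step' \<beta> (g z) / (b - a)"
        using s sb step'_bounds(1)[OF \<beta>] by auto
      then show ?thesis unfolding d_def by linarith
    qed
    also have "\<dots> \<le> step' \<beta> (f z) / s * 1 + 1 * step' \<beta> (g z) / (b - a)"
      using s sb step'_bounds(1)[OF \<beta>] by (intro add_mono mult_mono divide_right_mono) auto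
    finally have "norm (grad \<phi> z) \<le> (step' \<beta> (f z) / s + step' \<beta> (g z) / (b - a)) * (2 * sqrt (\<tau> z))"
      unfolding norm_eq using \<tau>0 by (intro mult_right_mono) auto
    also have "\<dots> = step' \<beta> (f z) / s * (2 * sqrt (\<tau> z)) + step' \<beta> (g z) / (b - a) * (2 * sqrt (\<tau> z))"
      by (simp add: algebra_simps)
    also have "\<dots> \<le> c1 * indicator A1 z + c2 * indicator A2 z"
    proof (rule add_mono)
      show "step' \<beta> (f z) / s * (2 * sqrt (\<tau> z)) \<le> c1 * indicator A1 z"
      proof (cases "z \<in> A1")
        case True
        have "step' \<beta> (f z) / s * (2 * sqrt (\<tau> z)) \<le> (1 / (1 - \<beta>)) / s * (2 * sqrt (2 * s))"
          using True s \<beta> \<tau>0 step'_bounds[OF \<beta>] by (intro mult_mono divide_right_mono) (auto simp: A1_def)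
        then show ?thesis using True by (simp add: c1_def mult.commute)
      next
        case False
        then have "f z \<le> 0 \<or> 1 \<le> f z" using s by (auto simp: A1_def f_eq field_simps)
        then show ?thesis using step'_bounds(3)[OF \<beta>] False by simp
      qed
      show "step' \<beta> (g z) / (b - a) * (2 * sqrt (\<tau> z)) \<le> c2 * indicator A2 z"
      proof (cases "z \<in> A2")
        case True
        have "step' \<beta> (g z) / (b - a) * (2 * sqrt (\<tau> z)) \<le> (1 / (1 - \<beta>)) / (b - a) * (2 * sqrt b)"
          using True s \<beta> \<tau>0 step'_bounds[OF \<beta>] by (intro mult_mono divide_right_mono) (auto simp: A2_def)
        then show ?thesis using True by (simp add: c2_def mult.commute)
      next
        case False
        then have "g z \<le> 0 \<or> 1 \<le> g z" using s by (auto simp: A2_def g_eq field_simps)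
        then show ?thesis using step'_bounds(3)[OF \<beta>] False by simp
      qed
    qed
    finally show ?thesis .
  qed
  have meas: "A1 \<in> sets borel" "A2 \<in> sets borel"
    and em: "emeasure lborel A1 \<le> ennreal (pi * s)" "emeasure lborel A2 \<le> ennreal (pi * (b - a))"
    using emeasure_annulus[of s "2 * s" z0] emeasure_annulus[of a b z0] s
    by (auto simp: A1_def A2_def \<tau>_def)
  show int: "integrable lborel (\<lambda>z. norm (grad \<phi> z))"
  proof (rule integrable_continuous_compact_support)
    show "compact (cball z0 (sqrt b))" by simp
    have norm_eq: "norm (grad \<phi> z) = sqrt ((dx \<phi> z)\<^sup>2 + (dy \<phi> z)\<^sup>2)" for z
      by (metis norm_grad_squared norm_ge_zero real_sqrt_unique)
    show "continuous_on (cball z0 (sqrt b)) (\<lambda>z. norm (grad \<phi> z))"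
      unfolding norm_eq using C\<phi> by (auto intro!: continuous_intros intro: continuous_on_subset)
    show "norm (grad \<phi> z) = 0" if "z \<notin> cball z0 (sqrt b)" for z
    proof -
      have "sqrt b < norm (z - z0)" using that by (simp add: dist_norm norm_minus_commute)
      then have "b < \<tau> z" unfolding \<tau>_def using s by (metis norm_ge_zero real_le_rsqrt not_le)
      then have "z \<notin> A1" "z \<notin> A2" using s by (auto simp: A1_def A2_def)
      then show ?thesis using bound[of z] by simp
    qed
  qed
  have "ennreal (LINT z|lborel. norm (grad \<phi> z)) = (\<integral>\<^sup>+z. ennreal (norm (grad \<phi> z)) \<partial>lborel)"
    using nn_integral_eq_integral[OF int] by simp
  also have "\<dots> \<le> (\<integral>\<^sup>+z. ennreal c1 * indicator A1 z + ennreal c2 * indicator A2 z \<partial>lborel)"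
  proof (rule nn_integral_mono)
    fix z
    have "ennreal (norm (grad \<phi> z)) \<le> ennreal (c1 * indicator A1 z + c2 * indicator A2 z)"
      using bound by (rule ennreal_leI)
    also have "\<dots> = ennreal c1 * indicator A1 z + ennreal c2 * indicator A2 z"
      using c by (auto simp: indicator_def)
    finally show "ennreal (norm (grad \<phi> z)) \<le> ennreal c1 * indicator A1 z + ennreal c2 * indicator A2 z" .
  qed
  also have "\<dots> = ennreal c1 * emeasure lborel A1 + ennreal c2 * emeasure lborel A2"
    using meas by (subst nn_integral_add) (auto simp: nn_integral_cmult_indicator)
  also have "\<dots> \<le> ennreal c1 * ennreal (pi * s) + ennreal c2 * ennreal (pi * (b - a))"
    using em by (intro add_mono mult_left_mono) auto
  also have "\<dots> = ennreal (c1 * (pi * s) + c2 * (pi * (b - a)))"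
    using c s by (simp add: ennreal_mult)
  finally have "(LINT z|lborel. norm (grad \<phi> z)) \<le> c1 * (pi * s) + c2 * (pi * (b - a))"
    using c s by (subst (asm) ennreal_le_iff) auto
  also have "\<dots> = 2 * pi / (1 - \<beta>) * (sqrt (2 * s) + sqrt b)"
  proof -
    have "2 * q / (x * (1 - \<beta>)) * (pi * x) = 2 * pi / (1 - \<beta>) * q" if "x \<noteq> 0" for q x :: real
    proof -
      have "2 * q / (x * (1 - \<beta>)) * (pi * x) = (x * (2 * pi * q)) / (x * (1 - \<beta>))" by simp
      also have "\<dots> = 2 * pi * q / (1 - \<beta>)" using that by (rule mult_divide_mult_cancel_left)
      finally show ?thesis by simp
    qed
    then show ?thesis
      unfolding c1_def c2_def using s by (simp only: distrib_left)
  qed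
  finally show "(LINT z|lborel. norm (grad \<phi> z)) \<le> 2 * pi / (1 - \<beta>) * (sqrt (2 * s) + sqrt b)" .
qed

text \<open>A continuous approximation of \<open>|\<nabla>v|\<close> times the Dirac measure of \<open>{v = c}\<close>, that is of arc length
  on the level curve.\<close>

definition band_density :: "(complex \<Rightarrow> real) \<Rightarrow> real \<Rightarrow> real \<Rightarrow> real \<Rightarrow> complex \<Rightarrow> real" where
  "band_density v c \<beta> \<epsilon> z = step' \<beta> ((v z - c) / (2 * \<epsilon>) + 1 / 2) / (2 * \<epsilon>) * norm (grad v z)"

lemma continuous_on_band_density:
  assumes "Ck_on (Suc 0) S v"
  shows "continuous_on S (band_density v c \<beta> \<epsilon>)"
proof -
  have C: "continuous_on S (dx v)" "continuous_on S (dy v)" "continuous_on S v"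
    using assms Ck_on_imp_continuous_on[OF assms] by auto
  have norm_eq: "norm (grad v z) = sqrt ((dx v z)\<^sup>2 + (dy v z)\<^sup>2)" for z
    by (metis norm_grad_squared norm_ge_zero real_sqrt_unique)
  have n: "continuous_on S (\<lambda>z. norm (grad v z))"
    unfolding norm_eq by (intro continuous_intros C)
  have "continuous_on S (\<lambda>z. (v z - c) / (2 * \<epsilon>) + 1 / 2)"
    unfolding divide_inverse by (intro continuous_intros C)
  from continuous_on_compose2[OF continuous_on_step'[of UNIV] this]
  have s: "continuous_on S (\<lambda>z. step' \<beta> ((v z - c) / (2 * \<epsilon>) + 1 / 2))" by simp
  from continuous_on_mult[OF continuous_on_mult[OF s continuous_on_const[of _ "1 / (2 * \<epsilon>)"]] n]
  show ?thesis by (simp add: band_density_def[abs_def])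
qed

text \<open>Test the identity \<open>div N = - k\<close> with \<open>\<psi>(v) \<phi>\<close>, where \<open>\<psi>\<close> climbs from \<open>- 1/2\<close> to \<open>1/2\<close>
  across the band and \<open>\<phi>\<close> is an annular cutoff. Centering the values of \<open>\<psi>\<close> at \<open>0\<close> gains a factor
  \<open>1/2\<close> over the estimate on one side of the curve; the covering argument loses it again.\<close>

lemma band_mass_le:
  fixes v :: "complex \<Rightarrow> real" and z0 :: complex and R c \<beta> \<epsilon> \<sigma> :: real
  defines "S \<equiv> ball z0 R - {z0}"
  assumes R: "R > 0" and v: "Ck_on 2 S v" and reg: "\<And>z. z \<in> S \<Longrightarrow> grad v z \<noteq> 0"
    and k: "integrable lborel (\<lambda>z. indicator S z * \<bar>level_curvature v z\<bar>)"
    and K: "compact K" "K \<subseteq> S" and \<beta>: "0 < \<beta>" "\<beta> < 1" and \<epsilon>: "\<epsilon> > 0" and \<sigma>: "\<sigma> > 0"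
  shows "(\<integral>\<^sup>+z. indicator K z * ennreal (band_density v c \<beta> \<epsilon> z) \<partial>lborel)
    \<le> ennreal (((LINT z|lborel. indicator S z * \<bar>level_curvature v z\<bar>) + 2 * pi / (1 - \<beta>) * (R + \<sigma>)) / 2)"
proof (cases "K = {}")
  case True
  then show ?thesis by simp
next
  case False
  let ?\<tau> = "\<lambda>z. (norm (z - z0))\<^sup>2"
  let ?N1 = "normal_x v" and ?N2 = "normal_y v" and ?k = "level_curvature v"
  have S: "open S" by (simp add: S_def open_Diff)
  have "continuous_on K ?\<tau>" by (intro continuous_intros)
  from continuous_attains_inf[OF K(1) False this] continuous_attains_sup[OF K(1) False this]
  obtain x y where x: "x \<in> K" "\<And>z. z \<in> K \<Longrightarrow> ?\<tau> x \<le> ?\<tau> z" and y: "y \<in> K" "\<And>z. z \<in> K \<Longrightarrow> ?\<tau> z \<le> ?\<tau> y"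
    by blast
  have \<tau>x: "?\<tau> x > 0" using x(1) K(2) by (auto simp: S_def)
  have \<tau>y: "?\<tau> y < R\<^sup>2" 
    using y(1) K(2) R by (auto simp: S_def dist_norm norm_minus_commute intro!: power_strict_mono)
  \<comment> \<open>Then \<open>K\<close> lies in the annulus \<open>2 s \<le> |z - z\<^sub>0|\<^sup>2 \<le> a\<close>, where the cutoff is \<open>1\<close>, and the inner
    ramp of the cutoff stays within distance \<open>\<sigma>\<close> of the center.\<close>
  define s where "s = min (?\<tau> x) (\<sigma>\<^sup>2) / 2"
  define a where "a = (?\<tau> y + R\<^sup>2) / 2"
  define b where "b = (a + R\<^sup>2) / 2"
  have s: "0 < s" "2 * s \<le> ?\<tau> x" "2 * s \<le> \<sigma>\<^sup>2" using \<tau>x \<sigma> by (auto simp: s_def)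
  have ab: "?\<tau> y < a" "a < b" "b < R\<^sup>2" using \<tau>y by (auto simp: a_def b_def)
  have "2 * s < a" using s(2) x(2)[OF y(1)] ab by linarith
  then obtain \<phi> where \<phi>: "Ck_on (Suc 0) UNIV \<phi>" "\<And>z. 0 \<le> \<phi> z" "\<And>z. \<phi> z \<le> 1"
    "\<And>z. 2 * s \<le> ?\<tau> z \<Longrightarrow> ?\<tau> z \<le> a \<Longrightarrow> \<phi> z = 1"
    "\<And>z. \<not> (s \<le> ?\<tau> z \<and> ?\<tau> z \<le> b) \<Longrightarrow> \<phi> z = 0"
    "integrable lborel (\<lambda>z. norm (grad \<phi> z))"
    "(LINT z|lborel. norm (grad \<phi> z)) \<le> 2 * pi / (1 - \<beta>) * (sqrt (2 * s) + sqrt b)"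
    by (rule annular_cutoff[OF \<beta> s(1) _ ab(2), of z0]) blast
  have "sqrt (2 * s) \<le> sqrt (\<sigma>\<^sup>2)" "sqrt b \<le> sqrt (R\<^sup>2)"
    using s(3) ab by (intro real_sqrt_le_mono; simp)+
  then have "sqrt (2 * s) + sqrt b \<le> R + \<sigma>" using \<sigma> R by simp
  then have "2 * pi / (1 - \<beta>) * (sqrt (2 * s) + sqrt b) \<le> 2 * pi / (1 - \<beta>) * (R + \<sigma>)"
    using \<beta> by (intro mult_left_mono) auto
  with \<phi>(7) have int_grad: "(LINT z|lborel. norm (grad \<phi> z)) \<le> 2 * pi / (1 - \<beta>) * (R + \<sigma>)" by linarith
  have \<phi>K: "\<phi> z = 1" if "z \<in> K" for z
    using \<phi>(4)[of z] x(2)[OF that] y(2)[OF that] s ab by linarith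
  define K' where "K' = {z. s \<le> ?\<tau> z \<and> ?\<tau> z \<le> b}"
  have K'_closed: "closed K'" unfolding K'_def by (intro closed_Collect_conj closed_Collect_le continuous_intros)
  have K'_sub: "K' \<subseteq> S"
  proof
    fix z assume z: "z \<in> K'"
    then have "(norm (z - z0))\<^sup>2 < R\<^sup>2" using ab by (auto simp: K'_def)
    then have "norm (z - z0) < R" using R by (meson less_imp_le power_less_imp_less_base)
    then show "z \<in> S" using z s by (auto simp: S_def K'_def dist_norm norm_minus_commute)
  qed
  then have "bounded K'" unfolding S_def by (meson Diff_subset bounded_ball bounded_subset)
  then have K': "compact K'" "K' \<subseteq> S" "\<And>z. z \<notin> K' \<Longrightarrow> \<phi> z = 0"
    using K'_closed K'_sub \<phi>(5) by (auto simp: compact_eq_bounded_closed K'_def)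
  define \<psi> where "\<psi> z = step \<beta> (1 / (2 * \<epsilon>) * v z + (1 / 2 - c / (2 * \<epsilon>))) + - 1 / 2" for z
  define m where "m = band_density v c \<beta> \<epsilon>"
  have Cv: "Ck_on (Suc 0) S v" using Ck_on_SucD v unfolding numeral_2_eq_2 by blast
  have Carg: "Ck_on (Suc 0) S (\<lambda>z. 1 / (2 * \<epsilon>) * v z + (1 / 2 - c / (2 * \<epsilon>)))"
    by (intro Ck_on_add Ck_on_mult Ck_on_const Cv S)
  have C\<psi>: "Ck_on (Suc 0) S \<psi>"
    unfolding \<psi>_def by (intro Ck_on_add Ck_on_step_compose Carg Ck_on_const S \<beta>)
  note CN = div_normal_eq_curvature(1,2)[OF S v reg]
  have CG: "Ck_on (Suc 0) S (\<lambda>z. ?N1 z * \<psi> z)" "Ck_on (Suc 0) S (\<lambda>z. ?N2 z * \<psi> z)"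
    using Ck_on_mult[OF S CN(1) C\<psi>] Ck_on_mult[OF S CN(2) C\<psi>] by simp_all
  have div: "dx (\<lambda>z. ?N1 z * \<psi> z) z + dy (\<lambda>z. ?N2 z * \<psi> z) z = - ?k z * \<psi> z + m z" if z: "z \<in> S" for z
  proof -
    have d: "?N1 differentiable (at z)" "?N2 differentiable (at z)" "\<psi> differentiable (at z)" "v differentiable (at z)"
      "(\<lambda>z. 1 / (2 * \<epsilon>) * v z + (1 / 2 - c / (2 * \<epsilon>))) differentiable (at z)"
      using CN C\<psi> Cv Carg z by auto
    have d': "(\<lambda>z. step \<beta> (1 / (2 * \<epsilon>) * v z + (1 / 2 - c / (2 * \<epsilon>)))) differentiable (at z)"
      using Ck_on_step_compose[OF S Carg \<beta>] z by auto
    have arg: "1 / (2 * \<epsilon>) * v z + (1 / 2 - c / (2 * \<epsilon>)) = (v z - c) / (2 * \<epsilon>) + 1 / 2"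
      by (simp add: diff_divide_distrib)
    have d\<psi>: "dx \<psi> z = step' \<beta> ((v z - c) / (2 * \<epsilon>) + 1 / 2) / (2 * \<epsilon>) * dx v z"
      "dy \<psi> z = step' \<beta> ((v z - c) / (2 * \<epsilon>) + 1 / 2) / (2 * \<epsilon>) * dy v z"
      unfolding \<psi>_def[abs_def] partials_add[OF d' differentiable_const] partials_const 
         partials_real_compose[OF DERIV_step[OF \<beta>] d(5)] arg partials_affine[OF d(4)] by simp_all
    have "dx (\<lambda>z. ?N1 z * \<psi> z) z + dy (\<lambda>z. ?N2 z * \<psi> z) z 
      = (dx ?N1 z + dy ?N2 z) * \<psi> z 
       + step' \<beta> ((v z - c) / (2 * \<epsilon>) + 1 / 2) / (2 * \<epsilon>) * (?N1 z * dx v z + ?N2 z * dy v z)"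
      unfolding partials_mult[OF d(1,3)] partials_mult[OF d(2,3)] d\<psi> by (simp add: algebra_simps add_divide_distrib)
    then show ?thesis
      using div_normal_eq_curvature(3)[OF S v reg z] normal_squared(2)[OF reg[OF z]] 
      by (simp add: m_def band_density_def)
  qed
  have m0: "m z \<ge> 0" for z
    using step'_bounds(1)[OF \<beta>] \<epsilon> by (simp add: m_def band_density_def)
  have \<psi>_le: "\<bar>\<psi> z\<bar> \<le> 1 / 2" for z
    using step_bounds[OF \<beta>, of "1 / (2 * \<epsilon>) * v z + (1 / 2 - c / (2 * \<epsilon>))"] unfolding \<psi>_def by linarith
  note ibp = integration_by_parts[OF S CG \<phi>(1) K']
  have int_m: "integrable lborel (\<lambda>z. indicator S z * (m z * \<phi> z))"
  proof (rule integrable_continuous_compact_support[OF _ K'(1)])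
    have "continuous_on K' m" "continuous_on K' \<phi>"
      using continuous_on_band_density[OF Cv] Ck_on_imp_continuous_on[OF \<phi>(1)] K'(2) 
      by (auto simp: m_def intro: continuous_on_subset)
    then have "continuous_on K' (\<lambda>z. m z * \<phi> z)" by (rule continuous_on_mult)
    then show "continuous_on K' (\<lambda>z. indicator S z * (m z * \<phi> z))"
      by (rule continuous_on_eq) (use K' in \<open>auto simp: indicator_def\<close>)
  qed (auto simp: K')
  have k\<psi>: "indicator S z * (?k z * \<psi> z * \<phi> z) = indicator S z * (m z * \<phi> z) 
      - indicator S z * ((dx (\<lambda>z. ?N1 z * \<psi> z) z + dy (\<lambda>z. ?N2 z * \<psi> z) z) * \<phi> z)" for z
  proof (cases "z \<in> S")
    case True
    show ?thesis unfolding div[OF True] by (simp add: algebra_simps)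
  qed simp
  have int_k: "integrable lborel (\<lambda>z. indicator S z * (?k z * \<psi> z * \<phi> z))"
    unfolding k\<psi> by (intro Bochner_Integration.integrable_diff int_m ibp(1))
  have "(LINT z|lborel. indicator S z * (m z * \<phi> z)) 
     = (LINT z|lborel. indicator S z * (?k z * \<psi> z * \<phi> z))
     + (LINT z|lborel. indicator S z * ((dx (\<lambda>z. ?N1 z * \<psi> z) z + dy (\<lambda>z. ?N2 z * \<psi> z) z) * \<phi> z))"
    unfolding k\<psi> using int_m ibp(1) by simp
  also have "\<dots> = (LINT z|lborel. indicator S z * (?k z * \<psi> z * \<phi> z))
     + (LINT z|lborel. - (indicator S z * (?N1 z * \<psi> z * dx \<phi> z + ?N2 z * \<psi> z * dy \<phi> z)))"
    using ibp(3) by simp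
  also have "\<dots> \<le> (LINT z|lborel. indicator S z * \<bar>?k z\<bar> / 2) + (LINT z|lborel. norm (grad \<phi> z) / 2)"
  proof (intro add_mono integral_mono)
    show "integrable lborel (\<lambda>z. indicator S z * \<bar>?k z\<bar> / 2)" "integrable lborel (\<lambda>z. norm (grad \<phi> z) / 2)"
      using k \<phi>(6) by auto
    show "integrable lborel (\<lambda>z. - (indicator S z * (?N1 z * \<psi> z * dx \<phi> z + ?N2 z * \<psi> z * dy \<phi> z)))"
      using ibp(2) by simp
    show "indicator S z * (?k z * \<psi> z * \<phi> z) \<le> indicator S z * \<bar>?k z\<bar> / 2" for z
    proof -
      have "\<bar>?k z * \<psi> z * \<phi> z\<bar> \<le> \<bar>?k z\<bar> * (1 / 2) * 1"
        unfolding abs_mult using \<psi>_le[of z] \<phi>(2,3)[of z] by (intro mult_mono) auto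
      then show ?thesis by (cases "z \<in> S") auto
    qed
    show "- (indicator S z * (?N1 z * \<psi> z * dx \<phi> z + ?N2 z * \<psi> z * dy \<phi> z)) \<le> norm (grad \<phi> z) / 2" for z
    proof (cases "z \<in> S")
      case True
      define t where "t = ?N1 z * dx \<phi> z + ?N2 z * dy \<phi> z"
      have "t\<^sup>2 + (?N1 z * dy \<phi> z - ?N2 z * dx \<phi> z)\<^sup>2 = ((?N1 z)\<^sup>2 + (?N2 z)\<^sup>2) * ((dx \<phi> z)\<^sup>2 + (dy \<phi> z)\<^sup>2)"
        by (simp add: t_def power2_eq_square algebra_simps)
      then have "t\<^sup>2 \<le> (norm (grad \<phi> z))\<^sup>2"
        unfolding norm_grad_squared normal_squared(1)[OF reg[OF True]] by (smt (verit) zero_le_power2)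
      then have "\<bar>t\<bar> \<le> norm (grad \<phi> z)" using abs_le_square_iff[of t "norm (grad \<phi> z)"] by simp
      then have "\<bar>\<psi> z * t\<bar> \<le> 1 / 2 * norm (grad \<phi> z)"
        unfolding abs_mult using \<psi>_le[of z] by (intro mult_mono) auto
      moreover have "?N1 z * \<psi> z * dx \<phi> z + ?N2 z * \<psi> z * dy \<phi> z = \<psi> z * t"
        by (simp add: t_def algebra_simps)
      ultimately show ?thesis using True by auto
    qed simp
  qed (fact int_k)
  also have "\<dots> \<le> ((LINT z|lborel. indicator S z * \<bar>?k z\<bar>) + 2 * pi / (1 - \<beta>) * (R + \<sigma>)) / 2"
    using int_grad by simp
  finally have main: "(LINT z|lborel. indicator S z * (m z * \<phi> z)) 
     \<le> ((LINT z|lborel. indicator S z * \<bar>?k z\<bar>) + 2 * pi / (1 - \<beta>) * (R + \<sigma>)) / 2" .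
  have "(\<integral>\<^sup>+z. indicator K z * ennreal (m z) \<partial>lborel) \<le> (\<integral>\<^sup>+z. ennreal (indicator S z * (m z * \<phi> z)) \<partial>lborel)"
    by (rule nn_integral_mono) (use K(2) \<phi>K in \<open>auto simp: indicator_def\<close>)
  also have "\<dots> = ennreal (LINT z|lborel. indicator S z * (m z * \<phi> z))"
    using m0 \<phi>(2) by (intro nn_integral_eq_integral int_m) auto
  also have "\<dots> \<le> ennreal (((LINT z|lborel. indicator S z * \<bar>?k z\<bar>) + 2 * pi / (1 - \<beta>) * (R + \<sigma>)) / 2)"
    using main by (rule ennreal_leI)
  finally show ?thesis by (simp add: m_def)
qed


section \<open>Each ball centered on the curve carries mass close to its diameter\<close>

lemma nn_integral_complex:
  assumes F: "F \<in> borel_measurable (borel :: complex measure)"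
  shows "(\<integral>\<^sup>+z. F z \<partial>lborel) = (\<integral>\<^sup>+x. \<integral>\<^sup>+y. F (Complex x y) \<partial>lborel \<partial>lborel)"
proof -
  let ?c = "\<lambda>p. Complex (fst p) (snd p)"
  have "continuous_on UNIV ?c" unfolding Complex_eq by (intro continuous_intros)
  then have c: "?c \<in> measurable (lborel \<Otimes>\<^sub>M lborel) borel"
    unfolding lborel_prod by (simp add: borel_measurable_continuous_onI)
  have "lborel = distr (lborel \<Otimes>\<^sub>M lborel) borel ?c"
  proof (rule lborel_eqI)
    fix l u :: complex
    assume lu: "\<And>b. b \<in> Basis \<Longrightarrow> l \<bullet> b \<le> u \<bullet> b"
    have lu': "Re l \<le> Re u" "Im l \<le> Im u" using lu[of 1] lu[of \<i>] by (auto simp: Basis_complex_def inner_complex_def)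
    have box: "box l u = {z. Re l < Re z \<and> Re z < Re u \<and> Im l < Im z \<and> Im z < Im u}"
      by (auto simp: box_def Basis_complex_def inner_complex_def)
    have "emeasure (distr (lborel \<Otimes>\<^sub>M lborel) borel ?c) (box l u)
       = emeasure (lborel \<Otimes>\<^sub>M lborel) ({Re l<..<Re u} \<times> {Im l<..<Im u})"
      using c by (subst emeasure_distr) (auto simp: box space_pair_measure intro!: arg_cong2[where f=emeasure])
    also have "\<dots> = ennreal (Re u - Re l) * ennreal (Im u - Im l)"
      using lu' by (subst lborel.emeasure_pair_measure_Times) auto
    also have "\<dots> = (\<Prod>b\<in>Basis. (u - l) \<bullet> b)"
      using lu' by (simp add: Basis_complex_def inner_complex_def ennreal_mult)
    finally show "emeasure (distr (lborel \<Otimes>\<^sub>M lborel) borel ?c) (box l u) = (\<Prod>b\<in>Basis. (u - l) \<bullet> b)" .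
  qed simp
  then have "(\<integral>\<^sup>+z. F z \<partial>lborel) = (\<integral>\<^sup>+p. F (?c p) \<partial>(lborel \<Otimes>\<^sub>M lborel))"
    using nn_integral_distr[OF c, of F] F by simp
  also have "\<dots> = (\<integral>\<^sup>+x. \<integral>\<^sup>+y. F (Complex x y) \<partial>lborel \<partial>lborel)"
    using measurable_compose[OF c F] by (subst lborel.nn_integral_fst[symmetric]) auto
  finally show ?thesis .
qed

text \<open>Two one-dimensional affine substitutions, one in each order of integration, turn the
  coordinate axes into the directions \<open>\<i> e\<close> and \<open>e\<close>.\<close>

lemma nn_integral_rotated:
  fixes a e :: complex
  assumes F: "F \<in> borel_measurable (borel :: complex measure)" and e: "norm e = 1"
  shows "(\<integral>\<^sup>+z. F z \<partial>lborel) 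
    = (\<integral>\<^sup>+x. \<integral>\<^sup>+y. F (a + of_real x * (\<i> * e) + of_real y * e) \<partial>lborel \<partial>lborel)"
proof -
  define c s where "c = Re e" and "s = Im e"
  have cs: "c\<^sup>2 + s\<^sup>2 = 1" using e cmod_power2[of e] by (simp add: c_def s_def)
  define P where "P x y = Complex (Re a - s * x + c * y) (Im a + c * x + s * y)" for x y
  have P: "a + of_real x * (\<i> * e) + of_real y * e = P x y" for x y
    by (simp add: complex_eq_iff P_def c_def s_def algebra_simps)
  have meas2: "(\<lambda>p. F (g p)) \<in> borel_measurable (lborel \<Otimes>\<^sub>M lborel)" 
    if "continuous_on UNIV g" for g :: "real \<times> real \<Rightarrow> complex"
    unfolding lborel_prod using measurable_compose[OF borel_measurable_continuous_onI[OF that] F] by simp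
  have meas1: "(\<lambda>p. F (g p)) \<in> borel_measurable borel" 
    if "continuous_on UNIV g" for g :: "real \<Rightarrow> complex"
    using measurable_compose[OF borel_measurable_continuous_onI[OF that] F] by simp
  show ?thesis
  proof (cases "c = 0")
    case True
    then have s: "s\<^sup>2 = 1" using cs by simp
    then have s0: "s \<noteq> 0" "\<bar>s\<bar> = 1" by (auto simp: power2_eq_1_iff)
    have m: "(\<lambda>x. \<integral>\<^sup>+y. F (Complex x y) \<partial>lborel) \<in> borel_measurable borel"
    proof -
      have "continuous_on UNIV (\<lambda>p. Complex (fst p) (snd p))"
        unfolding Complex_eq by (intro continuous_intros)
      from lborel.borel_measurable_nn_integral_fst[OF meas2[OF this]] show ?thesis by simp
    qed
    have "(\<integral>\<^sup>+z. F z \<partial>lborel) = (\<integral>\<^sup>+x. \<integral>\<^sup>+y. F (Complex x y) \<partial>lborel \<partial>lborel)"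
      by (rule nn_integral_complex[OF F])
    also have "\<dots> = (\<integral>\<^sup>+x. \<integral>\<^sup>+y. F (Complex (Re a + (- s) * x) y) \<partial>lborel \<partial>lborel)"
      using s0 by (subst nn_integral_real_affine[OF m, of "- s" "Re a"]) auto
    also have "\<dots> = (\<integral>\<^sup>+x. \<integral>\<^sup>+y. F (P x y) \<partial>lborel \<partial>lborel)"
    proof (rule nn_integral_cong)
      fix x
      have "continuous_on UNIV (\<lambda>y. Complex (Re a + (- s) * x) y)"
        unfolding Complex_eq by (intro continuous_intros)
      from nn_integral_real_affine[OF meas1[OF this] s0(1), of "Im a"] 
      show "(\<integral>\<^sup>+y. F (Complex (Re a + (- s) * x) y) \<partial>lborel) = (\<integral>\<^sup>+y. F (P x y) \<partial>lborel)"
        using s0(2) True by (simp add: P_def)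
    qed
    finally show ?thesis by (simp only: P)
  next
    case False
    define Q where "Q p = Complex (snd p) (Im a + s * (snd p - Re a) / c + fst p / c)" for p
    have Qc: "continuous_on UNIV Q" "continuous_on UNIV (\<lambda>p. Q (x, p))" for x
      unfolding Q_def Complex_eq divide_inverse by (intro continuous_intros)+
    have m: "(\<lambda>x. \<integral>\<^sup>+Y. F (Q (x, Y)) \<partial>lborel) \<in> borel_measurable lborel"
      by (rule lborel.borel_measurable_nn_integral_fst[OF meas2[OF Qc(1)]])
    have m': "(\<lambda>Y. \<integral>\<^sup>+x. F (Q (x, Y)) \<partial>lborel) \<in> borel_measurable lborel"
    proof -
      have "continuous_on UNIV (\<lambda>p. Q (snd p, fst p))"
        unfolding Q_def Complex_eq divide_inverse fst_conv snd_conv by (intro continuous_intros)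
      from lborel.borel_measurable_nn_integral_fst[OF meas2[OF this]] show ?thesis by simp
    qed
    have "(\<integral>\<^sup>+z. F z \<partial>lborel) = (\<integral>\<^sup>+Y. \<integral>\<^sup>+X. F (Complex Y X) \<partial>lborel \<partial>lborel)"
      by (rule nn_integral_complex[OF F])
    also have "\<dots> = (\<integral>\<^sup>+Y. ennreal \<bar>1 / c\<bar> * \<integral>\<^sup>+x. F (Q (x, Y)) \<partial>lborel \<partial>lborel)"
    proof (rule nn_integral_cong)
      fix Y
      have "continuous_on UNIV (\<lambda>X. Complex Y X)" unfolding Complex_eq by (intro continuous_intros)
      from nn_integral_real_affine[OF meas1[OF this], of "1 / c" "Im a + s * (Y - Re a) / c"] False
      show "(\<integral>\<^sup>+X. F (Complex Y X) \<partial>lborel) = ennreal \<bar>1 / c\<bar> * \<integral>\<^sup>+x. F (Q (x, Y)) \<partial>lborel"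
        by (simp add: Q_def)
    qed
    also have "\<dots> = ennreal \<bar>1 / c\<bar> * (\<integral>\<^sup>+Y. \<integral>\<^sup>+x. F (Q (x, Y)) \<partial>lborel \<partial>lborel)"
      by (rule nn_integral_cmult[OF m'])
    also have "(\<integral>\<^sup>+Y. \<integral>\<^sup>+x. F (Q (x, Y)) \<partial>lborel \<partial>lborel) = (\<integral>\<^sup>+x. \<integral>\<^sup>+Y. F (Q (x, Y)) \<partial>lborel \<partial>lborel)"
      by (rule lborel_pair.Fubini[OF meas2[OF Qc(1)]])
    also have "\<dots> = (\<integral>\<^sup>+x. ennreal \<bar>c\<bar> * \<integral>\<^sup>+y. F (P x y) \<partial>lborel \<partial>lborel)"
    proof (rule nn_integral_cong)
      fix x
      have "Q (x, Re a - s * x + c * y) = P x y" for y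
      proof -
        have "x * s\<^sup>2 + x * c\<^sup>2 = x" using cs by (metis add.commute distrib_left mult.right_neutral)
        then show ?thesis
          using False by (simp add: Q_def P_def complex_eq_iff field_simps power2_eq_square)
      qed
      then show "(\<integral>\<^sup>+Y. F (Q (x, Y)) \<partial>lborel) = ennreal \<bar>c\<bar> * \<integral>\<^sup>+y. F (P x y) \<partial>lborel"
        using nn_integral_real_affine[OF meas1[OF Qc(2)], of c x "Re a - s * x"] False by simp
    qed
    also have "\<dots> = ennreal \<bar>c\<bar> * (\<integral>\<^sup>+x. \<integral>\<^sup>+y. F (P x y) \<partial>lborel \<partial>lborel)"
    proof (rule nn_integral_cmult)
      have "continuous_on UNIV (\<lambda>p. P (fst p) (snd p))"
        unfolding P_def Complex_eq by (intro continuous_intros)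
      from lborel.borel_measurable_nn_integral_fst[OF meas2[OF this]]
      show "(\<lambda>x. \<integral>\<^sup>+y. F (P x y) \<partial>lborel) \<in> borel_measurable lborel" by simp
    qed
    also have "ennreal \<bar>1 / c\<bar> * \<dots> = (\<integral>\<^sup>+x. \<integral>\<^sup>+y. F (P x y) \<partial>lborel \<partial>lborel)"
      using False by (simp add: mult.assoc[symmetric] ennreal_mult[symmetric] abs_mult[symmetric])
    finally show ?thesis by (simp only: P)
  qed
qed

text \<open>In coordinates along \<open>\<nabla>v a\<close> and perpendicular to it, the value of \<open>v\<close> hardly changes in the
  second direction, so that on each segment in the first direction, over a range of perpendicular
  coordinates of length almost \<open>2 r\<close>, it crosses the whole band. By the fundamental theorem of
  calculus each such segment contributes at least \<open>1\<close>.\<close>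

lemma band_mass_ge:
  fixes v :: "complex \<Rightarrow> real"
  assumes S: "open S" "Ck_on (Suc 0) S v" and a: "cball a r \<subseteq> S" "v a = c" "grad v a \<noteq> 0"
    and \<eta>: "0 < \<eta>" "\<eta> < 1" and r: "r > 0"
    and osc: "\<And>z. z \<in> cball a r \<Longrightarrow> norm (grad v z - grad v a) \<le> \<eta> * norm (grad v a)"
    and \<beta>: "0 < \<beta>" "\<beta> < 1" 
    and \<epsilon>: "0 < \<epsilon>" "\<epsilon> \<le> \<eta> * norm (grad v a) * (r * (1 - \<eta>) / (1 + \<eta>))"
  shows "ennreal (2 * (r * (1 - \<eta>) / (1 + \<eta>))) \<le> (\<integral>\<^sup>+z. indicator (cball a r) z * ennreal (band_density v c \<beta> \<epsilon> z) \<partial>lborel)"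
proof -
  define g where "g = norm (grad v a)"
  have g: "g > 0" using a by (simp add: g_def)
  \<comment> \<open>The box of half sides \<open>\<tau>\<close> and \<open>\<kappa> \<tau>\<close> lies in the ball because \<open>\<tau> + \<kappa> \<tau> = r\<close>. In the direction
    of \<open>\<nabla>v a\<close>, \<open>v\<close> changes by at least \<open>g (1 - \<eta>) \<kappa> \<tau> = 2 \<eta> g \<tau>\<close> from the middle of the box to
    either side, twice what it can change from \<open>a\<close> along the perpendicular axis.\<close>
  define \<tau> where "\<tau> = r * (1 - \<eta>) / (1 + \<eta>)"
  define \<kappa> where "\<kappa> = 2 * \<eta> / (1 - \<eta>)"
  have \<tau>: "\<tau> > 0" "\<kappa> > 0" "\<tau> + \<kappa> * \<tau> = r" "\<kappa> * (1 - \<eta>) = 2 * \<eta>"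
  proof -
    have "1 + \<kappa> = (1 + \<eta>) / (1 - \<eta>)" using \<eta> by (simp add: \<kappa>_def field_simps)
    then have "\<tau> * (1 + \<kappa>) = r" using \<eta> by (simp add: \<tau>_def)
    then show "\<tau> + \<kappa> * \<tau> = r" by (simp add: algebra_simps)
  qed (use r \<eta> in \<open>auto simp: \<tau>_def \<kappa>_def\<close>)
  define e where "e = Complex (dx v a / g) (dy v a / g)"
  have g2: "g\<^sup>2 = (dx v a)\<^sup>2 + (dy v a)\<^sup>2" by (simp add: g_def norm_grad_squared)
  have e: "norm e = 1"
  proof -
    have "(norm e)\<^sup>2 = ((dx v a)\<^sup>2 + (dy v a)\<^sup>2) / g\<^sup>2" 
      by (simp add: e_def cmod_power2 power_divide add_divide_distrib)
    also have "\<dots> = 1\<^sup>2" unfolding g2[symmetric] using g by simp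
    finally show ?thesis by (subst (asm) power2_eq_iff_nonneg) auto
  qed
  define P where "P x y = a + of_real x * (\<i> * e) + of_real y * e" for x y
  have P_in: "P x y \<in> cball a r" if "\<bar>x\<bar> \<le> \<tau>" "\<bar>y\<bar> \<le> \<kappa> * \<tau>" for x y
  proof -
    have "norm (of_real x * (\<i> * e) + of_real y * e) \<le> \<bar>x\<bar> + \<bar>y\<bar>"
      using norm_triangle_ineq[of "of_real x * (\<i> * e)" "of_real y * e"] e by (simp add: norm_mult)
    also have "\<dots> \<le> r" using that \<tau> by linarith
    finally have "norm (- (of_real x * (\<i> * e) + of_real y * e)) \<le> r" by (simp only: norm_minus_cancel)
    then show ?thesis by (simp add: P_def dist_norm add.assoc)
  qed
  define De where "De z = Re e * dx v z + Im e * dy v z" for z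
  define Dt where "Dt z = Re (\<i> * e) * dx v z + Im (\<i> * e) * dy v z" for z
  have diff: "v differentiable (at z)" if "z \<in> cball a r" for z
    using S(2) a(1) that by auto
  have De_le: "De z \<le> norm (grad v z)" and De_ge: "z \<in> cball a r \<Longrightarrow> g * (1 - \<eta>) \<le> De z" 
    and Dt_le: "z \<in> cball a r \<Longrightarrow> \<bar>Dt z\<bar> \<le> \<eta> * g" for z
  proof -
    define n :: "real^2" where "n = vector [Re e, Im e]"
    define t :: "real^2" where "t = vector [- Im e, Re e]"
    have nt: "norm n = 1" "norm t = 1"
      using e by (simp_all add: n_def t_def norm_eq_sqrt_inner inner_vec_def sum_2 inner_complex_def add.commute)
    have De_eq: "De z = n \<bullet> grad v z" and Dt_eq: "Dt z = t \<bullet> grad v z" for z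
      by (simp_all add: De_def Dt_def n_def t_def inner_vec_def sum_2 grad_def)
    show "De z \<le> norm (grad v z)"
      unfolding De_eq using norm_cauchy_schwarz[of n "grad v z"] nt by simp
    have a_eq: "De a = g" "Dt a = 0"
    proof -
      have "De a = g\<^sup>2 / g" unfolding g2 by (simp add: De_def e_def power2_eq_square add_divide_distrib)
      also have "\<dots> = g" using g by (simp add: power2_eq_square)
      finally show "De a = g" .
      show "Dt a = 0" by (simp add: Dt_def e_def)
    qed
    assume z: "z \<in> cball a r"
    have "\<bar>n \<bullet> (grad v z - grad v a)\<bar> \<le> \<eta> * g" "\<bar>t \<bullet> (grad v z - grad v a)\<bar> \<le> \<eta> * g"
      using Cauchy_Schwarz_ineq2[of n "grad v z - grad v a"] Cauchy_Schwarz_ineq2[of t "grad v z - grad v a"] 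
        nt osc[OF z] by (simp_all add: g_def)
    then have "\<bar>De z - De a\<bar> \<le> \<eta> * g" "\<bar>Dt z - Dt a\<bar> \<le> \<eta> * g"
      by (simp_all add: De_eq Dt_eq inner_diff_right)
    then show "g * (1 - \<eta>) \<le> De z" "\<bar>Dt z\<bar> \<le> \<eta> * g"
      using a_eq by (simp_all add: algebra_simps)
  qed
  have deriv_y: "((\<lambda>y. v (P x y)) has_real_derivative De (P x y)) (at y)" if "\<bar>x\<bar> \<le> \<tau>" "\<bar>y\<bar> \<le> \<kappa> * \<tau>" for x y
    unfolding P_def De_def using diff[OF P_in[OF that]] by (intro DERIV_along_line) (simp add: P_def)
  have tangential: "\<bar>v (P x 0) - c\<bar> \<le> \<eta> * g * \<tau>" if x: "\<bar>x\<bar> \<le> \<tau>" for x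
  proof -
    have "norm (v (a + of_real x * (\<i> * e)) - v (a + of_real 0 * (\<i> * e))) \<le> \<eta> * g * norm (x - 0)"
    proof (rule field_differentiable_bound[of "{-\<tau>..\<tau>}"])
      fix x assume "x \<in> {-\<tau>..\<tau>}"
      then have x: "a + of_real x * (\<i> * e) \<in> cball a r" 
        using P_in[of x 0] \<tau> by (simp add: P_def abs_le_iff)
      show "((\<lambda>x. v (a + of_real x * (\<i> * e))) has_real_derivative Dt (a + of_real x * (\<i> * e))) (at x within {-\<tau>..\<tau>})"
        unfolding Dt_def by (rule has_field_derivative_at_within[OF DERIV_along_line[OF diff[OF x]]])
      show "norm (Dt (a + of_real x * (\<i> * e))) \<le> \<eta> * g"
        using Dt_le[OF x] by simp
    qed (use that \<tau> in \<open>auto simp: abs_le_iff\<close>)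
    also have "\<dots> \<le> \<eta> * g * \<tau>" using x \<eta> g by (intro mult_left_mono) auto
    finally show ?thesis by (simp add: P_def a(2))
  qed
  have rise: "g * (1 - \<eta>) * (y' - y) \<le> v (P x y') - v (P x y)" 
    if xy: "\<bar>x\<bar> \<le> \<tau>" "- (\<kappa> * \<tau>) \<le> y" "y < y'" "y' \<le> \<kappa> * \<tau>" for x y y'
  proof -
    obtain w where w: "y < w" "w < y'" "v (P x y') - v (P x y) = (y' - y) * De (P x w)"
      using MVT2[OF xy(3), of "\<lambda>y. v (P x y)" "\<lambda>y. De (P x y)"] deriv_y[OF xy(1)] xy by (auto simp: abs_le_iff)
    then have "g * (1 - \<eta>) \<le> De (P x w)"
      using that by (intro De_ge P_in) auto
    then have "(y' - y) * (g * (1 - \<eta>)) \<le> (y' - y) * De (P x w)"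
      using that by (intro mult_left_mono) auto
    then show ?thesis using w(3) by (simp add: mult.commute)
  qed
  have drop: "g * (1 - \<eta>) * (\<kappa> * \<tau>) = 2 * (\<eta> * g * \<tau>)"
  proof -
    have "g * (1 - \<eta>) * (\<kappa> * \<tau>) = g * \<tau> * (\<kappa> * (1 - \<eta>))" by (simp add: algebra_simps)
    then show ?thesis using \<tau>(4) by simp
  qed
  have \<epsilon>': "\<epsilon> \<le> \<eta> * g * \<tau>" using \<epsilon> by (simp add: g_def \<tau>_def)
  have top: "v (P x (\<kappa> * \<tau>)) - c \<ge> \<epsilon>" and bottom: "v (P x (- (\<kappa> * \<tau>))) - c \<le> - \<epsilon>" if x: "\<bar>x\<bar> \<le> \<tau>" for x
  proof -
    have "\<kappa> * \<tau> > 0" using \<tau> by simp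
    with rise[OF x, of 0 "\<kappa> * \<tau>"] rise[OF x, of "- (\<kappa> * \<tau>)" 0] tangential[OF x] drop \<epsilon>'
    show "v (P x (\<kappa> * \<tau>)) - c \<ge> \<epsilon>" "v (P x (- (\<kappa> * \<tau>))) - c \<le> - \<epsilon>" 
      by (simp_all add: abs_le_iff)
  qed
  have band_cont: "continuous_on (cball a r) (band_density v c \<beta> \<epsilon>)"
    using continuous_on_band_density[OF S(2)] a(1) by (rule continuous_on_subset)
  have De_cont: "continuous_on (cball a r) (\<lambda>z. step' \<beta> ((v z - c) / (2 * \<epsilon>) + 1 / 2) * (De z / (2 * \<epsilon>)))"
  proof -
    have C: "continuous_on (cball a r) (dx v)" "continuous_on (cball a r) (dy v)" "continuous_on (cball a r) v"
      using S Ck_on_imp_continuous_on[OF S(2)] a(1) by (auto intro: continuous_on_subset)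
    have "continuous_on (cball a r) (\<lambda>z. (v z - c) / (2 * \<epsilon>) + 1 / 2)"
      unfolding divide_inverse by (intro continuous_intros C)
    from continuous_on_compose2[OF continuous_on_step'[of UNIV] this]
    have s: "continuous_on (cball a r) (\<lambda>z. step' \<beta> ((v z - c) / (2 * \<epsilon>) + 1 / 2))" by simp
    have D: "continuous_on (cball a r) De"
      unfolding De_def by (intro continuous_intros C)
    show ?thesis
      using continuous_on_mult[OF s continuous_on_mult[OF D continuous_on_const[of _ "1 / (2 * \<epsilon>)"]]] by simp
  qed
  have band_nonneg: "band_density v c \<beta> \<epsilon> z \<ge> 0" for z
    using step'_bounds(1)[OF \<beta>] \<epsilon>(1) by (simp add: band_density_def)
  define F where "F z = ennreal (indicator (cball a r) z * band_density v c \<beta> \<epsilon> z)" for z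
  have F: "F \<in> borel_measurable borel"
    unfolding F_def using borel_measurable_continuous_on_indicator[OF _ band_cont] by simp
  have slice: "1 \<le> (\<integral>\<^sup>+y. F (P x y) \<partial>lborel)" if x: "\<bar>x\<bar> \<le> \<tau>" for x
  proof -
    let ?I = "{- (\<kappa> * \<tau>)..\<kappa> * \<tau>}"
    define h where "h y = step \<beta> ((v (P x y) - c) / (2 * \<epsilon>) + 1 / 2)" for y
    define h' where "h' y = step' \<beta> ((v (P x y) - c) / (2 * \<epsilon>) + 1 / 2) * (De (P x y) / (2 * \<epsilon>))" for y
    have "continuous_on ?I (P x)" unfolding P_def by (intro continuous_intros)
    then have "continuous_on ?I h'"
      unfolding h'_def using P_in[OF x] by (intro continuous_on_compose2[OF De_cont]) (auto simp: abs_le_iff)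
    then have m: "(\<lambda>y. indicator ?I y *\<^sub>R h' y) \<in> borel_measurable borel"
      by (intro borel_measurable_continuous_on_indicator) auto
    have h'_le: "h' y \<le> band_density v c \<beta> \<epsilon> (P x y)" for y
    proof -
      have "h' y \<le> step' \<beta> ((v (P x y) - c) / (2 * \<epsilon>) + 1 / 2) * (norm (grad v (P x y)) / (2 * \<epsilon>))"
        unfolding h'_def using De_le step'_bounds(1)[OF \<beta>] \<epsilon>(1) by (intro mult_left_mono divide_right_mono) auto
      then show ?thesis by (simp add: band_density_def)
    qed
    have "(\<integral>\<^sup>+y. ennreal (indicator ?I y *\<^sub>R h' y) * indicator ?I y \<partial>lborel) = ennreal (h (\<kappa> * \<tau>) - h (- (\<kappa> * \<tau>)))"
    proof (rule nn_integral_FTC_Icc[OF m])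
      fix y assume "y \<in> ?I"
      then have y: "\<bar>y\<bar> \<le> \<kappa> * \<tau>" "y \<in> ?I" by auto
      have "(h has_real_derivative h' y) (at y)"
        unfolding h_def h'_def
        by (rule DERIV_chain2[OF DERIV_step[OF \<beta>]]) (use \<epsilon>(1) in \<open>auto intro!: derivative_eq_intros deriv_y[OF x y(1)]\<close>)
      then show "(h has_real_derivative indicator ?I y *\<^sub>R h' y) (at y)"
        using y(2) by simp
      have "0 \<le> g * (1 - \<eta>)" using g \<eta> by simp
      also have "\<dots> \<le> De (P x y)" using De_ge P_in[OF x y(1)] .
      finally show "0 \<le> indicator ?I y *\<^sub>R h' y"
        using step'_bounds(1)[OF \<beta>] \<epsilon>(1) by (simp add: h'_def)
    qed (use \<tau> in \<open>simp add: add_increasing\<close>)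
    moreover have "h (\<kappa> * \<tau>) = 1"
      unfolding h_def using top[OF x] \<epsilon>(1) by (intro step_eq[OF \<beta>]) (simp add: field_simps)
    moreover have "h (- (\<kappa> * \<tau>)) = 0"
      unfolding h_def using bottom[OF x] \<epsilon>(1) by (intro step_eq[OF \<beta>]) (simp add: field_simps)
    ultimately have "1 = (\<integral>\<^sup>+y. ennreal (indicator ?I y *\<^sub>R h' y) * indicator ?I y \<partial>lborel)" by simp
    also have "\<dots> \<le> (\<integral>\<^sup>+y. F (P x y) \<partial>lborel)"
    proof (rule nn_integral_mono)
      fix y
      show "ennreal (indicator ?I y *\<^sub>R h' y) * indicator ?I y \<le> F (P x y)"
      proof (cases "y \<in> ?I")
        case True
        then have "P x y \<in> cball a r" using x by (intro P_in) auto
        then show ?thesis using True h'_le[of y] by (simp add: F_def ennreal_leI)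
      qed simp
    qed
    finally show ?thesis .
  qed
  have "ennreal (2 * \<tau>) = (\<integral>\<^sup>+x. indicator {-\<tau>..\<tau>} x \<partial>lborel)"
    using \<tau> by simp
  also have "\<dots> \<le> (\<integral>\<^sup>+x. \<integral>\<^sup>+y. F (P x y) \<partial>lborel \<partial>lborel)"
    by (rule nn_integral_mono) (use slice in \<open>auto simp: indicator_def\<close>)
  also have "\<dots> = (\<integral>\<^sup>+z. F z \<partial>lborel)"
    unfolding P_def by (rule nn_integral_rotated[OF F e, symmetric])
  also have "\<dots> = (\<integral>\<^sup>+z. indicator (cball a r) z * ennreal (band_density v c \<beta> \<epsilon> z) \<partial>lborel)"
    by (rule nn_integral_cong) (auto simp: F_def indicator_def)
  finally show ?thesis by (simp add: \<tau>_def)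
qed


section \<open>Covering the level curve\<close>

text \<open>A cover by countably many balls, whose center-radius pairs form an unordered set, is as good as a
  sequence of sets, and the sum of the diameters need only be bounded over finite subfamilies.\<close>

lemma hausdorff1_le_balls:
  fixes A :: "'a::euclidean_space set"
  assumes M: "M \<ge> 0" and cover: "\<And>\<delta>. \<delta> > 0 \<Longrightarrow> \<exists>I. countable I \<and> A \<subseteq> (\<Union>(b, \<rho>)\<in>I. cball b \<rho>) \<and> 
     (\<forall>(b, \<rho>)\<in>I. 0 \<le> \<rho> \<and> 2 * \<rho> \<le> \<delta>) \<and> (\<forall>F. finite F \<longrightarrow> F \<subseteq> I \<longrightarrow> (\<Sum>(b, \<rho>)\<in>F. 2 * \<rho>) \<le> M)"
  shows "hausdorff1 A \<le> ennreal M"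
  unfolding hausdorff1_def
proof (rule SUP_least)
  fix \<delta> :: real assume "\<delta> \<in> {0<..}"
  then have "\<delta> > 0" by simp
  from cover[OF this] obtain I where I0: "countable I" "A \<subseteq> (\<Union>(b, \<rho>)\<in>I. cball b \<rho>)" 
    "\<forall>(b, \<rho>)\<in>I. 0 \<le> \<rho> \<and> 2 * \<rho> \<le> \<delta>" "\<forall>F. finite F \<longrightarrow> F \<subseteq> I \<longrightarrow> (\<Sum>(b, \<rho>)\<in>F. 2 * \<rho>) \<le> M"
    by (elim exE conjE)
  have I: "0 \<le> \<rho> \<and> 2 * \<rho> \<le> \<delta>" if "(b, \<rho>) \<in> I" for b \<rho>
    using I0(3) that by auto
  define idx where "idx = to_nat_on I"
  have inj: "inj_on idx I" unfolding idx_def using I0(1) by (rule inj_on_to_nat_on)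
  define U where "U n = (\<Union>(b, \<rho>)\<in>{p\<in>I. idx p = n}. cball b \<rho>)" for n
  have U_idx: "U (idx (b, \<rho>)) = cball b \<rho>" if "(b, \<rho>) \<in> I" for b \<rho>
  proof -
    have "{p\<in>I. idx p = idx (b, \<rho>)} = {(b, \<rho>)}" using inj that by (auto dest: inj_onD)
    then show ?thesis by (simp add: U_def)
  qed
  have U_empty: "U n = {}" if "n \<notin> idx ` I" for n using that by (auto simp: U_def)
  have diam: "diameter (cball b \<rho>) \<le> 2 * \<rho>" if "(b, \<rho>) \<in> I" for b :: 'a and \<rho>
    using I[OF that] by simp
  have U_bound: "bounded (U n) \<and> diameter (U n) \<le> \<delta>" for n
  proof (cases "n \<in> idx ` I")
    case True
    then obtain b \<rho> where b: "(b, \<rho>) \<in> I" "n = idx (b, \<rho>)" by auto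
    then show ?thesis using U_idx[OF b(1)] diam[OF b(1)] I[OF b(1)] by simp
  next
    case False
    then show ?thesis using U_empty \<open>\<delta> > 0\<close> by simp
  qed
  have "A \<subseteq> (\<Union>n. U n)"
  proof
    fix x assume "x \<in> A"
    then obtain b \<rho> where b: "(b, \<rho>) \<in> I" "x \<in> cball b \<rho>" using I0(2) by blast
    then show "x \<in> (\<Union>n. U n)" using U_idx[OF b(1)] by blast
  qed
  with U_bound have U: "U \<in> {U. A \<subseteq> (\<Union>n. U n) \<and> (\<forall>n. bounded (U n) \<and> diameter (U n) \<le> \<delta>)}" by simp
  have "(\<Sum>n. ennreal (diameter (U n))) \<le> ennreal M"
  proof (rule suminf_le_const)
    fix n
    define F where "F = {p\<in>I. idx p < n}"
    have F: "finite F" "F \<subseteq> I"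
    proof -
      have "finite (idx ` F)" by (rule finite_subset[of _ "{..<n}"]) (auto simp: F_def)
      moreover have "inj_on idx F" using inj by (rule inj_on_subset) (auto simp: F_def)
      ultimately show "finite F" by (rule finite_imageD)
    qed (auto simp: F_def)
    have "(\<Sum>k<n. ennreal (diameter (U k))) = (\<Sum>k\<in>idx ` F. ennreal (diameter (U k)))"
    proof (rule sum.mono_neutral_right)
      show "\<forall>k\<in>{..<n} - idx ` F. ennreal (diameter (U k)) = 0"
      proof
        fix k assume "k \<in> {..<n} - idx ` F"
        then have "k \<notin> idx ` I" by (auto simp: F_def)
        then show "ennreal (diameter (U k)) = 0" by (simp add: U_empty)
      qed
    qed (auto simp: F_def)
    also have "\<dots> = (\<Sum>p\<in>F. ennreal (diameter (U (idx p))))"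
      using inj_on_subset[OF inj F(2)] by (simp add: sum.reindex)
    also have "\<dots> \<le> (\<Sum>p\<in>F. ennreal (2 * snd p))"
    proof (rule sum_mono)
      fix p assume "p \<in> F"
      then have p: "(fst p, snd p) \<in> I" using F by auto
      show "ennreal (diameter (U (idx p))) \<le> ennreal (2 * snd p)"
        using U_idx[OF p] diam[OF p] by (simp add: ennreal_leI)
    qed
    also have "\<dots> = ennreal (\<Sum>p\<in>F. 2 * snd p)"
    proof (rule sum_ennreal)
      fix p assume "p \<in> F"
      then have "(fst p, snd p) \<in> I" using F by auto
      then show "0 \<le> 2 * snd p" using I by fastforce
    qed
    also have "\<dots> \<le> ennreal M"
      using I0(4) F by (intro ennreal_leI) (simp add: case_prod_beta)
    finally show "(\<Sum>k<n. ennreal (diameter (U k))) \<le> ennreal M" .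
  qed simp
  then show "(INF U\<in>{U. A \<subseteq> (\<Union>n. U n) \<and> (\<forall>n. bounded (U n) \<and> diameter (U n) \<le> \<delta>)}. 
     \<Sum>n. ennreal (diameter (U n))) \<le> ennreal M"
    by (rule INF_lower2[OF U])
qed

lemma maximal_disjoint_balls:
  fixes r :: "'a::metric_space \<Rightarrow> real"
  shows "\<exists>D. D \<subseteq> A \<and> pairwise (\<lambda>a b. cball a (r a) \<inter> cball b (r b) = {}) D \<and>
    (\<forall>a\<in>A. a \<in> D \<or> (\<exists>b\<in>D. cball a (r a) \<inter> cball b (r b) \<noteq> {}))"
proof -
  let ?R = "\<lambda>a b. cball a (r a) \<inter> cball b (r b) = {}"
  let ?\<A> = "{D. D \<subseteq> A \<and> pairwise ?R D}"
  have "\<exists>D\<in>?\<A>. \<forall>X\<in>?\<A>. D \<subseteq> X \<longrightarrow> X = D"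
  proof (rule subset_Zorn_nonempty)
    have "{} \<in> ?\<A>" by simp
    then show "?\<A> \<noteq> {}" by blast
    fix \<C> assume "subset.chain ?\<A> \<C>"
    then have C: "\<C> \<subseteq> ?\<A>" "chain\<^sub>\<subseteq> \<C>" by (auto simp: subset_chain_def chain_subset_def)
    have "pairwise ?R (\<Union>\<C>)" using C by (intro pairwise_chain_Union) auto
    then show "\<Union>\<C> \<in> ?\<A>" using C by auto
  qed
  then obtain D where D0: "D \<in> ?\<A>" and max0: "\<forall>X\<in>?\<A>. D \<subseteq> X \<longrightarrow> X = D" ..
  have D: "D \<subseteq> A" "pairwise ?R D" using D0 by auto
  have max: "X = D" if "X \<subseteq> A" "pairwise ?R X" "D \<subseteq> X" for X
    using max0[rule_format, of X] that by simp
  show ?thesis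
  proof (intro exI[of _ D] conjI D ballI, rule ccontr)
    fix a assume a: "a \<in> A" "\<not> (a \<in> D \<or> (\<exists>b\<in>D. cball a (r a) \<inter> cball b (r b) \<noteq> {}))"
    then have "pairwise ?R (insert a D)" using D(2) by (auto simp: pairwise_insert)
    then have "insert a D = D" using a D(1) by (intro max) auto
    then show False using a by blast
  qed
qed

lemma continuous_on_grad:
  assumes "continuous_on S (dx v)" "continuous_on S (dy v)"
  shows "continuous_on S (grad v)"
proof -
  have "grad v z = dx v z *\<^sub>R axis 1 1 + dy v z *\<^sub>R axis 2 1" for z
    by (simp add: vec_eq_iff forall_2 grad_def axis_def)
  then have "grad v = (\<lambda>z. dx v z *\<^sub>R axis 1 1 + dy v z *\<^sub>R axis 2 1)" by (rule ext)
  then show ?thesis using assms by (simp add: continuous_intros)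
qed

text \<open>The radius at a point is \<open>\<eta>\<close> times the supremum \<open>s\<close> of the radii on which the gradient oscillates
  little relative to its size. As \<open>s\<close> is \<open>1\<close>-Lipschitz, the radii of two balls that meet differ
  little, and so the balls of radius \<open>2 r / (1 - \<eta>)\<close> around a maximal disjoint family cover the curve.
  The disjoint balls themselves have radii whose sum is controlled by the total mass of the band.\<close>

lemma level_set_cover:
  fixes v :: "complex \<Rightarrow> real"
  assumes S: "open S" and v: "Ck_on (Suc 0) S v" and reg: "\<And>z. z \<in> S \<Longrightarrow> grad v z \<noteq> 0"
    and \<beta>: "0 < \<beta>" "\<beta> < 1" and M: "M \<ge> 0"
    and mass: "\<And>K \<epsilon>. compact K \<Longrightarrow> K \<subseteq> S \<Longrightarrow> \<epsilon> > 0 \<Longrightarrow> 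
      (\<integral>\<^sup>+z. indicator K z * ennreal (band_density v c \<beta> \<epsilon> z) \<partial>lborel) \<le> ennreal M"
    and \<eta>: "0 < \<eta>" "\<eta> < 1" and \<delta>: "\<delta> > 0"
  shows "\<exists>I. countable I \<and> {z\<in>S. v z = c} \<subseteq> (\<Union>(b, \<rho>)\<in>I. cball b \<rho>) \<and> 
     (\<forall>(b, \<rho>)\<in>I. 0 \<le> \<rho> \<and> 2 * \<rho> \<le> \<delta>) \<and> 
     (\<forall>F. finite F \<longrightarrow> F \<subseteq> I \<longrightarrow> (\<Sum>(b, \<rho>)\<in>F. 2 * \<rho>) \<le> 2 * (1 + \<eta>) / (1 - \<eta>)\<^sup>2 * M)"
proof -
  define A where "A = {z\<in>S. v z = c}"
  define d where "d = \<delta> * (1 - \<eta>) / 4"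
  have d: "d > 0" using \<delta> \<eta> by (simp add: d_def)
  define Good where "Good a = {\<rho>. 0 < \<rho> \<and> \<rho> \<le> d \<and> ball a \<rho> \<subseteq> S \<and> 
     (\<forall>x\<in>ball a \<rho>. \<forall>y\<in>ball a \<rho>. norm (grad v x - grad v y) \<le> \<eta> * norm (grad v y))}" for a
  define s where "s a = Sup (Good a)" for a
  have bdd: "bdd_above (Good a)" for a by (rule bdd_aboveI[of _ d]) (simp add: Good_def)
  have nonempty: "Good a \<noteq> {}" if a: "a \<in> S" for a
  proof -
    define e where "e = \<eta> / 4 * norm (grad v a)"
    have e: "e > 0" using \<eta> reg[OF a] by (simp add: e_def)
    have "continuous_on S (grad v)" using v by (intro continuous_on_grad) auto
    then obtain r1 where r1: "r1 > 0" "\<And>z. z \<in> S \<Longrightarrow> dist z a < r1 \<Longrightarrow> dist (grad v z) (grad v a) < e"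
      using a e unfolding continuous_on_iff by blast
    obtain r2 where r2: "r2 > 0" "ball a r2 \<subseteq> S" using S a openE by blast
    define \<rho> where "\<rho> = min d (min r1 r2)"
    have \<rho>: "0 < \<rho>" "\<rho> \<le> d" "ball a \<rho> \<subseteq> S" using d r1(1) r2 by (auto simp: \<rho>_def)
    have near: "norm (grad v z - grad v a) < e" if "z \<in> ball a \<rho>" for z
    proof -
      have "z \<in> S" "dist z a < r1" using that \<rho>(3) by (auto simp: \<rho>_def dist_commute)
      then show ?thesis using r1(2)[of z] by (simp add: dist_norm)
    qed
    have "norm (grad v x - grad v y) \<le> \<eta> * norm (grad v y)" if "x \<in> ball a \<rho>" "y \<in> ball a \<rho>" for x y
    proof -
      have "norm (grad v x - grad v y) \<le> norm (grad v x - grad v a) + norm (grad v y - grad v a)"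
        using norm_triangle_ineq4[of "grad v x - grad v a" "grad v y - grad v a"] by simp
      then have 1: "norm (grad v x - grad v y) \<le> \<eta> * (norm (grad v a) / 2)"
        using near[OF that(1)] near[OF that(2)] by (simp add: e_def)
      have "e \<le> 1 / 4 * norm (grad v a)" unfolding e_def using \<eta> by (intro mult_right_mono) auto
      moreover have "norm (grad v a) \<le> norm (grad v y) + norm (grad v y - grad v a)"
        using norm_triangle_ineq4[of "grad v y" "grad v y - grad v a"] by simp
      ultimately have "norm (grad v a) / 2 \<le> norm (grad v y)"
        using near[OF that(2)] norm_ge_zero[of "grad v a"] by linarith
      then have "\<eta> * (norm (grad v a) / 2) \<le> \<eta> * norm (grad v y)" using \<eta> by (intro mult_left_mono) auto
      with 1 show ?thesis by linarith
    qed
    with \<rho> have "\<rho> \<in> Good a" by (simp add: Good_def)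
    then show ?thesis by blast
  qed
  have s_pos: "0 < s a" and s_le: "s a \<le> d" if a: "a \<in> S" for a
  proof -
    obtain \<rho> where "\<rho> \<in> Good a" using nonempty[OF a] by blast
    then have "0 < \<rho>" "\<rho> \<le> s a" unfolding s_def using bdd by (auto simp: Good_def intro: cSup_upper)
    then show "0 < s a" by linarith
    show "s a \<le> d" unfolding s_def using nonempty[OF a] by (rule cSup_least) (simp add: Good_def)
  qed
  have s_lip: "s a \<le> s b + dist a b" if a: "a \<in> S" and b: "b \<in> S" for a b
    unfolding s_def[of a]
  proof (rule cSup_least[OF nonempty[OF a]])
    fix \<rho> assume \<rho>: "\<rho> \<in> Good a"
    show "\<rho> \<le> s b + dist a b"
    proof (cases "\<rho> \<le> dist a b")
      case True
      then show ?thesis using s_pos[OF b] by linarith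
    next
      case False
      have sub: "ball b (\<rho> - dist a b) \<subseteq> ball a \<rho>"
      proof
        fix x assume "x \<in> ball b (\<rho> - dist a b)"
        then show "x \<in> ball a \<rho>" using dist_triangle[of a x b] by simp
      qed
      have "\<rho> \<le> d" using \<rho> by (simp add: Good_def)
      then have "\<rho> - dist a b \<le> d" using zero_le_dist[of a b] by linarith
      then have "\<rho> - dist a b \<in> Good b" using \<rho> False sub unfolding Good_def by auto
      then have "\<rho> - dist a b \<le> s b" unfolding s_def using bdd by (rule cSup_upper)
      then show ?thesis by linarith
    qed
  qed
  define r where "r a = \<eta> * s a" for a
  have r_pos: "0 < r a" and r_le: "r a \<le> d" if a: "a \<in> S" for a
  proof -
    show "0 < r a" using s_pos[OF a] \<eta> by (simp add: r_def)
    have "r a \<le> 1 * d" unfolding r_def using s_pos[OF a] s_le[OF a] \<eta> by (intro mult_mono) auto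
    then show "r a \<le> d" by simp
  qed
  have r_good: "cball a (r a) \<subseteq> S" 
    "\<And>z. z \<in> cball a (r a) \<Longrightarrow> norm (grad v z - grad v a) \<le> \<eta> * norm (grad v a)" if a: "a \<in> S" for a
  proof -
    have "r a < s a" using s_pos[OF a] \<eta> by (simp add: r_def)
    then obtain \<rho> where \<rho>: "\<rho> \<in> Good a" "r a < \<rho>"
      unfolding s_def using less_cSup_iff[OF nonempty[OF a] bdd] by blast
    have sub: "cball a (r a) \<subseteq> ball a \<rho>" using \<rho>(2) by auto
    then show "cball a (r a) \<subseteq> S" using \<rho>(1) unfolding Good_def by blast
    have "a \<in> ball a \<rho>" using \<rho>(1) by (simp add: Good_def)
    then show "norm (grad v z - grad v a) \<le> \<eta> * norm (grad v a)" if "z \<in> cball a (r a)" for z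
      using \<rho>(1) sub that unfolding Good_def by blast
  qed
  from maximal_disjoint_balls[of A r]
  obtain D where D: "D \<subseteq> A" "pairwise (\<lambda>a b. cball a (r a) \<inter> cball b (r b) = {}) D"
    and max: "\<forall>a\<in>A. a \<in> D \<or> (\<exists>b\<in>D. cball a (r a) \<inter> cball b (r b) \<noteq> {})"
    by (elim exE conjE)
  have DS: "a \<in> S" "v a = c" if "a \<in> D" for a using that D(1) by (auto simp: A_def)
  have disj: "disjoint_family_on (\<lambda>b. cball b (r b)) F" if "F \<subseteq> D" for F
    using D(2) that by (auto simp: disjoint_family_on_def pairwise_def)
  have D_count: "countable D"
  proof (rule countable_image_inj_on)
    show "countable ((\<lambda>b. ball b (r b)) ` D)"
    proof (rule countable_disjoint_open_subsets)
      show "pairwise disjnt ((\<lambda>b. ball b (r b)) ` D)"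
      proof (rule pairwise_imageI)
        fix a b assume "a \<in> D" "b \<in> D" "a \<noteq> b"
        then have "cball a (r a) \<inter> cball b (r b) = {}" using D(2) by (simp add: pairwise_def)
        then show "disjnt (ball a (r a)) (ball b (r b))"
          using ball_subset_cball[of a "r a"] ball_subset_cball[of b "r b"] unfolding disjnt_def by blast
      qed
    qed auto
    show "inj_on (\<lambda>b. ball b (r b)) D"
    proof (rule inj_onI, rule ccontr)
      fix a b assume ab: "a \<in> D" "b \<in> D" "ball a (r a) = ball b (r b)" "a \<noteq> b"
      then have "cball a (r a) \<inter> cball b (r b) = {}" using D(2) by (simp add: pairwise_def)
      moreover have "a \<in> ball a (r a)" using r_pos[OF DS(1)[OF ab(1)]] by simp
      ultimately show False using ab(3) ball_subset_cball by blast
    qed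
  qed
  define w where "w b = 2 * r b / (1 - \<eta>)" for b
  define I where "I = (\<lambda>b. (b, w b)) ` D"
  have "A \<subseteq> (\<Union>(b, \<rho>)\<in>I. cball b \<rho>)"
  proof
    fix a assume a: "a \<in> A"
    then have aS: "a \<in> S" by (simp add: A_def)
    have "\<exists>b\<in>D. dist b a \<le> w b"
    proof (cases "a \<in> D")
      case True
      then show ?thesis using r_pos[OF aS] \<eta> by (intro bexI[of _ a]) (auto simp: w_def)
    next
      case False
      then obtain b x where b: "b \<in> D" "x \<in> cball a (r a)" "x \<in> cball b (r b)" using max a by blast
      have "dist b a \<le> r b + r a" using b(2,3) dist_triangle[of b a x] by (simp add: dist_commute)
      moreover have "r a \<le> r b + \<eta> * dist b a"
      proof -
        have "\<eta> * s a \<le> \<eta> * (s b + dist a b)" using s_lip[OF aS DS(1)[OF b(1)]] \<eta> by (intro mult_left_mono) auto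
        then show ?thesis by (simp add: r_def algebra_simps dist_commute)
      qed
      ultimately have "dist b a * (1 - \<eta>) \<le> 2 * r b" by (simp add: algebra_simps)
      then show ?thesis using b(1) \<eta> by (auto simp: w_def field_simps)
    qed
    then show "a \<in> (\<Union>(b, \<rho>)\<in>I. cball b \<rho>)" by (auto simp: I_def)
  qed
  moreover have "0 \<le> \<rho> \<and> 2 * \<rho> \<le> \<delta>" if "(b, \<rho>) \<in> I" for b \<rho>
  proof -
    have b: "b \<in> D" "\<rho> = w b" using that by (auto simp: I_def)
    have "4 * r b \<le> \<delta> * (1 - \<eta>)" using r_le[OF DS(1)[OF b(1)]] by (simp add: d_def)
    then show ?thesis using r_pos[OF DS(1)[OF b(1)]] \<eta> by (simp add: b w_def field_simps)
  qed
  moreover have "(\<Sum>(b, \<rho>)\<in>F. 2 * \<rho>) \<le> 2 * (1 + \<eta>) / (1 - \<eta>)\<^sup>2 * M" if F: "finite F" "F \<subseteq> I" for F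
  proof -
    obtain E where E: "E \<subseteq> D" "finite E" "F = (\<lambda>b. (b, w b)) ` E"
      using finite_subset_image[OF F(1)] F(2) unfolding I_def by blast
    define \<tau> where "\<tau> b = r b * (1 - \<eta>) / (1 + \<eta>)" for b
    define eb where "eb b = \<eta> * norm (grad v b) * \<tau> b" for b
    define \<epsilon> where "\<epsilon> = Min (insert 1 (eb ` E))"
    have \<tau>: "\<tau> b > 0" if "b \<in> E" for b
      using r_pos DS E(1) that \<eta> by (auto simp: \<tau>_def)
    have "eb b > 0" if "b \<in> E" for b
      using \<tau>[OF that] reg DS E(1) that \<eta> by (auto simp: eb_def)
    then have \<epsilon>: "\<epsilon> > 0" "\<And>b. b \<in> E \<Longrightarrow> \<epsilon> \<le> eb b"
      unfolding \<epsilon>_def using E(2) by auto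
    define m where "m z = ennreal (band_density v c \<beta> \<epsilon> z)" for z
    define K where "K = (\<Union>b\<in>E. cball b (r b))"
    have K: "compact K" "K \<subseteq> S" unfolding K_def using E r_good(1) DS(1) by (auto intro!: compact_UN)
    have "ennreal (\<Sum>b\<in>E. 2 * \<tau> b) = (\<Sum>b\<in>E. ennreal (2 * \<tau> b))"
      using \<tau> by (intro sum_ennreal[symmetric]) (auto simp: less_imp_le)
    also have "\<dots> \<le> (\<Sum>b\<in>E. \<integral>\<^sup>+z. indicator (cball b (r b)) z * m z \<partial>lborel)"
    proof (rule sum_mono)
      fix b assume b: "b \<in> E"
      then have bS: "b \<in> S" "v b = c" using DS E(1) by auto
      show "ennreal (2 * \<tau> b) \<le> (\<integral>\<^sup>+z. indicator (cball b (r b)) z * m z \<partial>lborel)"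
        unfolding m_def \<tau>_def
        by (rule band_mass_ge[OF S v r_good(1)[OF bS(1)] bS(2) reg[OF bS(1)] \<eta> r_pos[OF bS(1)] r_good(2)[OF bS(1)] \<beta> \<epsilon>(1)])
          (use \<epsilon>(2)[OF b] in \<open>auto simp: eb_def \<tau>_def\<close>)
    qed
    also have "\<dots> = (\<integral>\<^sup>+z. (\<Sum>b\<in>E. indicator (cball b (r b)) z * m z) \<partial>lborel)"
    proof (rule nn_integral_sum[symmetric])
      fix b assume b: "b \<in> E"
      have "continuous_on (cball b (r b)) (band_density v c \<beta> \<epsilon>)"
        using continuous_on_band_density[OF v] r_good(1) DS(1) E(1) b by (blast intro: continuous_on_subset)
      then have "(\<lambda>z. indicator (cball b (r b)) z *\<^sub>R band_density v c \<beta> \<epsilon> z) \<in> borel_measurable borel"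
        by (intro borel_measurable_continuous_on_indicator) auto
      then have "(\<lambda>z. ennreal (indicator (cball b (r b)) z *\<^sub>R band_density v c \<beta> \<epsilon> z)) \<in> borel_measurable lborel"
        by simp
      also have "(\<lambda>z. ennreal (indicator (cball b (r b)) z *\<^sub>R band_density v c \<beta> \<epsilon> z)) 
          = (\<lambda>z. indicator (cball b (r b)) z * m z)"
        by (auto simp: fun_eq_iff indicator_def m_def)
      finally show "(\<lambda>z. indicator (cball b (r b)) z * m z) \<in> borel_measurable lborel" .
    qed
    also have "\<dots> = (\<integral>\<^sup>+z. indicator K z * m z \<partial>lborel)"
      unfolding K_def indicator_UN_disjoint[OF E(2) disj[OF E(1)]] by (simp only: sum_distrib_right)
    also have "\<dots> \<le> ennreal M" unfolding m_def by (rule mass[OF K \<epsilon>(1)])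
    finally have le: "(\<Sum>b\<in>E. 2 * \<tau> b) \<le> M" using M by (simp add: ennreal_le_iff)
    have "(\<Sum>(b, \<rho>)\<in>F. 2 * \<rho>) = (\<Sum>b\<in>E. 2 * w b)"
      unfolding E(3) by (subst sum.reindex) (auto simp: inj_on_def)
    also have "\<dots> = (\<Sum>b\<in>E. 2 * (1 + \<eta>) / (1 - \<eta>)\<^sup>2 * (2 * \<tau> b))"
    proof (rule sum.cong[OF refl])
      fix b
      have *: "2 * (2 * q / x) = 2 * y / x\<^sup>2 * (2 * (q * x / y))" if "x \<noteq> 0" "y \<noteq> 0" for q x y :: real
        using that by (simp add: field_simps power2_eq_square)
      show "2 * w b = 2 * (1 + \<eta>) / (1 - \<eta>)\<^sup>2 * (2 * \<tau> b)"
        unfolding w_def \<tau>_def by (rule *) (use \<eta> in auto)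
    qed
    also have "\<dots> = 2 * (1 + \<eta>) / (1 - \<eta>)\<^sup>2 * (\<Sum>b\<in>E. 2 * \<tau> b)" by (rule sum_distrib_left[symmetric])
    also have "\<dots> \<le> 2 * (1 + \<eta>) / (1 - \<eta>)\<^sup>2 * M" using le \<eta> by (intro mult_left_mono) auto
    finally show ?thesis .
  qed
  moreover have "countable I" unfolding I_def using D_count by (rule countable_image)
  ultimately show ?thesis unfolding A_def by blast
qed

text \<open>The transition width of the steps, the size of the inner circle of the cutoff and the oscillation
  of the gradient all tend to \<open>0\<close> together as the parameter \<open>\<eta>\<close> does. The factor \<open>2\<close> that the
  covering costs, because a maximal disjoint family covers only after doubling the radii, is the
  factor \<open>1/2\<close> gained from the centered step.\<close>

lemma level_curve_length_le:
  fixes v :: "complex \<Rightarrow> real" and z0 :: complex and R c :: real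
  defines "S \<equiv> ball z0 R - {z0}"
  assumes R: "R > 0" and v: "Ck_on 2 S v" and reg: "\<And>z. z \<in> S \<Longrightarrow> grad v z \<noteq> 0"
    and k: "integrable lborel (\<lambda>z. indicator S z * \<bar>level_curvature v z\<bar>)"
  shows "hausdorff1 {z\<in>ball z0 R. v z = c} 
    \<le> ennreal ((LINT z|lborel. indicator S z * \<bar>level_curvature v z\<bar>) + 2 * pi * R)"
proof -
  define J where "J = (LINT z|lborel. indicator S z * \<bar>level_curvature v z\<bar>)"
  have J: "J \<ge> 0" unfolding J_def by (intro integral_nonneg_AE AE_I2) auto
  have S: "open S" by (simp add: S_def open_Diff)
  have v1: "Ck_on (Suc 0) S v" using Ck_on_SucD v unfolding numeral_2_eq_2 by blast
  define B where "B \<eta> = 2 * (1 + \<eta>) / (1 - \<eta>)\<^sup>2 * ((J + 2 * pi / (1 - \<eta>) * (R + \<eta> * R)) / 2)" for \<eta>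
  have bound: "hausdorff1 {z\<in>ball z0 R. v z = c} \<le> ennreal (B \<eta>)" if \<eta>: "0 < \<eta>" "\<eta> < 1" for \<eta>
  proof (rule hausdorff1_le_balls)
    define M where "M = (J + 2 * pi / (1 - \<eta>) * (R + \<eta> * R)) / 2"
    have M: "M \<ge> 0" using J R \<eta> by (simp add: M_def)
    then show "B \<eta> \<ge> 0" unfolding B_def M_def[symmetric] using \<eta> by simp
    have mass: "(\<integral>\<^sup>+z. indicator K z * ennreal (band_density v c \<eta> \<epsilon> z) \<partial>lborel) \<le> ennreal M"
      if "compact K" "K \<subseteq> S" "\<epsilon> > 0" for K \<epsilon>
      unfolding M_def J_def S_def
      using \<eta> R that v reg k by (intro band_mass_le) (auto simp: S_def)
    fix \<delta> :: real assume \<delta>: "\<delta> > 0"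
    have "\<exists>I. countable I \<and> {z\<in>S. v z = c} \<subseteq> (\<Union>(b, \<rho>)\<in>I. cball b \<rho>) \<and> 
      (\<forall>(b, \<rho>)\<in>I. 0 \<le> \<rho> \<and> 2 * \<rho> \<le> \<delta>) \<and> 
      (\<forall>F. finite F \<longrightarrow> F \<subseteq> I \<longrightarrow> (\<Sum>(b, \<rho>)\<in>F. 2 * \<rho>) \<le> 2 * (1 + \<eta>) / (1 - \<eta>)\<^sup>2 * M)"
      by (rule level_set_cover[OF S v1 reg \<eta> M mass \<eta> \<delta>])
    then obtain I where I0: "countable I" "{z\<in>S. v z = c} \<subseteq> (\<Union>(b, \<rho>)\<in>I. cball b \<rho>)"
      "\<forall>(b, \<rho>)\<in>I. 0 \<le> \<rho> \<and> 2 * \<rho> \<le> \<delta>" 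
      "\<forall>F. finite F \<longrightarrow> F \<subseteq> I \<longrightarrow> (\<Sum>(b, \<rho>)\<in>F. 2 * \<rho>) \<le> 2 * (1 + \<eta>) / (1 - \<eta>)\<^sup>2 * M"
      by (elim exE conjE)
    \<comment> \<open>The center is not controlled by the estimates on \<open>S\<close>; a degenerate ball covers it for free.\<close>
    let ?I = "insert (z0, 0) I"
    have "countable ?I" using I0(1) by simp
    moreover have "{z\<in>ball z0 R. v z = c} \<subseteq> (\<Union>(b, \<rho>)\<in>?I. cball b \<rho>)"
    proof
      fix z assume "z \<in> {z\<in>ball z0 R. v z = c}"
      then have "z = z0 \<or> z \<in> {z\<in>S. v z = c}" by (auto simp: S_def)
      then show "z \<in> (\<Union>(b, \<rho>)\<in>?I. cball b \<rho>)" using I0(2) by auto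
    qed
    moreover have "\<forall>(b, \<rho>)\<in>?I. 0 \<le> \<rho> \<and> 2 * \<rho> \<le> \<delta>" using I0(3) \<delta> by auto
    moreover have "(\<Sum>(b, \<rho>)\<in>F. 2 * \<rho>) \<le> B \<eta>" if F: "finite F" "F \<subseteq> ?I" for F
    proof -
      have "(\<Sum>(b, \<rho>)\<in>F. 2 * \<rho>) = (\<Sum>(b, \<rho>)\<in>F - {(z0, 0)}. 2 * \<rho>)"
        using F(1) by (intro sum.mono_neutral_right) auto
      also have "\<dots> \<le> 2 * (1 + \<eta>) / (1 - \<eta>)\<^sup>2 * M" using F by (intro I0(4)[rule_format]) auto
      finally show ?thesis by (simp add: B_def M_def)
    qed
    ultimately show "\<exists>I. countable I \<and> {z\<in>ball z0 R. v z = c} \<subseteq> (\<Union>(b, \<rho>)\<in>I. cball b \<rho>) \<and> 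
     (\<forall>(b, \<rho>)\<in>I. 0 \<le> \<rho> \<and> 2 * \<rho> \<le> \<delta>) \<and> (\<forall>F. finite F \<longrightarrow> F \<subseteq> I \<longrightarrow> (\<Sum>(b, \<rho>)\<in>F. 2 * \<rho>) \<le> B \<eta>)"
      by blast
  qed
  have "((\<lambda>\<eta>. ennreal (B \<eta>)) \<longlongrightarrow> ennreal (J + 2 * pi * R)) (at_right 0)"
  proof (rule tendsto_ennrealI)
    have "isCont B 0" unfolding B_def by (intro continuous_intros) auto
    then have "(B \<longlongrightarrow> B 0) (at_right 0)" by (simp add: isCont_def filterlim_at_split)
    then show "(B \<longlongrightarrow> J + 2 * pi * R) (at_right 0)" by (simp add: B_def add_divide_distrib mult.assoc)
  qed
  moreover have "eventually (\<lambda>\<eta>. hausdorff1 {z\<in>ball z0 R. v z = c} \<le> ennreal (B \<eta>)) (at_right 0)"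
    unfolding eventually_at_right_field using bound by (intro exI[of _ 1]) auto
  ultimately have "hausdorff1 {z\<in>ball z0 R. v z = c} \<le> ennreal (J + 2 * pi * R)"
    by (rule tendsto_lowerbound) simp
  then show ?thesis by (simp add: J_def)
qed


section \<open>Curvature bounds under the four hypotheses\<close>

lemma curvature_integrable_of_bound:
  fixes v :: "complex \<Rightarrow> real" and z0 :: complex
  assumes R: "R > 0" and v: "Ck_on 2 (ball z0 R) v" 
    and reg: "\<And>z. z \<in> ball z0 R - {z0} \<Longrightarrow> grad v z \<noteq> 0"
    and W: "W absolutely_integrable_on ball z0 R" 
    and bound: "\<And>z. z \<in> ball z0 R - {z0} \<Longrightarrow> \<bar>level_curvature v z\<bar> \<le> W z"
  shows "level_curvature v absolutely_integrable_on ball z0 R"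
proof -
  let ?S = "ball z0 R - {z0}"
  have S: "open ?S" by (simp add: open_Diff)
  have "W absolutely_integrable_on ?S"
    using W by (rule set_integrable_subset) auto
  then have "level_curvature v absolutely_integrable_on ?S"
    using set_integrable_level_curvature[OF S Ck_on_subset[OF v] reg _ bound] by auto
  then show ?thesis
  proof (rule absolutely_integrable_spike_set)
    have "{x \<in> ?S - ball z0 R. level_curvature v x \<noteq> 0} = {}" by auto
    then show "negligible {x \<in> ?S - ball z0 R. level_curvature v x \<noteq> 0}" by (simp only: negligible_empty)
    have "{x \<in> ball z0 R - ?S. level_curvature v x \<noteq> 0} \<subseteq> {z0}" by auto
    then show "negligible {x \<in> ball z0 R - ?S. level_curvature v x \<noteq> 0}"
      using negligible_subset[OF negligible_sing] by blast
  qed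
qed

lemma set_integrable_one_ball: "set_integrable lebesgue (ball (z0 :: complex) R) (\<lambda>z. 1 :: real)"
  unfolding set_integrable_def
  using lmeasurable_ball[of z0 R] by (simp add: fmeasurable_def)

text \<open>Since \<open>2 h \<le> 1 + h\<^sup>2\<close> and the ball has finite measure, square integrability of a bound for the
  Hessian suffices.\<close>

lemma curvature_integrable_L2_hessian:
  fixes v :: "complex \<Rightarrow> real"
  assumes R: "R > 0" and v: "Ck_on 2 (ball z0 R) v" and C: "C > 0"
    and H: "L2_on (ball z0 R) (hessian v)" and f: "\<And>z. z \<in> ball z0 R \<Longrightarrow> norm (cgrad v z) > C"
  shows "level_curvature v absolutely_integrable_on ball z0 R"
proof (rule curvature_integrable_of_bound[OF R v])
  have pos: "norm (grad v z) > 2 * C" if "z \<in> ball z0 R" for z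
    using f[OF that] by (simp add: norm_cgrad)
  then show reg: "grad v z \<noteq> 0" if "z \<in> ball z0 R - {z0}" for z
    using C that by (smt (verit) DiffD1 norm_zero)
  show "(\<lambda>z. (1 + (norm (hessian v z))\<^sup>2) * (1 / (2 * C))) absolutely_integrable_on ball z0 R"
    using H unfolding L2_on_def 
    by (intro set_integrable_mult_left set_integral_add(1) set_integrable_one_ball) auto
  show "\<bar>level_curvature v z\<bar> \<le> (1 + (norm (hessian v z))\<^sup>2) * (1 / (2 * C))" if z: "z \<in> ball z0 R - {z0}" for z
  proof -
    let ?h = "norm (hessian v z)"
    have comp: "\<bar>hessian v z $ i $ j\<bar> \<le> ?h" for i j
      by (rule order_trans[OF component_le_norm_cart Finite_Cartesian_Product.norm_nth_le])
    have "\<bar>dx (dx v) z\<bar> \<le> ?h" "\<bar>dy (dx v) z\<bar> \<le> ?h" "\<bar>dy (dy v) z\<bar> \<le> ?h"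
      using comp[of 1 1] comp[of 1 2] comp[of 2 2] by (simp_all add: hessian_def)
    then have "\<bar>level_curvature v z\<bar> \<le> 2 * ?h / norm (grad v z)"
      using reg[OF z] by (rule level_curvature_bound)
    also have "\<dots> \<le> (1 + ?h\<^sup>2) / (2 * C)"
      using pos[of z] z C sum_squares_bound[of 1 ?h] by (intro frac_le) auto
    finally show ?thesis by simp
  qed
qed

text \<open>The modulus of \<open>f\<^sub>z\<close> measures the trace-free part of the Hessian of \<open>u\<^sup>1\<close>, that of \<open>g\<^sub>z\<close> the one of
  \<open>u\<^sup>2\<close>. The system bounds the traces by these two, so that the whole Hessians are square
  integrable.\<close>

lemma curvature_integrable_L2_wirt_z:
  fixes u :: "complex \<Rightarrow> real^2" and i :: 2
  defines "v \<equiv> \<lambda>j z. u z $ j"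
  assumes p: "1 < p" and \<Omega>: "open \<Omega>" and u: "Ck_on 2 \<Omega> u" "p_harmonic_map p \<Omega> u"
    and R: "R > 0" and B: "ball z0 R \<subseteq> \<Omega>" and C: "C > 0"
    and H: "\<And>j. L2_on (ball z0 R) (wirt_z (cgrad (v j)))" 
    and f: "\<And>z. z \<in> ball z0 R \<Longrightarrow> norm (cgrad (v i) z) > C"
  shows "level_curvature (v i) absolutely_integrable_on ball z0 R"
proof (rule curvature_integrable_of_bound[OF R])
  have C2: "Ck_on 2 (ball z0 R) (v j)" for j
    unfolding v_def by (rule Ck_on_linear[OF open_ball bounded_linear_vec_nth Ck_on_subset[OF u(1) B]])
  then show "Ck_on 2 (ball z0 R) (v i)" .
  have pos: "norm (grad (v i) z) > 2 * C" if "z \<in> ball z0 R" for z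
    using f[OF that] by (simp add: norm_cgrad)
  then show reg: "grad (v i) z \<noteq> 0" if "z \<in> ball z0 R - {z0}" for z
    using C that by (smt (verit) DiffD1 norm_zero)
  define \<kappa> where "\<kappa> = (p - 2) / min 1 (p / 2)"
  define Q where "Q z = (norm (wirt_z (cgrad (v 1)) z))\<^sup>2 + (norm (wirt_z (cgrad (v 2)) z))\<^sup>2" for z
  show "(\<lambda>z. (1 + (\<kappa>\<^sup>2 / 2 + 2) * (4 * Q z)) * (1 / (2 * C))) absolutely_integrable_on ball z0 R"
    using H[of 1] H[of 2] unfolding L2_on_def Q_def
    by (intro set_integrable_mult_left set_integrable_mult_right set_integral_add(1) set_integrable_one_ball) auto
  show "\<bar>level_curvature (v i) z\<bar> \<le> (1 + (\<kappa>\<^sup>2 / 2 + 2) * (4 * Q z)) * (1 / (2 * C))" if z: "z \<in> ball z0 R - {z0}" for z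
  proof -
    have zB: "z \<in> ball z0 R" using z by simp
    define T where "T = (dx (v 1) z)\<^sup>2 + (dy (v 1) z)\<^sup>2 + (dx (v 2) z)\<^sup>2 + (dy (v 2) z)\<^sup>2"
    have i: "i = 1 \<or> i = 2" by (rule exhaust_2)
    have norm_Du_eq: "norm_Du u w = sqrt ((norm (grad (v 1) w))\<^sup>2 + (norm (grad (v 2) w))\<^sup>2)" for w
      by (simp add: norm_Du_def v_def)
    have sum_pos: "(norm (grad (v 1) w))\<^sup>2 + (norm (grad (v 2) w))\<^sup>2 > 0" if "w \<in> ball z0 R" for w
    proof -
      have "norm (grad (v i) w) > 0" using pos[OF that] C by linarith
      then have "(norm (grad (v i) w))\<^sup>2 > 0" by (rule zero_less_power)
      then show ?thesis using i by (auto intro: add_pos_nonneg add_nonneg_pos)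
    qed
    then have nz: "norm_Du u w \<noteq> 0" if "w \<in> ball z0 R" for w
      using that unfolding norm_Du_eq by fastforce
    have T: "T > 0" using sum_pos[OF zB] unfolding norm_grad_squared by (simp add: T_def add.assoc)
    have v_eq: "(\<lambda>z. u z $ j) = v j" for j by (simp add: v_def)
    note E = p_harmonic_map_nondivergence_form[OF \<Omega> u open_ball B nz zB, unfolded v_eq]
    have lap: "(dx (dx (v 1)) z + dy (dy (v 1)) z)\<^sup>2 + (dx (dx (v 2)) z + dy (dy (v 2)) z)\<^sup>2
      \<le> \<kappa>\<^sup>2 * (((dx (dx (v 1)) z - dy (dy (v 1)) z) / 2)\<^sup>2 + (dy (dx (v 1)) z)\<^sup>2
        + ((dx (dx (v 2)) z - dy (dy (v 2)) z) / 2)\<^sup>2 + (dy (dx (v 2)) z)\<^sup>2)"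
      unfolding \<kappa>_def
      by (rule laplacians_le_trace_free_parts[OF p T[unfolded T_def] E[of 1] E[of 2]])
    define M where "M = ((dx (dx (v 1)) z - dy (dy (v 1)) z) / 2)\<^sup>2 + (dy (dx (v 1)) z)\<^sup>2
        + ((dx (dx (v 2)) z - dy (dy (v 2)) z) / 2)\<^sup>2 + (dy (dx (v 2)) z)\<^sup>2"
    have MQ: "M = 4 * Q z"
      unfolding M_def Q_def norm_wirt_z_cgrad[OF open_ball C2 zB] by (simp add: power_divide field_simps)
    let ?d = "(dx (dx (v i)) z - dy (dy (v i)) z) / 2" and ?L = "dx (dx (v i)) z + dy (dy (v i)) z"
    have nn: "0 \<le> ((dx (dx (v 1)) z - dy (dy (v 1)) z) / 2)\<^sup>2" "0 \<le> (dy (dx (v 1)) z)\<^sup>2"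
      "0 \<le> ((dx (dx (v 2)) z - dy (dy (v 2)) z) / 2)\<^sup>2" "0 \<le> (dy (dx (v 2)) z)\<^sup>2"
      "0 \<le> (dx (dx (v 1)) z + dy (dy (v 1)) z)\<^sup>2" "0 \<le> (dx (dx (v 2)) z + dy (dy (v 2)) z)\<^sup>2"
      by (rule zero_le_power2)+
    from i have L: "?L\<^sup>2 \<le> \<kappa>\<^sup>2 * M" and d: "?d\<^sup>2 \<le> M" and o: "(dy (dx (v i)) z)\<^sup>2 \<le> M"
    proof (atomize (full), elim disjE)
      assume i: "i = 1"
      show "?L\<^sup>2 \<le> \<kappa>\<^sup>2 * M \<and> ?d\<^sup>2 \<le> M \<and> (dy (dx (v i)) z)\<^sup>2 \<le> M"
        unfolding i using lap[folded M_def] nn M_def by linarith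
    next
      assume i: "i = 2"
      show "?L\<^sup>2 \<le> \<kappa>\<^sup>2 * M \<and> ?d\<^sup>2 \<le> M \<and> (dy (dx (v i)) z)\<^sup>2 \<le> M"
        unfolding i using lap[folded M_def] nn M_def by linarith
    qed
    have M0: "M \<ge> 0" using d zero_le_power2 order_trans by blast
    define h where "h = sqrt ((\<kappa>\<^sup>2 / 2 + 2) * M)"
    have h0: "h \<ge> 0" using M0 by (simp add: h_def)
    have h2: "h\<^sup>2 = (\<kappa>\<^sup>2 / 2 + 2) * M" using M0 by (simp add: h_def)
    have half: "(x / 2 + y)\<^sup>2 \<le> x\<^sup>2 / 2 + 2 * y\<^sup>2" "(x / 2 - y)\<^sup>2 \<le> x\<^sup>2 / 2 + 2 * y\<^sup>2" for x y :: real
      using sum_squares_bound[of "x / 2" y] sum_squares_bound[of "x / 2" "- y"] 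
      by (simp_all add: power2_eq_square field_simps)
    have "?L\<^sup>2 / 2 + 2 * ?d\<^sup>2 \<le> h\<^sup>2" using L d unfolding h2 by (simp add: algebra_simps)
    moreover have "dx (dx (v i)) z = ?L / 2 + ?d" "dy (dy (v i)) z = ?L / 2 - ?d" by (simp_all add: field_simps)
    ultimately have "(dx (dx (v i)) z)\<^sup>2 \<le> h\<^sup>2" "(dy (dy (v i)) z)\<^sup>2 \<le> h\<^sup>2"
      using half[of ?L ?d] by (metis order_trans)+
    moreover have "(dy (dx (v i)) z)\<^sup>2 \<le> h\<^sup>2"
    proof -
      have "1 * M \<le> (\<kappa>\<^sup>2 / 2 + 2) * M" using M0 by (intro mult_right_mono) (auto simp: add_increasing)
      then show ?thesis using o unfolding h2 by linarith
    qed
    ultimately have "\<bar>dx (dx (v i)) z\<bar> \<le> h" "\<bar>dy (dx (v i)) z\<bar> \<le> h" "\<bar>dy (dy (v i)) z\<bar> \<le> h"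
      using h0 by (simp_all add: abs_le_square_iff[symmetric])
    then have "\<bar>level_curvature (v i) z\<bar> \<le> 2 * h / norm (grad (v i) z)"
      using reg[OF z] by (rule level_curvature_bound)
    also have "\<dots> \<le> (1 + h\<^sup>2) / (2 * C)"
      using pos[OF zB] C sum_squares_bound[of 1 h] by (intro frac_le) auto
    finally show ?thesis by (simp add: h2 MQ)
  qed
qed

text \<open>On the compact ball the Hessian is bounded. With \<open>\<alpha> < 1\<close> the curvature is then at most of the
  order of \<open>1 / |z - z\<^sub>0|\<close>, which is integrable in the plane; a lower bound by a constant is
  the case \<open>\<alpha> = 0\<close>.\<close>

lemma curvature_integrable_cball:
  fixes v :: "complex \<Rightarrow> real"
  assumes \<Omega>: "open \<Omega>" "Ck_on 2 \<Omega> v" and R: "R > 0" and B: "cball z0 R \<subseteq> \<Omega>" and C: "C > 0" and \<alpha>: "\<alpha> < 1"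
    and f: "\<And>z. z \<in> ball z0 R - {z0} \<Longrightarrow> norm (cgrad v z) > C * norm (z - z0) powr \<alpha>"
  shows "level_curvature v absolutely_integrable_on ball z0 R"
proof -
  have v: "Ck_on 2 (ball z0 R) v"
    using \<Omega>(2) by (rule Ck_on_subset) (use B ball_subset_cball in blast)
  have pos: "norm (grad v z) > 2 * (C * norm (z - z0) powr \<alpha>)" if "z \<in> ball z0 R - {z0}" for z
    using f[OF that] by (simp add: norm_cgrad)
  have reg: "grad v z \<noteq> 0" if "z \<in> ball z0 R - {z0}" for z
  proof -
    have "0 \<le> 2 * (C * norm (z - z0) powr \<alpha>)" using C by simp
    then show ?thesis using pos[OF that] by (smt (verit) norm_zero)
  qed
  have bd: "\<exists>h. \<forall>z\<in>cball z0 R. \<bar>w z\<bar> \<le> h" if "continuous_on \<Omega> w" for w :: "complex \<Rightarrow> real"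
  proof -
    have "bounded (w ` cball z0 R)"
      using continuous_on_subset[OF that B] compact_cball by (intro compact_imp_bounded compact_continuous_image)
    then show ?thesis by (auto simp: bounded_iff)
  qed
  have "continuous_on \<Omega> (dx (dx v))" "continuous_on \<Omega> (dy (dx v))" "continuous_on \<Omega> (dy (dy v))"
    using \<Omega>(2) by (simp_all add: numeral_2_eq_2)
  from this[THEN bd] obtain h1 h2 h3 where "\<forall>z\<in>cball z0 R. \<bar>dx (dx v) z\<bar> \<le> h1" 
    "\<forall>z\<in>cball z0 R. \<bar>dy (dx v) z\<bar> \<le> h2" "\<forall>z\<in>cball z0 R. \<bar>dy (dy v) z\<bar> \<le> h3"
    by (elim exE)
  then have h: "\<bar>dx (dx v) z\<bar> \<le> max h1 (max h2 h3)" "\<bar>dy (dx v) z\<bar> \<le> max h1 (max h2 h3)" 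
    "\<bar>dy (dy v) z\<bar> \<le> max h1 (max h2 h3)" if "z \<in> cball z0 R" for z
    using that by (auto simp: le_max_iff_disj)
  define h where "h = max h1 (max h2 h3)"
  have h0: "h \<ge> 0" using h(1)[of z0] R by (simp add: h_def)
  have W: "(\<lambda>z. (h / C * R powr (1 - \<alpha>)) * (1 / norm (z - z0))) absolutely_integrable_on ball z0 R"
    using absolutely_integrable_inverse_dist[OF R] by (rule set_integrable_mult_right)
  have bound: "\<bar>level_curvature v z\<bar> \<le> (h / C * R powr (1 - \<alpha>)) * (1 / norm (z - z0))" if z: "z \<in> ball z0 R - {z0}" for z
  proof -
    define \<rho> where "\<rho> = norm (z - z0)"
    have \<rho>: "0 < \<rho>" "\<rho> \<le> R" using z by (auto simp: \<rho>_def dist_norm norm_minus_commute)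
    have "\<bar>level_curvature v z\<bar> \<le> 2 * h / norm (grad v z)"
      unfolding h_def using z by (intro level_curvature_bound reg h) auto
    also have "\<dots> \<le> 2 * h / (2 * (C * \<rho> powr \<alpha>))"
      using pos[OF z] h0 C \<rho> by (intro frac_le) (auto simp: \<rho>_def less_imp_le)
    also have "\<dots> = h / C * (\<rho> powr (1 - \<alpha>) / \<rho>)"
      using \<rho> C by (simp add: powr_diff)
    also have "\<dots> \<le> h / C * (R powr (1 - \<alpha>) / \<rho>)"
      using \<rho> \<alpha> h0 C by (intro mult_left_mono divide_right_mono powr_mono2) auto
    finally show ?thesis by (simp add: \<rho>_def)
  qed
  show ?thesis
    by (rule curvature_integrable_of_bound[OF R v reg W bound])
qed

section \<open>Level curves of p-harmonic maps\<close>

theorem theorem3: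
  fixes p C R c \<alpha> :: real
    and \<Omega> B :: "complex set"
    and u :: "complex \<Rightarrow> real^2"
    and v :: "2 \<Rightarrow> complex \<Rightarrow> real"
    and f :: "2 \<Rightarrow> complex \<Rightarrow> complex"
    and z0 :: complex
    and i :: 2
    and H1 H2 H3 H4 :: bool
  assumes "1 < p" and "p \<noteq> 2"
    and "open \<Omega>" and "connected \<Omega>"
    and "Ck_on 2 \<Omega> u" and "p_harmonic_map p \<Omega> u"
    and v: "\<And>j. v j = (\<lambda>z. u z $ j)"
    and f: "\<And>j. f j = cgrad (v j)"
    and "C > 0"
    and "R > 0" and B: "B = ball z0 R" and "B \<subseteq> \<Omega>"
    and "{z\<in>B. v i z = c} \<noteq> {}"
    and H1: "H1 \<longleftrightarrow> (\<forall>j. L2_on B (hessian (v j))) \<and> (\<forall>z\<in>B. norm (f i z) > C)"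
    and H2: "H2 \<longleftrightarrow> (\<forall>j. L2_on B (wirt_z (f j))) \<and> (\<forall>z\<in>B. norm (f i z) > C)"
    and H3: "H3 \<longleftrightarrow> (\<forall>j. quasiregular_on B (f j)) \<and> (\<forall>z\<in>B. norm (f i z) > C)"
    and H4: "H4 \<longleftrightarrow> (\<forall>j. quasiregular_on B (f j)) \<and> \<alpha> < 1 \<and>
               (\<forall>z\<in>B - {z0}. norm (f i z) > C * norm (z - z0) powr \<alpha>)"
  shows "(H1 \<or> H2 \<or> ((H3 \<or> H4) \<and> cball z0 R \<subseteq> \<Omega>) \<longrightarrow>
           level_curvature (v i) absolutely_integrable_on B)
       \<and> (H1 \<or> H2 \<or> H3 \<or> H4 \<longrightarrow>
           discrete {z\<in>\<Omega>. grad (v i) z = 0} \<longrightarrow>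
           (\<forall>z\<in>B. v i z = c \<longrightarrow> grad (v i) z \<noteq> 0) \<longrightarrow>
           hausdorff1 {z\<in>B. v i z = c}
             \<le> (\<integral>\<^sup>+z\<in>\<Omega> \<inter> B. ennreal \<bar>level_curvature (v i) z\<bar> \<partial>lebesgue)
               + ennreal (2 * pi * R))"
proof (intro conjI impI)
  have vi: "v j = (\<lambda>z. u z $ j)" "f j = cgrad (v j)" for j using v f by simp_all
  have C2\<Omega>: "Ck_on 2 \<Omega> (v i)"
    unfolding vi by (rule Ck_on_linear[OF \<open>open \<Omega>\<close> bounded_linear_vec_nth \<open>Ck_on 2 \<Omega> u\<close>])
  have C2: "Ck_on 2 (ball z0 R) (v i)"
    using C2\<Omega> \<open>B \<subseteq> \<Omega>\<close> B Ck_on_subset by blast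
  assume "H1 \<or> H2 \<or> ((H3 \<or> H4) \<and> cball z0 R \<subseteq> \<Omega>)"
  then consider H1 | H2 | "H3" "cball z0 R \<subseteq> \<Omega>" | "H4" "cball z0 R \<subseteq> \<Omega>" by blast
  then show "level_curvature (v i) absolutely_integrable_on B"
    unfolding B
  proof cases
    case 1
    then show "level_curvature (v i) absolutely_integrable_on ball z0 R"
      using \<open>C > 0\<close> \<open>R > 0\<close> C2 unfolding H1 B vi(2) by (intro curvature_integrable_L2_hessian[of R z0 "v i" C]) auto
  next
    case 2
    have L2: "L2_on (ball z0 R) (wirt_z (cgrad (\<lambda>z. u z $ j)))" for j
      using 2 unfolding H2 B vi(2) vi(1) by blast
    have low: "C < norm (cgrad (\<lambda>z. u z $ i) z)" if "z \<in> ball z0 R" for z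
      using 2 that unfolding H2 B vi(2) vi(1) by blast
    show "level_curvature (v i) absolutely_integrable_on ball z0 R"
      unfolding vi(1)
      by (rule curvature_integrable_L2_wirt_z[OF \<open>1 < p\<close> \<open>open \<Omega>\<close> \<open>Ck_on 2 \<Omega> u\<close> \<open>p_harmonic_map p \<Omega> u\<close> 
          \<open>R > 0\<close> \<open>B \<subseteq> \<Omega>\<close>[unfolded B] \<open>C > 0\<close> L2 low])
  next
    case 3
    have "C * norm (z - z0) powr 0 < norm (cgrad (v i) z)" if "z \<in> ball z0 R - {z0}" for z
      using 3(1) that unfolding H3 B vi(2) by simp
    then show "level_curvature (v i) absolutely_integrable_on ball z0 R"
      by (intro curvature_integrable_cball[OF \<open>open \<Omega>\<close> C2\<Omega> \<open>R > 0\<close> 3(2) \<open>C > 0\<close>, of 0]) auto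
  next
    case 4
    have "\<alpha> < 1" using 4(1) unfolding H4 by blast
    moreover have "C * norm (z - z0) powr \<alpha> < norm (cgrad (v i) z)" if "z \<in> ball z0 R - {z0}" for z
      using 4(1) that unfolding H4 B vi(2) by blast
    ultimately show "level_curvature (v i) absolutely_integrable_on ball z0 R"
      by (intro curvature_integrable_cball[OF \<open>open \<Omega>\<close> C2\<Omega> \<open>R > 0\<close> 4(2) \<open>C > 0\<close>]) auto
  qed
next
  let ?k = "level_curvature (v i)" and ?S = "ball z0 R - {z0}"
  have vi: "v j = (\<lambda>z. u z $ j)" "f j = cgrad (v j)" for j using v f by simp_all
  have "Ck_on 2 \<Omega> (v i)"
    unfolding vi by (rule Ck_on_linear[OF \<open>open \<Omega>\<close> bounded_linear_vec_nth \<open>Ck_on 2 \<Omega> u\<close>])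
  moreover have "?S \<subseteq> \<Omega>" using \<open>B \<subseteq> \<Omega>\<close> unfolding B by blast
  ultimately have C2: "Ck_on 2 ?S (v i)" by (rule Ck_on_subset)
  assume H: "H1 \<or> H2 \<or> H3 \<or> H4"
  have reg: "grad (v i) z \<noteq> 0" if "z \<in> ?S" for z
  proof -
    have "0 \<le> C * norm (z - z0) powr \<alpha>" using \<open>C > 0\<close> by simp
    moreover have "z \<in> B" "z \<in> B - {z0}" using that unfolding B by auto
    with H have "C < norm (f i z) \<or> C * norm (z - z0) powr \<alpha> < norm (f i z)"
      unfolding H1 H2 H3 H4 by blast
    ultimately have "norm (f i z) > 0" using \<open>C > 0\<close> by linarith
    then have "norm (grad (v i) z) > 0" unfolding vi(2) norm_cgrad[of "v i"] by simp
    then show ?thesis by simp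
  qed
  define J where "J = (\<integral>\<^sup>+z\<in>\<Omega> \<inter> B. ennreal \<bar>?k z\<bar> \<partial>lebesgue)"
  have J: "(\<integral>\<^sup>+z. ennreal (indicator ?S z * \<bar>?k z\<bar>) \<partial>lborel) \<le> J"
  proof -
    have "(\<integral>\<^sup>+z. ennreal (indicator ?S z * \<bar>?k z\<bar>) \<partial>lborel) = (\<integral>\<^sup>+z. ennreal (indicator ?S z * \<bar>?k z\<bar>) \<partial>lebesgue)"
      by (rule nn_integral_completion[symmetric])
    also have "\<dots> \<le> J"
      unfolding J_def by (rule nn_integral_mono) (use \<open>B \<subseteq> \<Omega>\<close> B in \<open>auto simp: indicator_def\<close>)
    finally show ?thesis .
  qed
  have "hausdorff1 {z\<in>B. v i z = c} \<le> J + ennreal (2 * pi * R)"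
  proof (cases "J = \<infinity>")
    case False
    have S: "open ?S" by (simp add: open_Diff)
    have "(\<lambda>z. indicator ?S z *\<^sub>R \<bar>?k z\<bar>) \<in> borel_measurable borel"
      using S continuous_on_level_curvature[OF C2 reg] 
      by (intro borel_measurable_continuous_on_indicator continuous_on_rabs) auto
    then have int: "integrable lborel (\<lambda>z. indicator ?S z * \<bar>?k z\<bar>)"
      using J False by (intro integrableI_bounded) (auto simp: less_top top_unique abs_mult)
    have "hausdorff1 {z\<in>B. v i z = c} \<le> ennreal ((LINT z|lborel. indicator ?S z * \<bar>?k z\<bar>) + 2 * pi * R)"
      unfolding B by (rule level_curve_length_le[OF \<open>R > 0\<close> C2 reg int])
    also have "\<dots> = ennreal (LINT z|lborel. indicator ?S z * \<bar>?k z\<bar>) + ennreal (2 * pi * R)"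
      using \<open>R > 0\<close> by (intro ennreal_plus integral_nonneg_AE AE_I2) auto
    also have "ennreal (LINT z|lborel. indicator ?S z * \<bar>?k z\<bar>) = (\<integral>\<^sup>+z. ennreal (indicator ?S z * \<bar>?k z\<bar>) \<partial>lborel)"
      using int by (intro nn_integral_eq_integral[symmetric]) auto
    also have "\<dots> + ennreal (2 * pi * R) \<le> J + ennreal (2 * pi * R)"
      using J by (rule add_right_mono)
    finally show ?thesis .
  qed simp
  then show "hausdorff1 {z\<in>B. v i z = c}
             \<le> (\<integral>\<^sup>+z\<in>\<Omega> \<inter> B. ennreal \<bar>level_curvature (v i) z\<bar> \<partial>lebesgue)
               + ennreal (2 * pi * R)"
    by (simp only: J_def)
qed

end
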